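(* For a BNFP instance on a directed graph $G=(V,E)$ with $n=|V|$, $m=|E|$ and $B=\max_{i\in V}|b_i|$, the large capacity augmenting path algorithm (described in the context) correctly solves the BNFP in $O(m^2\log(nB))$ time.
   Context: BNFP: given a directed graph $G=(V,E)$ without multiple arcs, integer weights $c_{ij}$ and integer capacities $u_{ij}\ge0$ on arcs, and integers $b_i$ with $\sum_i b_i=0$, minimize $\max\{c_{ij}:x_{ij}>0\}$ subject to $\sum_{j:(i,j)\in E}x_{ij}-\sum_{j:(j,i)\in E}x_{ji}=b_i$ for all $i\in V$ and $0\le x_{ij}\le u_{ij}$. Let $S=\{i:b_i>0\}$, $T=\{i:b_i<0\}$, $\delta=\sum_{i\in S}b_i$. The auxiliary graph $G^*=(V^*,E^* )$ has $V^*=V\cup\{s,t\}$ and $E^*=E\cup\{(s,i):i\in S\}\cup\{(j,t):j\in T\}$, with capacity $b_i$ on $(s,i)$, $-b_j$ on $(j,t)$, and weight $0$ on these new arcs; $m^*=|E^*|$. For real $\alpha$, $G^*(\alpha)$ is the spanning subgraph of $G^*$ containing the arcs of weight at most $\alpha$. Let $c_{\sigma(1)}<\dots<c_{\sigma(\varphi)}$ be the distinct arc weights of $G$. Large capacity augmenting path algorithm: (1) Solve a maximum flow problem on $G^*$; if its value is less than $\delta$, stop (BNFP infeasible). (2) Otherwise set $k=0$ and $x^0=0$. Repeat: set $k:=k+1$ and $x^k:=x^{k-1}$; form the residual graph of $G^*(c_{\sigma(k)})$ with respect to the current flow; while this residual graph contains an $s$–$t$ augmenting path $P$ with residual capacity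 at least $(\delta-v(x^{k-1}))/m^*$, augment $\varepsilon$ units of flow along $P$, where $\varepsilon$ is the residual capacity of $P$, and update $x^k$, $v(x^k)$ and the residual graph; until $v(x^k)=\delta$. (3) Output the restriction of $x^k$ to the arcs of $E$ as the BNFP solution. Here $v(x)$ is the value of an $s$–$t$ flow $x$.
   Formalization: As literally stated the algorithm can fail: here the path threshold uses the deficit of the current flow, not of x^{k-1}; the new arcs get weight min(0, least c_ij) instead of 0; and the time bound is asserted for B ≥ 1 and n = O(m) (all but graphs dominated by isolated vertices). *)

theory Defs
  imports Complex_Main "HOL-Library.Extended_Real" "Graph_Theory.Graph_Theory"
begin

section \<open>The bottleneck network flow problem\<close>

record 'v bnfp =
  graph  :: "'v pair_pre_digraph"
  weight :: "'v \<times> 'v \<Rightarrow> int"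
  cap    :: "'v \<times> 'v \<Rightarrow> int"
  bal    :: "'v \<Rightarrow> int"

abbreviation VV :: "'v bnfp \<Rightarrow> 'v set" where "VV I \<equiv> pverts (graph I)"
abbreviation EE :: "'v bnfp \<Rightarrow> ('v \<times> 'v) set" where "EE I \<equiv> parcs (graph I)"

definition bnfp_instance :: "'v bnfp \<Rightarrow> bool" where
  "bnfp_instance I \<longleftrightarrow>
     pair_fin_digraph (graph I) \<and> VV I \<noteq> {} \<and>
     (\<forall>e\<in>EE I. 0 \<le> cap I e) \<and> (\<Sum>i\<in>VV I. bal I i) = 0"

definition net_out :: "'a pair_pre_digraph \<Rightarrow> ('a \<times> 'a \<Rightarrow> real) \<Rightarrow> 'a \<Rightarrow> real" where
  "net_out H x i = (\<Sum>j | (i, j) \<in> parcs H. x (i, j)) - (\<Sum>j | (j, i) \<in> parcs H. x (j, i))"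

definition feasible :: "'v bnfp \<Rightarrow> ('v \<times> 'v \<Rightarrow> real) \<Rightarrow> bool" where
  "feasible I x \<longleftrightarrow>
     (\<forall>i\<in>VV I. net_out (graph I) x i = bal I i) \<and>
     (\<forall>e\<in>EE I. 0 \<le> x e \<and> x e \<le> cap I e)"

text \<open>The supremum ranges over a finite set, so it is a maximum; it is \<open>-\<infinity>\<close> for the zero flow.\<close>

definition bottleneck :: "'v bnfp \<Rightarrow> ('v \<times> 'v \<Rightarrow> real) \<Rightarrow> ereal" where
  "bottleneck I x = (SUP e\<in>{e \<in> EE I. 0 < x e}. ereal (real_of_int (weight I e)))"

definition optimal :: "'v bnfp \<Rightarrow> ('v \<times> 'v \<Rightarrow> real) \<Rightarrow> bool" where
  "optimal I x \<longleftrightarrow> feasible I x \<and> (\<forall>y. feasible I y \<longrightarrow> bottleneck I x \<le> bottleneck I y)"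

definition max_supply :: "'v bnfp \<Rightarrow> int" where
  "max_supply I = Max ((\<lambda>i. \<bar>bal I i\<bar>) ` VV I)"


section \<open>The auxiliary graph\<close>

datatype 'v node = Src | Snk | Vtx 'v

definition sources :: "'v bnfp \<Rightarrow> 'v set" where "sources I = {i \<in> VV I. 0 < bal I i}"
definition sinks :: "'v bnfp \<Rightarrow> 'v set" where "sinks I = {i \<in> VV I. bal I i < 0}"
definition demand :: "'v bnfp \<Rightarrow> int" where "demand I = (\<Sum>i\<in>sources I. bal I i)"

definition star :: "'v bnfp \<Rightarrow> 'v node pair_pre_digraph" where
  "star I = \<lparr> pverts = {Src, Snk} \<union> Vtx ` VV I,
     parcs = (\<lambda>(i, j). (Vtx i, Vtx j)) ` EE I
             \<union> (\<lambda>i. (Src, Vtx i)) ` sources I \<union> (\<lambda>j. (Vtx j, Snk)) ` sinks I \<rparr>"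

abbreviation mstar :: "'v bnfp \<Rightarrow> nat" where "mstar I \<equiv> card (parcs (star I))"

fun star_cap :: "'v bnfp \<Rightarrow> 'v node \<times> 'v node \<Rightarrow> int" where
  "star_cap I (Vtx i, Vtx j) = cap I (i, j)"
| "star_cap I (Src, Vtx i) = bal I i"
| "star_cap I (Vtx j, Snk) = - bal I j"
| "star_cap I _ = 0"

text \<open>
  The new arcs have weight 0 if no arc of \<open>G\<close> has negative weight. In general they get the
  least weight of all, so that they belong to every threshold graph: with weight 0, a threshold
  graph for a negative \<open>\<alpha>\<close> would have no arc at \<open>Src\<close> and the method would miss negative optima.
\<close>

definition new_weight :: "'v bnfp \<Rightarrow> int" where
  "new_weight I = Min (insert 0 (weight I ` EE I))"

fun star_weight :: "'v bnfp \<Rightarrow> 'v node \<times> 'v node \<Rightarrow> int" where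
  "star_weight I (Vtx i, Vtx j) = weight I (i, j)"
| "star_weight I _ = new_weight I"

definition star_le :: "'v bnfp \<Rightarrow> real \<Rightarrow> 'v node pair_pre_digraph" where
  "star_le I \<alpha> = \<lparr> pverts = pverts (star I), parcs = {e \<in> parcs (star I). real_of_int (star_weight I e) \<le> \<alpha>} \<rparr>"

text \<open>
  The \<open>k\<close>-th smallest distinct weight, \<open>k = 1, 2, \<dots>\<close>. It is unspecified if there is no such
  weight; phase 1 refers to it if \<open>G\<close> has no arcs, but then phase 1 is reached only if all
  supplies are 0, and every threshold graph is arcless.
\<close>

definition nth_weight :: "'v bnfp \<Rightarrow> nat \<Rightarrow> int" where
  "nth_weight I k = sorted_list_of_set (weight I ` EE I) ! (k - 1)"

abbreviation num_weights :: "'v bnfp \<Rightarrow> nat" where "num_weights I \<equiv> card (weight I ` EE I)"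

type_synonym 'v flow = "'v node \<times> 'v node \<Rightarrow> real"

definition is_flow :: "'v bnfp \<Rightarrow> 'v flow \<Rightarrow> bool" where
  "is_flow I x \<longleftrightarrow>
     (\<forall>e\<in>parcs (star I). 0 \<le> x e \<and> x e \<le> star_cap I e) \<and>
     (\<forall>i\<in>pverts (star I) - {Src, Snk}. net_out (star I) x i = 0)"

definition flow_val :: "'v bnfp \<Rightarrow> 'v flow \<Rightarrow> real" where
  "flow_val I x = net_out (star I) x Src"

definition max_flow :: "'v bnfp \<Rightarrow> 'v flow \<Rightarrow> bool" where
  "max_flow I x \<longleftrightarrow> is_flow I x \<and> (\<forall>y. is_flow I y \<longrightarrow> flow_val I y \<le> flow_val I x)"


section \<open>Residual graphs and augmenting paths\<close>

text \<open>A residual arc is an arc with a flag: \<open>(e, True)\<close> traverses \<open>e\<close> forwards, \<open>(e, False)\<close> backwards.\<close>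

type_synonym 'a rarc = "('a \<times> 'a) \<times> bool"

fun rtail :: "'a rarc \<Rightarrow> 'a" where "rtail ((i, j), d) = (if d then i else j)"
fun rhead :: "'a rarc \<Rightarrow> 'a" where "rhead ((i, j), d) = (if d then j else i)"

fun rescap :: "('a \<times> 'a \<Rightarrow> 'n::minus) \<Rightarrow> ('a \<times> 'a \<Rightarrow> 'n) \<Rightarrow> 'a rarc \<Rightarrow> 'n" where
  "rescap u x (e, d) = (if d then u e - x e else x e)"

definition residual ::
    "'v bnfp \<Rightarrow> real \<Rightarrow> 'v flow \<Rightarrow> ('v node, 'v node rarc) pre_digraph" where
  "residual I \<alpha> x = \<lparr> verts = pverts (star_le I \<alpha>),
     arcs = {(e, d). e \<in> parcs (star_le I \<alpha>) \<and> 0 < rescap (\<lambda>e. real_of_int (star_cap I e)) x (e, d)},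
     tail = rtail, head = rhead \<rparr>"

definition augmenting_path :: "'v bnfp \<Rightarrow> real \<Rightarrow> 'v flow \<Rightarrow> 'v node rarc list \<Rightarrow> bool" where
  "augmenting_path I \<alpha> x P \<longleftrightarrow> pre_digraph.apath (residual I \<alpha> x) Src P Snk"

definition path_cap :: "'v bnfp \<Rightarrow> 'v flow \<Rightarrow> 'v node rarc list \<Rightarrow> real" where
  "path_cap I x P = Min (rescap (\<lambda>e. real_of_int (star_cap I e)) x ` set P)"

definition augment :: "'v flow \<Rightarrow> real \<Rightarrow> 'v node rarc list \<Rightarrow> 'v flow" where
  "augment x \<epsilon> P = (\<lambda>e. x e + (if (e, True) \<in> set P then \<epsilon> else 0)
                          - (if (e, False) \<in> set P then \<epsilon> else 0))"


section \<open>The large capacity augmenting path algorithm\<close>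

text \<open>
  In \<open>Phase k x\<close>, \<open>x\<close> is the current flow \<open>x\<^sup>k\<close>.

  The deficit in the threshold is that of the flow current when a path is sought. The deficit
  must not be frozen at the beginning of the phase: on a graph with one weight whose only routes
  are two disjoint paths of two arcs, of capacities 1000 and 1, with \<open>\<delta> = 1001\<close> and
  \<open>m\<^sup>* = 6\<close>, the frozen threshold \<open>1001/6\<close> would rule out the second path and no phase would
  be left to use it.
\<close>

datatype 'v config =
    Start
  | Phase nat "'v flow"
  | Infeasible
  | Output "'v \<times> 'v \<Rightarrow> real"

definition large_path :: "'v bnfp \<Rightarrow> nat \<Rightarrow> 'v flow \<Rightarrow> 'v node rarc list \<Rightarrow> bool" where
  "large_path I k x P \<longleftrightarrow>
     augmenting_path I (nth_weight I k) x P \<and>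
     path_cap I x P \<ge> (demand I - flow_val I x) / mstar I"

definition restrict_flow :: "'v bnfp \<Rightarrow> 'v flow \<Rightarrow> 'v \<times> 'v \<Rightarrow> real" where
  "restrict_flow I x = (\<lambda>e. if e \<in> EE I then x (Vtx (fst e), Vtx (snd e)) else 0)"

inductive lcap_step :: "'v bnfp \<Rightarrow> 'v config \<Rightarrow> 'v config \<Rightarrow> bool" for I where
  infeasible: "max_flow I y \<Longrightarrow> flow_val I y < demand I \<Longrightarrow> lcap_step I Start Infeasible"
| init: "max_flow I y \<Longrightarrow> \<not> flow_val I y < demand I \<Longrightarrow> lcap_step I Start (Phase 1 (\<lambda>_. 0))"
| augment: "large_path I k x P \<Longrightarrow>
     lcap_step I (Phase k x) (Phase k (augment x (path_cap I x P) P))"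
| next_phase: "(\<nexists>P. large_path I k x P) \<Longrightarrow> flow_val I x \<noteq> demand I \<Longrightarrow> k < num_weights I \<Longrightarrow>
     lcap_step I (Phase k x) (Phase (Suc k) x)"
| finish: "(\<nexists>P. large_path I k x P) \<Longrightarrow> flow_val I x = demand I \<Longrightarrow>
     lcap_step I (Phase k x) (Output (restrict_flow I x))"

fun correct_answer :: "'v bnfp \<Rightarrow> 'v config \<Rightarrow> bool" where
  "correct_answer I Infeasible \<longleftrightarrow> (\<nexists>x. feasible I x)"
| "correct_answer I (Output x) \<longleftrightarrow> optimal I x"
| "correct_answer I _ \<longleftrightarrow> False"

text \<open>
  Whatever paths are chosen, the run ends, and it ends with a correct answer (in particular,
  it does not run out of weights).
\<close>

definition lcap_correct :: "'v bnfp \<Rightarrow> bool" where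
  "lcap_correct I \<longleftrightarrow>
     (\<nexists>r :: nat \<Rightarrow> 'v config. r 0 = Start \<and> (\<forall>i. lcap_step I (r i) (r (Suc i)))) \<and>
     (\<forall>z. (lcap_step I)\<^sup>*\<^sup>* Start z \<and> (\<nexists>z'. lcap_step I z z') \<longrightarrow> correct_answer I z)"


section \<open>Running time\<close>

subsection \<open>Timed while-programs\<close>

text \<open>
  \<open>Do f\<close> and every test cost one unit. In the program below each of them
  performs a bounded number of unit-cost random access machine operations: integer arithmetic
  and comparison, reading or writing one array cell (arrays indexed by vertices or arcs are
  functions), and \<open>hd\<close>, \<open>tl\<close>, \<open>#\<close> on linked lists.
\<close>

datatype 's com =
    Do "'s \<Rightarrow> 's"
  | Seq "'s com" "'s com"              (infixr ";;" 60)
  | If "'s \<Rightarrow> bool" "'s com" "'s com"   ("(IF _/ THEN _/ ELSE _)" [0, 0, 61] 61)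
  | While "'s \<Rightarrow> bool" "'s com"         ("(WHILE _/ DO _)" [0, 61] 61)

inductive exec :: "'s com \<Rightarrow> 's \<Rightarrow> nat \<Rightarrow> 's \<Rightarrow> bool" where
  Do: "exec (Do f) s 1 (f s)"
| Seq: "exec c s p s' \<Longrightarrow> exec d s' q s'' \<Longrightarrow> exec (c ;; d) s (p + q) s''"
| IfTrue: "g s \<Longrightarrow> exec c s p s' \<Longrightarrow> exec (IF g THEN c ELSE d) s (1 + p) s'"
| IfFalse: "\<not> g s \<Longrightarrow> exec d s p s' \<Longrightarrow> exec (IF g THEN c ELSE d) s (1 + p) s'"
| WhileFalse: "\<not> g s \<Longrightarrow> exec (WHILE g DO c) s 1 s"
| WhileTrue: "g s \<Longrightarrow> exec c s p s' \<Longrightarrow> exec (WHILE g DO c) s' q s'' \<Longrightarrow>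
     exec (WHILE g DO c) s (1 + p + q) s''"


subsection \<open>The implementation\<close>

record 'v ram =
  in_verts  :: "'v list"
  in_arcs   :: "('v \<times> 'v) list"
  in_weight :: "'v \<times> 'v \<Rightarrow> int"
  in_cap    :: "'v \<times> 'v \<Rightarrow> int"
  in_bal :: "'v \<Rightarrow> int"
  \<comment> \<open>\<open>adj i\<close> lists both kinds of residual arcs leaving \<open>i\<close>, whatever their residual capacity\<close>
  all_nodes :: "'v node list"
  all_links :: "('v node \<times> 'v node) list"
  adj       :: "'v node \<Rightarrow> 'v node rarc list"
  link_cap  :: "'v node \<times> 'v node \<Rightarrow> int"
  link_wt   :: "'v node \<times> 'v node \<Rightarrow> int"
  num_links :: int
  dem       :: int
  min_wt    :: int
  max_wt    :: int
  flw       :: "'v node \<times> 'v node \<Rightarrow> int"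
  fval      :: int
  level     :: int
  new_level :: int
  \<comment> \<open>residual capacity \<open>r\<close> is large if \<open>th_num \<le> th_den * r\<close>\<close>
  th_num    :: int
  th_den    :: int
  scale     :: int
  \<comment> \<open>\<open>via i\<close>: the arc along which \<open>i\<close> was labelled; \<open>work\<close>: stack of unscanned ends of adjacency lists\<close>
  labelled  :: "'v node \<Rightarrow> bool"
  via       :: "'v node \<Rightarrow> 'v node rarc"
  work      :: "'v node rarc list list"
  at_node   :: "'v node"
  amount    :: int
  todo_v    :: "'v list"
  todo_a    :: "('v \<times> 'v) list"
  todo_n    :: "'v node list"
  todo_l    :: "('v node \<times> 'v node) list"
  no_sol    :: bool
  sol       :: "'v \<times> 'v \<Rightarrow> int"

definition add_link ::
    "('v ram \<Rightarrow> 'v node \<times> 'v node) \<Rightarrow> ('v ram \<Rightarrow> int) \<Rightarrow> ('v ram \<Rightarrow> int) \<Rightarrow> 'v ram com" where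
  "add_link e u w =
     Do (\<lambda>\<sigma>. \<sigma>\<lparr>all_links := e \<sigma> # all_links \<sigma>, num_links := num_links \<sigma> + 1,
               link_cap := (link_cap \<sigma>)(e \<sigma> := u \<sigma>), link_wt := (link_wt \<sigma>)(e \<sigma> := w \<sigma>)\<rparr>) ;;
     Do (\<lambda>\<sigma>. \<sigma>\<lparr>adj := (adj \<sigma>)(fst (e \<sigma>) := (e \<sigma>, True) # adj \<sigma> (fst (e \<sigma>)))\<rparr>) ;;
     Do (\<lambda>\<sigma>. \<sigma>\<lparr>adj := (adj \<sigma>)(snd (e \<sigma>) := (e \<sigma>, False) # adj \<sigma> (snd (e \<sigma>)))\<rparr>)"

definition build :: "'v ram com" where
  "build =
     Do (\<lambda>\<sigma>. \<sigma>\<lparr>all_nodes := [Src, Snk], all_links := [], num_links := 0, dem := 0,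
               min_wt := 0, max_wt := 0, adj := (adj \<sigma>)(Src := [], Snk := []),
               todo_v := in_verts \<sigma>\<rparr>) ;;
     (WHILE (\<lambda>\<sigma>. todo_v \<sigma> \<noteq> []) DO
        Do (\<lambda>\<sigma>. \<sigma>\<lparr>all_nodes := Vtx (hd (todo_v \<sigma>)) # all_nodes \<sigma>,
                  adj := (adj \<sigma>)(Vtx (hd (todo_v \<sigma>)) := []), todo_v := tl (todo_v \<sigma>)\<rparr>)) ;;
     Do (\<lambda>\<sigma>. \<sigma>\<lparr>todo_a := in_arcs \<sigma>\<rparr>) ;;
     (WHILE (\<lambda>\<sigma>. todo_a \<sigma> \<noteq> []) DO
        (add_link (\<lambda>\<sigma>. (Vtx (fst (hd (todo_a \<sigma>))), Vtx (snd (hd (todo_a \<sigma>)))))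
           (\<lambda>\<sigma>. in_cap \<sigma> (hd (todo_a \<sigma>))) (\<lambda>\<sigma>. in_weight \<sigma> (hd (todo_a \<sigma>))) ;;
         Do (\<lambda>\<sigma>. \<sigma>\<lparr>min_wt := min (min_wt \<sigma>) (in_weight \<sigma> (hd (todo_a \<sigma>))),
                   max_wt := max (max_wt \<sigma>) (in_weight \<sigma> (hd (todo_a \<sigma>))),
                   todo_a := tl (todo_a \<sigma>)\<rparr>))) ;;
     Do (\<lambda>\<sigma>. \<sigma>\<lparr>todo_v := in_verts \<sigma>\<rparr>) ;;
     (WHILE (\<lambda>\<sigma>. todo_v \<sigma> \<noteq> []) DO
        ((IF (\<lambda>\<sigma>. 0 < in_bal \<sigma> (hd (todo_v \<sigma>)))
          THEN (add_link (\<lambda>\<sigma>. (Src, Vtx (hd (todo_v \<sigma>))))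
                  (\<lambda>\<sigma>. in_bal \<sigma> (hd (todo_v \<sigma>))) min_wt ;;
                Do (\<lambda>\<sigma>. \<sigma>\<lparr>dem := dem \<sigma> + in_bal \<sigma> (hd (todo_v \<sigma>))\<rparr>))
          ELSE (IF (\<lambda>\<sigma>. in_bal \<sigma> (hd (todo_v \<sigma>)) < 0)
                THEN add_link (\<lambda>\<sigma>. (Vtx (hd (todo_v \<sigma>)), Snk))
                       (\<lambda>\<sigma>. - in_bal \<sigma> (hd (todo_v \<sigma>))) min_wt
                ELSE Do (\<lambda>\<sigma>. \<sigma>))) ;;
         Do (\<lambda>\<sigma>. \<sigma>\<lparr>todo_v := tl (todo_v \<sigma>)\<rparr>)))"

definition zero_flow :: "'v ram com" where
  "zero_flow =
     Do (\<lambda>\<sigma>. \<sigma>\<lparr>fval := 0, todo_l := all_links \<sigma>\<rparr>) ;;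
     (WHILE (\<lambda>\<sigma>. todo_l \<sigma> \<noteq> []) DO
        Do (\<lambda>\<sigma>. \<sigma>\<lparr>flw := (flw \<sigma>)(hd (todo_l \<sigma>) := 0), todo_l := tl (todo_l \<sigma>)\<rparr>))"

definition usable :: "'v ram \<Rightarrow> 'v node rarc \<Rightarrow> bool" where
  "usable \<sigma> a \<longleftrightarrow>
     link_wt \<sigma> (fst a) \<le> level \<sigma> \<and> \<not> labelled \<sigma> (rhead a) \<and>
     0 < rescap (link_cap \<sigma>) (flw \<sigma>) a \<and>
     th_num \<sigma> \<le> th_den \<sigma> * rescap (link_cap \<sigma>) (flw \<sigma>) a"

definition search :: "'v ram com" where
  "search =
     Do (\<lambda>\<sigma>. \<sigma>\<lparr>todo_n := all_nodes \<sigma>\<rparr>) ;;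
     (WHILE (\<lambda>\<sigma>. todo_n \<sigma> \<noteq> []) DO
        Do (\<lambda>\<sigma>. \<sigma>\<lparr>labelled := (labelled \<sigma>)(hd (todo_n \<sigma>) := False), todo_n := tl (todo_n \<sigma>)\<rparr>)) ;;
     Do (\<lambda>\<sigma>. \<sigma>\<lparr>labelled := (labelled \<sigma>)(Src := True), work := [adj \<sigma> Src]\<rparr>) ;;
     (WHILE (\<lambda>\<sigma>. work \<sigma> \<noteq> [] \<and> \<not> labelled \<sigma> Snk) DO
        (IF (\<lambda>\<sigma>. hd (work \<sigma>) = [])
         THEN Do (\<lambda>\<sigma>. \<sigma>\<lparr>work := tl (work \<sigma>)\<rparr>)
         ELSE (IF (\<lambda>\<sigma>. usable \<sigma> (hd (hd (work \<sigma>))))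
               THEN Do (\<lambda>\<sigma>. let a = hd (hd (work \<sigma>)); i = rhead a in
                      \<sigma>\<lparr>labelled := (labelled \<sigma>)(i := True), via := (via \<sigma>)(i := a),
                        work := adj \<sigma> i # tl (hd (work \<sigma>)) # tl (work \<sigma>)\<rparr>)
               ELSE Do (\<lambda>\<sigma>. \<sigma>\<lparr>work := tl (hd (work \<sigma>)) # tl (work \<sigma>)\<rparr>))))"

text \<open>Augments along the path found by \<open>search\<close>, which is read off backwards from \<open>Snk\<close>.\<close>

definition augment_found :: "'v ram com" where
  "augment_found =
     Do (\<lambda>\<sigma>. \<sigma>\<lparr>at_node := Snk, amount := rescap (link_cap \<sigma>) (flw \<sigma>) (via \<sigma> Snk)\<rparr>) ;;
     (WHILE (\<lambda>\<sigma>. at_node \<sigma> \<noteq> Src) DO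
        Do (\<lambda>\<sigma>. let a = via \<sigma> (at_node \<sigma>) in
          \<sigma>\<lparr>amount := min (amount \<sigma>) (rescap (link_cap \<sigma>) (flw \<sigma>) a), at_node := rtail a\<rparr>)) ;;
     Do (\<lambda>\<sigma>. \<sigma>\<lparr>at_node := Snk\<rparr>) ;;
     (WHILE (\<lambda>\<sigma>. at_node \<sigma> \<noteq> Src) DO
        Do (\<lambda>\<sigma>. let a = via \<sigma> (at_node \<sigma>); e = fst a in
          \<sigma>\<lparr>flw := (flw \<sigma>)(e := (if snd a then flw \<sigma> e + amount \<sigma> else flw \<sigma> e - amount \<sigma>)),
            at_node := rtail a\<rparr>)) ;;
     Do (\<lambda>\<sigma>. \<sigma>\<lparr>fval := fval \<sigma> + amount \<sigma>\<rparr>)"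

definition augment_while_large :: "('v ram \<Rightarrow> int) \<Rightarrow> ('v ram \<Rightarrow> int) \<Rightarrow> 'v ram com" where
  "augment_while_large p q =
     Do (\<lambda>\<sigma>. \<sigma>\<lparr>th_num := p \<sigma>, th_den := q \<sigma>\<rparr>) ;; search ;;
     (WHILE (\<lambda>\<sigma>. labelled \<sigma> Snk) DO
        (augment_found ;; Do (\<lambda>\<sigma>. \<sigma>\<lparr>th_num := p \<sigma>, th_den := q \<sigma>\<rparr>) ;; search))"

text \<open>A maximum flow of the whole auxiliary graph, by capacity scaling.\<close>

definition solve_max_flow :: "'v ram com" where
  "solve_max_flow =
     zero_flow ;;
     Do (\<lambda>\<sigma>. \<sigma>\<lparr>level := max_wt \<sigma>, scale := 1\<rparr>) ;;
     (WHILE (\<lambda>\<sigma>. 2 * scale \<sigma> \<le> dem \<sigma>) DO Do (\<lambda>\<sigma>. \<sigma>\<lparr>scale := 2 * scale \<sigma>\<rparr>)) ;;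
     (WHILE (\<lambda>\<sigma>. 1 \<le> scale \<sigma>) DO
        (augment_while_large scale (\<lambda>_. 1) ;; Do (\<lambda>\<sigma>. \<sigma>\<lparr>scale := scale \<sigma> div 2\<rparr>)))"

definition raise_level :: "'v ram com" where
  "raise_level =
     Do (\<lambda>\<sigma>. \<sigma>\<lparr>new_level := max_wt \<sigma>, todo_a := in_arcs \<sigma>\<rparr>) ;;
     (WHILE (\<lambda>\<sigma>. todo_a \<sigma> \<noteq> []) DO
        Do (\<lambda>\<sigma>. let w = in_weight \<sigma> (hd (todo_a \<sigma>)) in
          \<sigma>\<lparr>new_level := (if level \<sigma> < w \<and> w < new_level \<sigma> then w else new_level \<sigma>),
            todo_a := tl (todo_a \<sigma>)\<rparr>)) ;;
     Do (\<lambda>\<sigma>. \<sigma>\<lparr>level := new_level \<sigma>\<rparr>)"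

definition phase :: "'v ram com" where
  "phase = raise_level ;; augment_while_large (\<lambda>\<sigma>. dem \<sigma> - fval \<sigma>) num_links"

definition write_output :: "'v ram com" where
  "write_output =
     Do (\<lambda>\<sigma>. \<sigma>\<lparr>no_sol := False, todo_a := in_arcs \<sigma>\<rparr>) ;;
     (WHILE (\<lambda>\<sigma>. todo_a \<sigma> \<noteq> []) DO
        Do (\<lambda>\<sigma>. let e = hd (todo_a \<sigma>) in
          \<sigma>\<lparr>sol := (sol \<sigma>)(e := flw \<sigma> (Vtx (fst e), Vtx (snd e))), todo_a := tl (todo_a \<sigma>)\<rparr>))"

definition lcap_program :: "'v ram com" where
  "lcap_program =
     build ;; solve_max_flow ;;
     (IF (\<lambda>\<sigma>. fval \<sigma> < dem \<sigma>)
      THEN Do (\<lambda>\<sigma>. \<sigma>\<lparr>no_sol := True\<rparr>)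
      ELSE (zero_flow ;; Do (\<lambda>\<sigma>. \<sigma>\<lparr>level := min_wt \<sigma> - 1\<rparr>) ;;
            phase ;; (WHILE (\<lambda>\<sigma>. fval \<sigma> \<noteq> dem \<sigma>) DO phase) ;;
            write_output))"

text \<open>The input is given by lists in arbitrary order; all other cells may contain anything.\<close>

definition loaded :: "'v bnfp \<Rightarrow> 'v ram \<Rightarrow> bool" where
  "loaded I \<sigma> \<longleftrightarrow>
     distinct (in_verts \<sigma>) \<and> set (in_verts \<sigma>) = VV I \<and>
     distinct (in_arcs \<sigma>) \<and> set (in_arcs \<sigma>) = EE I \<and>
     (\<forall>e\<in>EE I. in_weight \<sigma> e = weight I e \<and> in_cap \<sigma> e = cap I e) \<and>
     (\<forall>i\<in>VV I. in_bal \<sigma> i = bal I i)"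

definition answer :: "'v bnfp \<Rightarrow> 'v ram \<Rightarrow> 'v config" where
  "answer I \<sigma> = (if no_sol \<sigma> then Infeasible
                 else Output (\<lambda>e. if e \<in> EE I then real_of_int (sol \<sigma> e) else 0))"

end

theory Submission
  imports Defs "HOL-Library.Log_Nat"
begin

text \<open>
  If no augmenting path of residual capacity at least \<open>D\<close> exists in a threshold graph, the nodes reachable
  over large residual arcs form a cut showing that the value of the current flow is less than \<open>m\<^sup>* D\<close> below the
  maximum. With \<open>D = (\<delta> - v(x)) / m\<^sup>*\<close> this says that a phase ends without saturating the flow
  only if its threshold graph has no flow of value \<open>\<delta>\<close>. So the threshold of the phase that finishes is a lower
  bound for every feasible solution.

  Each large augmentation removes the fraction \<open>1/m\<^sup>*\<close> of the deficit, so \<open>m\<^sup>* ln(\<delta> - v(x))\<close> drops by at least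
  one each time: over all phases there are \<open>O(m log(nB))\<close> augmentations, plus at most \<open>m\<close> unsuccessful searches.
  Capacity scaling finds the initial maximum flow with \<open>O(m)\<close> augmentations for each of \<open>O(log(nB))\<close> scales, by the
  same cut argument. A search takes \<open>O(m + n)\<close> steps, and \<open>n = O(m)\<close>.
\<close>

section \<open>Flows and cuts\<close>

text \<open>Solutions may be real-valued, so every cut estimate compares the current flow with an
  arbitrary real flow. The flows of the algorithm itself stay integral, and the counting rests on
  this: a positive deficit is at least 1, so its logarithm is nonnegative, and at scale 1 no slack
  is left. The cut bound of a phase has to be strict. The search asks for capacity at least
  \<open>D\<close>, so residual capacities across the cut are less than \<open>D\<close>; only a gap
  smaller than the whole deficit excludes a flow of value \<delta> at that threshold. The phases of
  the program are not proved correct on their own. Their loops carry the statement that the abstract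
  algorithm can reach the current flow, so the output inherits its correctness from the invariant of
  \<open>lcap_step\<close>, and only time remains to be counted. Two degenerate cases need care
  throughout: without arcs \<open>nth_weight\<close> is unspecified, and without arcs in the
  auxiliary graph the threshold divides by 0. A feasible instance without arcs has demand 0, which
  makes both harmless.\<close>

lemma net_out_eq_arc_sum:
  assumes "finite (parcs H)"
  shows "net_out H x i =
    (\<Sum>e\<in>parcs H. x e * (of_bool (fst e = i) - of_bool (snd e = i)))"
proof -
  have "(\<Sum>j | (i, j) \<in> parcs H. x (i, j)) = (\<Sum>e\<in>{e \<in> parcs H. fst e = i}. x e)"
    by (rule sum.reindex_bij_witness[of _ snd "Pair i"]) auto
  moreover have "(\<Sum>j | (j, i) \<in> parcs H. x (j, i)) = (\<Sum>e\<in>{e \<in> parcs H. snd e = i}. x e)"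
    by (rule sum.reindex_bij_witness[of _ fst "\<lambda>j. (j, i)"]) auto
  moreover have "(\<Sum>e\<in>{e \<in> parcs H. Q e}. x e) = (\<Sum>e\<in>parcs H. x e * of_bool (Q e))" for Q
    using assms by (simp add: sum.inter_filter of_bool_def) (rule sum.cong; simp)
  ultimately show ?thesis
    unfolding net_out_def by (simp add: right_diff_distrib sum_subtractf)
qed

text \<open>An arc with both ends in \<open>R\<close> cancels, so only arcs across the boundary of
  \<open>R\<close> remain; every cut argument rests on this form.\<close>

lemma sum_net_out:
  assumes "finite (parcs H)" "finite R"
  shows "(\<Sum>i\<in>R. net_out H x i) =
    (\<Sum>e\<in>parcs H. x e * (of_bool (fst e \<in> R) - of_bool (snd e \<in> R)))"
proof -
  have d: "(\<Sum>i\<in>R. of_bool (a = i)) = (of_bool (a \<in> R) :: real)" for a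
    using assms(2) by (simp add: of_bool_def sum.delta)
  have "(\<Sum>i\<in>R. net_out H x i) =
    (\<Sum>e\<in>parcs H. \<Sum>i\<in>R. x e * (of_bool (fst e = i) - of_bool (snd e = i)))"
    unfolding net_out_eq_arc_sum[OF assms(1)] by (rule sum.swap)
  also have "\<dots> = (\<Sum>e\<in>parcs H. x e * (of_bool (fst e \<in> R) - of_bool (snd e \<in> R)))"
    by (simp add: sum_distrib_left[symmetric] sum_subtractf d)
  finally show ?thesis .
qed

section \<open>Walks along residual arcs\<close>

fun rwalk :: "'a \<Rightarrow> 'a rarc list \<Rightarrow> 'a \<Rightarrow> bool" where
  "rwalk u [] v \<longleftrightarrow> u = v"
| "rwalk u (a # P) v \<longleftrightarrow> rtail a = u \<and> rwalk (rhead a) P v"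

lemma rwalk_append: "rwalk u (P @ Q) w \<longleftrightarrow> (\<exists>v. rwalk u P v \<and> rwalk v Q w)"
  by (induction P arbitrary: u) auto

lemma rwalk_snoc: "rwalk u (P @ [a]) w \<longleftrightarrow> rwalk u P (rtail a) \<and> rhead a = w"
  by (auto simp: rwalk_append)

lemma rwalk_prefix:
  assumes "rwalk u P v" "w \<in> set (u # map rhead P)"
  shows "\<exists>Q R. P = Q @ R \<and> rwalk u Q w"
  using assms
proof (induction P arbitrary: u)
  case (Cons a P)
  show ?case
  proof (cases "w = u")
    case True
    then show ?thesis by (intro exI[of _ "[]"] exI[of _ "a # P"]) auto
  next
    case False
    with Cons.prems have "rwalk (rhead a) P v" "w \<in> set (rhead a # map rhead P)" by auto
    from Cons.IH[OF this] obtain Q R where "P = Q @ R" "rwalk (rhead a) Q w" by auto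
    with Cons.prems show ?thesis by (intro exI[of _ "a # Q"] exI[of _ R]) auto
  qed
qed auto

text \<open>Loop erasure while the walk grows: if the new head was visited before, the walk is cut
  back to that visit. Only arcs of \<open>P\<close> survive, so properties of all arcs carry
  over.\<close>

lemma rwalk_to_distinct:
  assumes "rwalk u P v"
  shows "\<exists>Q. set Q \<subseteq> set P \<and> rwalk u Q v \<and> distinct (u # map rhead Q)"
  using assms
proof (induction P arbitrary: v rule: rev_induct)
  case Nil
  then show ?case by (intro exI[of _ "[]"]) auto
next
  case (snoc a P)
  from snoc.IH[of "rtail a"] snoc.prems obtain Q where
    Q: "set Q \<subseteq> set P" "rwalk u Q (rtail a)" "distinct (u # map rhead Q)" "rhead a = v"
    by (auto simp: rwalk_snoc)
  show ?case
  proof (cases "v \<in> set (u # map rhead Q)")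
    case True
    from rwalk_prefix[OF Q(2) True] obtain Q1 Q2 where "Q = Q1 @ Q2" "rwalk u Q1 v" by blast
    with Q show ?thesis by (intro exI[of _ Q1]) auto
  next
    case False
    with Q show ?thesis by (intro exI[of _ "Q @ [a]"]) (auto simp: rwalk_snoc)
  qed
qed

text \<open>A residual arc in either direction moves \<epsilon> from its tail to its head, and along
  the walk these changes telescope. \<open>distinct P\<close> matters because \<open>augment\<close>
  tests membership and thus counts each residual arc once.\<close>

lemma net_out_augment:
  assumes "finite (parcs H)" "rwalk u P v" "distinct P" "fst ` set P \<subseteq> parcs H"
  shows "net_out H (augment x \<epsilon> P) i = net_out H x i + \<epsilon> * (of_bool (i = u) - of_bool (i = v))"
  using assms(2-)
proof (induction P arbitrary: u)
  case Nil
  then show ?case by (simp add: augment_def)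
next
  case (Cons a P)
  obtain e d where a: "a = (e, d)" by (cases a)
  define s :: real where "s = (if d then \<epsilon> else - \<epsilon>)"
  have eq: "augment x \<epsilon> (a # P) e' = augment x \<epsilon> P e' + (if e' = e then s else 0)" for e'
    using Cons.prems(2) unfolding a by (auto simp: augment_def s_def)
  have "net_out H (augment x \<epsilon> (a # P)) i = net_out H (augment x \<epsilon> P) i
      + (\<Sum>e'\<in>parcs H. (if e' = e then s else 0) * (of_bool (fst e' = i) - of_bool (snd e' = i)))"
    unfolding net_out_eq_arc_sum[OF assms(1)] eq by (simp add: distrib_right sum.distrib)
  also have "(\<Sum>e'\<in>parcs H. (if e' = e then s else 0) * (of_bool (fst e' = i) - of_bool (snd e' = i)))
     = (\<Sum>e'\<in>parcs H. if e' = e then s * (of_bool (fst e' = i) - of_bool (snd e' = i)) else 0)"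
    by (rule sum.cong) auto
  also have "\<dots> = s * (of_bool (fst e = i) - of_bool (snd e = i))"
    using Cons.prems(3) assms(1) unfolding a by (simp add: sum.delta')
  also have "\<dots> = \<epsilon> * (of_bool (i = rtail a) - of_bool (i = rhead a))"
    unfolding a s_def by (cases e) auto
  also have "net_out H (augment x \<epsilon> P) i
      = net_out H x i + \<epsilon> * (of_bool (i = rhead a) - of_bool (i = v))"
    using Cons by auto
  finally show ?case using Cons.prems(1) by (simp add: algebra_simps)
qed

abbreviation res :: "'v bnfp \<Rightarrow> 'v flow \<Rightarrow> 'v node rarc \<Rightarrow> real" where
  "res I x \<equiv> rescap (\<lambda>e. real_of_int (star_cap I e)) x"

text \<open>\<open>rwalk\<close> does not mention a graph, so the same walk can be followed through
  changing flows and thresholds. This equivalence leaves the library's paths behind: simplicity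
  becomes distinctness of \<open>Src\<close> and the heads.\<close>

lemma augmenting_path_iff:
  "augmenting_path I \<alpha> x P \<longleftrightarrow>
     (\<forall>a\<in>set P. fst a \<in> parcs (star_le I \<alpha>) \<and> 0 < res I x a) \<and>
     rwalk Src P Snk \<and> distinct (Src # map rhead P)"
proof -
  let ?G = "residual I \<alpha> x"
  have cas: "pre_digraph.cas ?G u P v \<longleftrightarrow> rwalk u P v" for u v
    by (induction P arbitrary: u) (auto simp: pre_digraph.cas.simps residual_def)
  have verts: "pre_digraph.awalk_verts ?G u P = u # map rhead P" if "rwalk u P v" for u v
    using that by (induction P arbitrary: u)
      (auto simp: pre_digraph.awalk_verts.simps residual_def)
  have arcs: "a \<in> arcs ?G \<longleftrightarrow> fst a \<in> parcs (star_le I \<alpha>) \<and> 0 < res I x a" for a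
    by (cases a) (auto simp: residual_def)
  have "Src \<in> verts ?G" by (simp add: residual_def star_le_def star_def)
  then show ?thesis
    unfolding augmenting_path_def pre_digraph.apath_def pre_digraph.awalk_def
    by (simp add: cas subset_eq arcs) (use verts in auto)
qed

lemma path_cap_ge_iff:
  assumes "P \<noteq> []"
  shows "D \<le> path_cap I x P \<longleftrightarrow> (\<forall>a\<in>set P. D \<le> res I x a)"
  using assms by (simp add: path_cap_def)

lemma augmenting_path_not_Nil: "augmenting_path I \<alpha> x P \<Longrightarrow> P \<noteq> []"
  by (auto simp: augmenting_path_iff)

definition int_valued :: "'v flow \<Rightarrow> bool" where
  "int_valued x \<longleftrightarrow> (\<forall>e. x e \<in> \<int>)"

text \<open>A flow of a threshold graph is encoded as a flow of the whole auxiliary graph that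
  vanishes on the heavier arcs, so the flows of all phases share one type and one
  \<open>is_flow\<close>.\<close>

definition supported :: "'v bnfp \<Rightarrow> real \<Rightarrow> 'v flow \<Rightarrow> bool" where
  "supported I \<alpha> x \<longleftrightarrow> (\<forall>e\<in>parcs (star I) - parcs (star_le I \<alpha>). x e = 0)"

section \<open>The auxiliary graph of an instance, flow values and demand\<close>

locale bnfp =
  fixes I :: "'v bnfp"
  assumes inst: "bnfp_instance I"
begin

lemma finite_VV: "finite (VV I)" and finite_EE: "finite (EE I)"
  and EE_subset: "(i, j) \<in> EE I \<Longrightarrow> i \<in> VV I \<and> j \<in> VV I"
  and cap_nonneg: "e \<in> EE I \<Longrightarrow> 0 \<le> cap I e" and VV_nonempty: "VV I \<noteq> {}"
  and sum_bal: "(\<Sum>i\<in>VV I. bal I i) = 0"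
proof -
  interpret pair_fin_digraph "graph I" using inst by (simp add: bnfp_instance_def)
  show "finite (VV I)" "finite (EE I)" by (fact pair_finite_verts pair_finite_arcs)+
  show "(i, j) \<in> EE I \<Longrightarrow> i \<in> VV I \<and> j \<in> VV I" using in_arcsD1 in_arcsD2 by blast
qed (use inst in \<open>auto simp: bnfp_instance_def\<close>)

lemma finite_sources: "finite (sources I)" and finite_sinks: "finite (sinks I)"
  using finite_VV by (auto simp: sources_def sinks_def)

lemma finite_star_verts: "finite (pverts (star I))"
  and finite_star: "finite (parcs (star I))"
  using finite_VV finite_EE finite_sources finite_sinks by (auto simp: star_def)

lemma star_verts: "pverts (star I) = {Src, Snk} \<union> Vtx ` VV I"
  by (simp add: star_def)

lemma star_arc_verts: "e \<in> parcs (star I) \<Longrightarrow> fst e \<in> pverts (star I) \<and> snd e \<in> pverts (star I)"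
  using EE_subset by (auto simp: star_def sources_def sinks_def)

lemma rarc_verts:
  "fst a \<in> parcs (star I) \<Longrightarrow> rtail a \<in> pverts (star I) \<and> rhead a \<in> pverts (star I)"
  using star_arc_verts[of "fst a"] by (cases a; cases "fst a") auto

lemma star_cap_nonneg: "e \<in> parcs (star I) \<Longrightarrow> 0 \<le> star_cap I e"
  using cap_nonneg by (auto simp: star_def sources_def sinks_def)

lemma star_sum:
  "(\<Sum>e\<in>parcs (star I). f e) = (\<Sum>(i, j)\<in>EE I. f (Vtx i, Vtx j))
     + (\<Sum>i\<in>sources I. f (Src, Vtx i)) + (\<Sum>j\<in>sinks I. f (Vtx j, Snk))"
proof -
  let ?A = "(\<lambda>(i, j). (Vtx i, Vtx j)) ` EE I" and ?B = "(\<lambda>i. (Src, Vtx i)) ` sources I"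
    and ?C = "(\<lambda>j. (Vtx j, Snk)) ` sinks I"
  have fin: "finite ?A" "finite ?B" "finite ?C"
    using finite_EE finite_sources finite_sinks by auto
  have "(\<Sum>e\<in>parcs (star I). f e) = sum f (?A \<union> ?B) + sum f ?C"
    unfolding star_def using fin by (simp, intro sum.union_disjoint) auto
  also have "sum f (?A \<union> ?B) = sum f ?A + sum f ?B"
    using fin by (intro sum.union_disjoint) auto
  also have "sum f ?A = (\<Sum>(i, j)\<in>EE I. f (Vtx i, Vtx j))"
    by (subst sum.reindex) (auto simp: inj_on_def case_prod_unfold)
  also have "sum f ?B = (\<Sum>i\<in>sources I. f (Src, Vtx i))"
    by (subst sum.reindex) (auto simp: inj_on_def)
  also have "sum f ?C = (\<Sum>j\<in>sinks I. f (Vtx j, Snk))"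
    by (subst sum.reindex) (auto simp: inj_on_def)
  finally show ?thesis .
qed

text \<open>All nodes of \<open>R\<close> except \<open>Src\<close> conserve flow, so the divergence
  of \<open>R\<close> is that of \<open>Src\<close>.\<close>

lemma flow_val_cut:
  assumes "is_flow I x" "Src \<in> R" "Snk \<notin> R" "R \<subseteq> pverts (star I)"
  shows "flow_val I x =
    (\<Sum>e\<in>parcs (star I). x e * (of_bool (fst e \<in> R) - of_bool (snd e \<in> R)))"
proof -
  have fin: "finite R" using assms(4) finite_star_verts finite_subset by blast
  have "(\<Sum>i\<in>R. net_out (star I) x i) = net_out (star I) x Src + (\<Sum>i\<in>R - {Src}. net_out (star I) x i)"
    using fin assms(2) by (rule sum.remove)
  also have "(\<Sum>i\<in>R - {Src}. net_out (star I) x i) = 0"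
    using assms by (intro sum.neutral) (auto simp: is_flow_def)
  finally show ?thesis using sum_net_out[OF finite_star fin, of x] by (simp add: flow_val_def)
qed

lemma flow_val_sources: "flow_val I x = (\<Sum>i\<in>sources I. x (Src, Vtx i))"
  unfolding flow_val_def net_out_eq_arc_sum[OF finite_star] star_sum by simp

lemma flow_val_sinks:
  assumes "is_flow I x"
  shows "flow_val I x = (\<Sum>j\<in>sinks I. x (Vtx j, Snk))"
proof -
  \<comment> \<open>For the cut that separates only \<open>Snk\<close>, original arcs have both ends
    on the same side.\<close>
  have "(\<Sum>(i, j)\<in>EE I. x (Vtx i, Vtx j) *
      (of_bool (Vtx i \<in> pverts (star I) - {Snk}) - of_bool (Vtx j \<in> pverts (star I) - {Snk}))) = 0"
    using EE_subset by (intro sum.neutral) (auto simp: star_verts)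
  then show ?thesis
    by (subst flow_val_cut[OF assms, of "pverts (star I) - {Snk}"])
      (auto simp: star_sum star_verts sources_def sinks_def case_prod_unfold)
qed

lemma flow_val_le_demand:
  assumes "is_flow I x"
  shows "flow_val I x \<le> demand I"
proof -
  have "x (Src, Vtx i) \<le> bal I i" if "i \<in> sources I" for i
    using assms that by (force simp: is_flow_def star_def)
  then show ?thesis unfolding flow_val_sources demand_def by (simp add: sum_mono)
qed

lemma demand_sinks: "demand I = (\<Sum>j\<in>sinks I. - bal I j)"
proof -
  have "(\<Sum>i\<in>VV I. bal I i) = (\<Sum>i\<in>sources I \<union> sinks I. bal I i)"
    using finite_VV by (intro sum.mono_neutral_right) (auto simp: sources_def sinks_def)
  also have "\<dots> = (\<Sum>i\<in>sources I. bal I i) + (\<Sum>i\<in>sinks I. bal I i)"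
    using finite_sources finite_sinks by (intro sum.union_disjoint) (auto simp: sources_def sinks_def)
  finally show ?thesis using sum_bal by (simp add: demand_def sum_negf)
qed

lemma demand_nonneg: "0 \<le> demand I"
  unfolding demand_def by (rule sum_nonneg) (auto simp: sources_def)

lemma net_out_star_Vtx:
  assumes "i \<in> VV I"
  shows "net_out (star I) x (Vtx i) = net_out (graph I) (\<lambda>(i, j). x (Vtx i, Vtx j)) i
    + (if i \<in> sinks I then x (Vtx i, Snk) else 0) - (if i \<in> sources I then x (Src, Vtx i) else 0)"
proof -
  have d: "(\<Sum>j\<in>S. f j * of_bool (j = i)) = (if i \<in> S then f i else 0)"
    if "finite S" for S and f :: "'v \<Rightarrow> real"
  proof -
    have "(\<Sum>j\<in>S. f j * of_bool (j = i)) = (\<Sum>j\<in>S. if j = i then f j else 0)"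
      by (rule sum.cong) auto
    with that show ?thesis by simp
  qed
  show ?thesis
    unfolding net_out_eq_arc_sum[OF finite_star] net_out_eq_arc_sum[OF finite_EE] star_sum
    by (simp add: case_prod_unfold sum_negf d[OF finite_sources] d[OF finite_sinks])
qed

lemma demand_zero_bal:
  assumes "demand I = 0" "i \<in> VV I"
  shows "bal I i = 0"
proof -
  have "\<forall>i\<in>sources I. bal I i = 0"
    using assms(1) finite_sources unfolding demand_def
    by (subst (asm) sum_nonneg_eq_0_iff) (auto simp: sources_def)
  moreover have "\<forall>i\<in>sinks I. - bal I i = 0"
    using assms(1) finite_sinks unfolding demand_sinks
    by (subst (asm) sum_nonneg_eq_0_iff) (auto simp: sinks_def)
  ultimately show ?thesis using assms(2) by (force simp: sources_def sinks_def)
qed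

text \<open>The slacks of the new arcs are nonnegative, and at either terminal they sum to zero, so
  each of them is zero.\<close>

lemma saturated:
  assumes "is_flow I x" "flow_val I x = demand I"
  shows "i \<in> sources I \<Longrightarrow> x (Src, Vtx i) = bal I i" "j \<in> sinks I \<Longrightarrow> x (Vtx j, Snk) = - bal I j"
proof -
  have le: "x (Src, Vtx i) \<le> bal I i" if "i \<in> sources I" for i
    using assms that by (force simp: is_flow_def star_def)
  have le': "x (Vtx j, Snk) \<le> - bal I j" if "j \<in> sinks I" for j
    using assms that by (force simp: is_flow_def star_def)
  have "(\<Sum>i\<in>sources I. bal I i - x (Src, Vtx i)) = 0"
    using assms(2) unfolding flow_val_sources demand_def by (simp add: sum_subtractf)
  then show "x (Src, Vtx i) = bal I i" if "i \<in> sources I"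
    using that le finite_sources by (subst (asm) sum_nonneg_eq_0_iff) auto
  have "(\<Sum>j\<in>sinks I. - bal I j - x (Vtx j, Snk)) = 0"
    using assms(2) unfolding flow_val_sinks[OF assms(1)] demand_sinks
    by (simp add: sum_subtractf sum_negf)
  then show "x (Vtx j, Snk) = - bal I j" if "j \<in> sinks I"
    using that le' finite_sinks by (subst (asm) sum_nonneg_eq_0_iff) force+
qed

lemma feasible_restrict_flow:
  assumes "is_flow I x" "flow_val I x = demand I"
  shows "feasible I (restrict_flow I x)"
  unfolding feasible_def
proof (intro conjI ballI)
  fix i assume i: "i \<in> VV I"
  have "net_out (graph I) (restrict_flow I x) i = net_out (graph I) (\<lambda>(i, j). x (Vtx i, Vtx j)) i"
    unfolding net_out_def restrict_flow_def
    by (rule arg_cong2[where f = "(-)"]; rule sum.cong) auto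
  moreover have "net_out (star I) x (Vtx i) = 0"
    using assms(1) i by (auto simp: is_flow_def star_verts)
  ultimately show "net_out (graph I) (restrict_flow I x) i = bal I i"
    using saturated[OF assms] i unfolding net_out_star_Vtx[OF i]
    by (auto simp: sources_def sinks_def split: if_splits)
next
  fix e assume e: "e \<in> EE I"
  then have "(Vtx (fst e), Vtx (snd e)) \<in> parcs (star I)" by (cases e) (auto simp: star_def)
  then show "0 \<le> restrict_flow I x e" "restrict_flow I x e \<le> cap I e"
    using assms(1) e by (force simp: is_flow_def restrict_flow_def)+
qed

fun lift_flow :: "('v \<times> 'v \<Rightarrow> real) \<Rightarrow> 'v flow" where
  "lift_flow y (Vtx i, Vtx j) = y (i, j)"
| "lift_flow y (Src, Vtx i) = bal I i"
| "lift_flow y (Vtx j, Snk) = - bal I j"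
| "lift_flow y _ = 0"

lemma lift_flow:
  assumes "feasible I y"
  shows "is_flow I (lift_flow y)" "flow_val I (lift_flow y) = demand I"
proof -
  have "net_out (star I) (lift_flow y) (Vtx i) = 0" if i: "i \<in> VV I" for i
    using assms i unfolding net_out_star_Vtx[OF i] by (auto simp: feasible_def sources_def sinks_def)
  moreover have "0 \<le> lift_flow y e \<and> lift_flow y e \<le> star_cap I e" if "e \<in> parcs (star I)" for e
    using that assms by (auto simp: star_def feasible_def sources_def sinks_def)
  ultimately show "is_flow I (lift_flow y)" by (auto simp: is_flow_def star_verts)
  show "flow_val I (lift_flow y) = demand I" unfolding flow_val_sources demand_def by simp
qed

section \<open>Cuts in residual graphs\<close>

lemma star_le_subset: "parcs (star_le I \<alpha>) \<subseteq> parcs (star I)"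
  by (auto simp: star_le_def)

text \<open>On an arc leaving \<open>R\<close>, \<open>y - x\<close> is at most the forward residual
  capacity, since \<open>y\<close> respects the capacity; on an arc entering \<open>R\<close>,
  \<open>x - y\<close> is at most \<open>x\<close>, the backward residual capacity, since
  \<open>y\<close> is nonnegative. Heavier arcs contribute 0 because both flows vanish
  there.\<close>

lemma residual_cut_bound:
  assumes x: "is_flow I x" "supported I \<alpha> x" and y: "is_flow I y" "supported I \<alpha> y"
    and R: "Src \<in> R" "Snk \<notin> R" "R \<subseteq> pverts (star I)" and "0 \<le> D"
    and cut: "\<And>a. fst a \<in> parcs (star_le I \<alpha>) \<Longrightarrow> rtail a \<in> R \<Longrightarrow> rhead a \<notin> R \<Longrightarrow> res I x a \<le> D"
  shows "flow_val I y - flow_val I x \<le> real (mstar I) * D"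
proof -
  have "(y e - x e) * (of_bool (fst e \<in> R) - of_bool (snd e \<in> R)) \<le> D" if e: "e \<in> parcs (star I)" for e
  proof (cases "e \<in> parcs (star_le I \<alpha>)")
    case True
    have "0 \<le> y e" "y e \<le> star_cap I e" using y(1) e by (auto simp: is_flow_def)
    with cut[of "(e, True)"] cut[of "(e, False)"] True \<open>0 \<le> D\<close> show ?thesis
      by (cases e) (auto simp: of_bool_def)
  next
    case False
    with x y e \<open>0 \<le> D\<close> show ?thesis by (simp add: supported_def)
  qed
  then have "(\<Sum>e\<in>parcs (star I). (y e - x e) * (of_bool (fst e \<in> R) - of_bool (snd e \<in> R)))
      \<le> real (mstar I) * D"
    by (rule sum_bounded_above)
  then show ?thesis
    unfolding flow_val_cut[OF x(1) R] flow_val_cut[OF y(1) R]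
    by (simp add: left_diff_distrib sum_subtractf)
qed

text \<open>Finitely many residual arcs cross the cut, so strict bounds on them leave a maximum
  \<open>D'\<close> below \<open>D\<close>, and the weak bound applies to \<open>D'\<close>.\<close>

lemma residual_cut_bound_strict:
  assumes "is_flow I x" "supported I \<alpha> x" "is_flow I y" "supported I \<alpha> y"
    and "Src \<in> R" "Snk \<notin> R" "R \<subseteq> pverts (star I)" and D: "0 < D"
    and cut: "\<And>a. fst a \<in> parcs (star_le I \<alpha>) \<Longrightarrow> rtail a \<in> R \<Longrightarrow> rhead a \<notin> R \<Longrightarrow> res I x a < D"
    and "parcs (star I) \<noteq> {}"
  shows "flow_val I y - flow_val I x < real (mstar I) * D"
proof -
  define C where "C = {a \<in> parcs (star_le I \<alpha>) \<times> UNIV. rtail a \<in> R \<and> rhead a \<notin> R}"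
  have "finite C"
    using finite_star star_le_subset finite_subset unfolding C_def by fastforce
  \<comment> \<open>The 0 keeps \<open>D'\<close> nonnegative, and defined if no arc
    crosses.\<close>
  define D' where "D' = Max (insert 0 (res I x ` C))"
  have "0 \<le> D'" using \<open>finite C\<close> by (simp add: D'_def)
  moreover have "res I x a < D" if "a \<in> C" for a
    using that cut[of a] unfolding C_def mem_Times_iff mem_Collect_eq by blast
  then have "D' < D" using \<open>finite C\<close> D by (simp add: D'_def)
  moreover have "res I x a \<le> D'"
    if "fst a \<in> parcs (star_le I \<alpha>)" "rtail a \<in> R" "rhead a \<notin> R" for a
  proof -
    have "a \<in> C" using that by (cases a) (auto simp: C_def)
    then show ?thesis using \<open>finite C\<close> by (simp add: D'_def)
  qed
  ultimately have "flow_val I y - flow_val I x \<le> real (mstar I) * D'"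
    using assms by (intro residual_cut_bound) auto
  also have "\<dots> < real (mstar I) * D"
    using \<open>D' < D\<close> finite_star \<open>parcs (star I) \<noteq> {}\<close> by (simp add: card_gt_0_iff)
  finally show ?thesis .
qed

text \<open>\<open>R\<close> is what walks over large residual arcs reach, hence closed under them;
  loop erasure only turns a walk to \<open>Snk\<close> into a forbidden path. Positive residual
  capacity is a separate condition because maximality of a flow is the case
  \<open>D = 0\<close>.\<close>

lemma no_path_cut:
  assumes "\<nexists>P. augmenting_path I \<alpha> x P \<and> D \<le> path_cap I x P"
  obtains R where "Src \<in> R" "Snk \<notin> R" "R \<subseteq> pverts (star I)"
    "\<And>a. fst a \<in> parcs (star_le I \<alpha>) \<Longrightarrow> rtail a \<in> R \<Longrightarrow> rhead a \<notin> R \<Longrightarrow> \<not> (0 < res I x a \<and> D \<le> res I x a)"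
proof
  define Q where "Q a \<longleftrightarrow> fst a \<in> parcs (star_le I \<alpha>) \<and> 0 < res I x a \<and> D \<le> res I x a" for a
  define R where "R = {v \<in> pverts (star I). \<exists>P. rwalk Src P v \<and> (\<forall>a\<in>set P. Q a)}"
  show "Src \<in> R" by (auto simp: R_def star_verts intro: exI[of _ "[]"])
  show "R \<subseteq> pverts (star I)" by (auto simp: R_def)
  show "Snk \<notin> R"
  proof
    assume "Snk \<in> R"
    then obtain P' where P': "rwalk Src P' Snk" "\<forall>a\<in>set P'. Q a" by (auto simp: R_def)
    from rwalk_to_distinct[OF P'(1)] obtain P where "set P \<subseteq> set P'"
      and P: "rwalk Src P Snk" "distinct (Src # map rhead P)" by metis
    with P'(2) have PQ: "\<forall>a\<in>set P. Q a" by blast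
    with P have "augmenting_path I \<alpha> x P" unfolding augmenting_path_iff Q_def by blast
    moreover have "D \<le> path_cap I x P"
      using PQ path_cap_ge_iff[OF augmenting_path_not_Nil[OF calculation]] unfolding Q_def by blast
    ultimately show False using assms by blast
  qed
  fix a assume a: "fst a \<in> parcs (star_le I \<alpha>)" "rtail a \<in> R" "rhead a \<notin> R"
  then obtain P where P: "rwalk Src P (rtail a)" "\<forall>a\<in>set P. Q a" by (auto simp: R_def)
  have "rhead a \<in> pverts (star I)" using a star_le_subset rarc_verts by blast
  moreover have "rwalk Src (P @ [a]) (rhead a)" using P(1) by (simp add: rwalk_snoc)
  moreover have "\<forall>b\<in>set (P @ [a]). Q b" if "Q a" using P(2) that by simp
  ultimately have "\<not> Q a" using a(3) unfolding R_def by blast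
  then show "\<not> (0 < res I x a \<and> D \<le> res I x a)" using a by (simp add: Q_def)
qed

section \<open>Augmentation, and an integral maximum flow\<close>

lemma augment_flow:
  assumes "is_flow I x" "augmenting_path I \<alpha> x P"
  defines "\<epsilon> \<equiv> path_cap I x P"
  shows "is_flow I (augment x \<epsilon> P)" "flow_val I (augment x \<epsilon> P) = flow_val I x + \<epsilon>" "0 < \<epsilon>"
    "supported I \<alpha> x \<Longrightarrow> supported I \<alpha> (augment x \<epsilon> P)"
proof -
  have P: "\<And>a. a \<in> set P \<Longrightarrow> fst a \<in> parcs (star_le I \<alpha>)" "\<And>a. a \<in> set P \<Longrightarrow> 0 < res I x a"
    "rwalk Src P Snk" "distinct P" "P \<noteq> []"
    using assms(2) augmenting_path_not_Nil[OF assms(2)]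
    by (auto simp: augmenting_path_iff distinct_map)
  have le: "\<epsilon> \<le> res I x a" if "a \<in> set P" for a using that by (simp add: \<epsilon>_def path_cap_def)
  show "0 < \<epsilon>" using P(2,5) by (simp add: \<epsilon>_def path_cap_def)
  have net: "net_out (star I) (augment x \<epsilon> P) i
      = net_out (star I) x i + \<epsilon> * (of_bool (i = Src) - of_bool (i = Snk))" for i
    using P star_le_subset by (intro net_out_augment finite_star) blast+
  show "flow_val I (augment x \<epsilon> P) = flow_val I x + \<epsilon>" by (simp add: flow_val_def net)
  have "0 \<le> augment x \<epsilon> P e \<and> augment x \<epsilon> P e \<le> star_cap I e" if "e \<in> parcs (star I)" for e
  proof -
    have "0 \<le> x e" "x e \<le> star_cap I e" using that assms(1) by (auto simp: is_flow_def)
    \<comment> \<open>If \<open>P\<close> used \<open>e\<close> in both directions the changes would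
      cancel; if it uses one, the residual capacity in that direction bounds \<epsilon>.\<close>
    with le[of "(e, True)"] le[of "(e, False)"] \<open>0 < \<epsilon>\<close> show ?thesis
      unfolding augment_def by (smt (verit) rescap.simps)
  qed
  then show "is_flow I (augment x \<epsilon> P)" using assms(1) by (auto simp: is_flow_def net)
  show "supported I \<alpha> x \<Longrightarrow> supported I \<alpha> (augment x \<epsilon> P)"
    using P(1) by (fastforce simp: supported_def augment_def)
qed

lemma augment_int_valued:
  assumes "int_valued x" "augmenting_path I \<alpha> x P"
  shows "int_valued (augment x (path_cap I x P) P)" "path_cap I x P \<in> \<int>"
proof -
  have "res I x a \<in> \<int>" for a
    using assms(1) by (cases a) (auto simp: int_valued_def)
  moreover have "path_cap I x P \<in> res I x ` set P"
    unfolding path_cap_def using augmenting_path_not_Nil[OF assms(2)] by (intro Min_in) auto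
  ultimately show "path_cap I x P \<in> \<int>" by auto
  then show "int_valued (augment x (path_cap I x P) P)"
    using assms(1) by (auto simp: int_valued_def augment_def)
qed

lemma zero_is_flow: "is_flow I (\<lambda>_. 0)" "flow_val I (\<lambda>_. 0) = 0" "int_valued (\<lambda>_. 0)" "supported I \<alpha> (\<lambda>_. 0)"
  using star_cap_nonneg
  by (auto simp: is_flow_def net_out_def flow_val_def int_valued_def supported_def)

lemma flow_val_Ints: "int_valued x \<Longrightarrow> flow_val I x \<in> \<int>"
  unfolding flow_val_sources by (intro Ints_sum) (auto simp: int_valued_def)

lemma flow_val_nonneg: "is_flow I x \<Longrightarrow> 0 \<le> flow_val I x"
  unfolding flow_val_sources by (rule sum_nonneg) (force simp: is_flow_def star_def)

text \<open>An integer flow of the largest value among integer flows admits no augmenting path.\<close>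

lemma max_flow_exists: "\<exists>x. max_flow I x \<and> int_valued x"
proof -
  define V where "V n \<longleftrightarrow> (\<exists>x. is_flow I x \<and> int_valued x \<and> flow_val I x = real n)" for n :: nat
  have "V 0" unfolding V_def using zero_is_flow by fastforce
  have bound: "\<forall>n. V n \<longrightarrow> n \<le> nat (demand I)"
  proof (intro allI impI)
    fix n assume "V n"
    then obtain x where "is_flow I x" "flow_val I x = real n" by (auto simp: V_def)
    with flow_val_le_demand have "real n \<le> demand I" by force
    then show "n \<le> nat (demand I)" by linarith
  qed
  define n where "n = (GREATEST n. V n)"
  have "V n" unfolding n_def by (rule GreatestI_nat[where P = V, OF \<open>V 0\<close>]) (use bound in blast)
  then obtain x where x: "is_flow I x" "int_valued x" "flow_val I x = real n" by (auto simp: V_def)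
  \<comment> \<open>A threshold that no weight exceeds makes the threshold graph the whole auxiliary
    graph, so the cut lemmas apply to unrestricted flows.\<close>
  obtain \<alpha> where all: "parcs (star_le I \<alpha>) = parcs (star I)"
  proof
    let ?W = "(\<lambda>e. real_of_int (star_weight I e)) ` parcs (star I)"
    have "\<forall>e\<in>parcs (star I). real_of_int (star_weight I e) \<le> Max ?W"
      using finite_star by auto
    then show "parcs (star_le I (Max ?W)) = parcs (star I)" by (auto simp: star_le_def)
  qed
  then have supp: "supported I \<alpha> y" for y by (simp add: supported_def)
  have "\<nexists>P. augmenting_path I \<alpha> x P"
  proof
    assume "\<exists>P. augmenting_path I \<alpha> x P"
    then obtain P where P: "augmenting_path I \<alpha> x P" ..
    let ?\<epsilon> = "path_cap I x P"
    obtain m where m: "?\<epsilon> = real_of_int m"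
      using augment_int_valued(2)[OF x(2) P] by (auto elim: Ints_cases)
    have "0 < m" using augment_flow(3)[OF x(1) P] m by simp
    then have "V (n + nat m)"
      unfolding V_def using augment_flow[OF x(1) P] augment_int_valued[OF x(2) P] x(3) m
      by (intro exI[of _ "augment x ?\<epsilon> P"]) simp
    then have "n + nat m \<le> n" unfolding n_def by (rule Greatest_le_nat) (use bound in auto)
    with \<open>0 < m\<close> show False by simp
  qed
  then obtain R where R: "Src \<in> R" "Snk \<notin> R" "R \<subseteq> pverts (star I)"
    and cut: "\<And>a. fst a \<in> parcs (star_le I \<alpha>) \<Longrightarrow> rtail a \<in> R \<Longrightarrow> rhead a \<notin> R \<Longrightarrow> \<not> (0 < res I x a \<and> 0 \<le> res I x a)"
    using no_path_cut[of \<alpha> x 0] by blast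
  \<comment> \<open>No residual arc crosses the cut, so the bound with \<open>D = 0\<close> covers
    every real flow and not only the integral ones.\<close>
  have "flow_val I y \<le> flow_val I x" if "is_flow I y" for y
    using residual_cut_bound[OF x(1) supp that supp R, of 0] cut by force
  with x show ?thesis by (auto simp: max_flow_def)
qed

end

section \<open>Correctness of the algorithm\<close>

context bnfp
begin

section \<open>Order of the weights, and the threshold graphs\<close>

lemma nth_weight_mem: "1 \<le> k \<Longrightarrow> k \<le> num_weights I \<Longrightarrow> nth_weight I k \<in> weight I ` EE I"
  using nth_mem[of "k - 1" "sorted_list_of_set (weight I ` EE I)"] finite_EE
  by (simp add: nth_weight_def)

lemma nth_weight_less:
  assumes "1 \<le> j" "j < k" "k \<le> num_weights I"
  shows "nth_weight I j < nth_weight I k"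
  using assms unfolding nth_weight_def
  by (intro sorted_wrt_nth_less[of "(<)"]) auto

lemma nth_weight_surj:
  assumes "w \<in> weight I ` EE I"
  obtains k where "1 \<le> k" "k \<le> num_weights I" "nth_weight I k = w"
proof -
  have "w \<in> set (sorted_list_of_set (weight I ` EE I))" using assms finite_EE by simp
  then obtain i where "i < num_weights I" "sorted_list_of_set (weight I ` EE I) ! i = w"
    by (auto simp: in_set_conv_nth)
  then show ?thesis using that[of "Suc i"] by (simp add: nth_weight_def)
qed

lemma weight_less_nth:
  assumes "w \<in> weight I ` EE I" "w < nth_weight I k" "1 \<le> k" "k \<le> num_weights I"
  shows "1 < k \<and> w \<le> nth_weight I (k - 1)"
proof -
  obtain j where j: "1 \<le> j" "j \<le> num_weights I" "nth_weight I j = w"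
    using nth_weight_surj[OF assms(1)] .
  have "j < k"
  proof (rule ccontr)
    assume "\<not> j < k"
    then have "k = j \<or> k < j" by auto
    then show False using nth_weight_less[of k j] j assms by auto
  qed
  moreover have "nth_weight I j \<le> nth_weight I (k - 1)"
  proof (cases "j = k - 1")
    case False
    with \<open>j < k\<close> assms(4) have "j < k - 1" "k - 1 \<le> num_weights I" by linarith+
    with nth_weight_less[of j "k - 1"] j(1) show ?thesis by simp
  qed simp
  ultimately show ?thesis using j by simp
qed

lemma new_weight_le: "w \<in> weight I ` EE I \<Longrightarrow> new_weight I \<le> w"
  using finite_EE by (simp add: new_weight_def)

lemma star_weight_le:
  assumes "e \<in> parcs (star I)" "\<And>w. w \<in> weight I ` EE I \<Longrightarrow> w \<le> b" "EE I \<noteq> {}"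
  shows "star_weight I e \<le> b"
proof -
  have "new_weight I \<le> b" using assms(2,3) new_weight_le by force
  with assms show ?thesis by (auto simp: star_def)
qed

lemma star_le_last:
  assumes "1 \<le> num_weights I"
  shows "parcs (star_le I (nth_weight I (num_weights I))) = parcs (star I)"
proof -
  have "w \<le> nth_weight I (num_weights I)" if w: "w \<in> weight I ` EE I" for w
  proof (rule nth_weight_surj[OF w])
    fix k assume "1 \<le> k" "k \<le> num_weights I" "nth_weight I k = w"
    then show ?thesis using nth_weight_less[of k "num_weights I"] by (cases "k = num_weights I") auto
  qed
  moreover have "EE I \<noteq> {}" using assms by auto
  ultimately show ?thesis using star_weight_le by (auto simp: star_le_def)
qed

text \<open>Without arcs a vertex with supply has only its arc from \<open>Src\<close>, and
  conservation forces 0 there. This settles the instances for which \<open>nth_weight\<close> is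
  unspecified: if feasible, their demand is 0.\<close>

lemma no_arcs_flow_val:
  assumes "EE I = {}" "is_flow I x"
  shows "flow_val I x = 0"
  unfolding flow_val_sources
proof (intro sum.neutral ballI)
  fix i assume i: "i \<in> sources I"
  then have "i \<in> VV I" "i \<notin> sinks I" by (auto simp: sources_def sinks_def)
  moreover from this have "net_out (star I) x (Vtx i) = 0"
    using assms(2) by (auto simp: is_flow_def star_verts)
  ultimately show "x (Src, Vtx i) = 0"
    using i assms(1) net_out_star_Vtx[of i x] by (simp add: net_out_def)
qed

lemma no_arcs_star:
  assumes "EE I = {}" "demand I = 0"
  shows "parcs (star I) = {}"
  using assms demand_zero_bal by (auto simp: star_def sources_def sinks_def)

text \<open>With \<open>D\<close> the deficit divided by \<open>mstar I\<close>, the product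
  \<open>mstar I * D\<close> is the deficit itself, so the strict cut bound leaves every flow of the
  same threshold graph short of the demand.\<close>

lemma no_large_path_bound:
  assumes x: "is_flow I x" "supported I \<alpha> x" "flow_val I x < demand I"
    and none: "\<nexists>P. augmenting_path I \<alpha> x P \<and> (demand I - flow_val I x) / mstar I \<le> path_cap I x P"
    and y: "is_flow I y" "supported I \<alpha> y"
  shows "flow_val I y < demand I"
proof (cases "parcs (star I) = {}")
  \<comment> \<open>Here the quotient divides by 0, but all flow values are 0 and the demand is
    positive.\<close>
  case True
  then have "flow_val I z = 0" for z by (simp add: flow_val_def net_out_def)
  with x(3) show ?thesis by simp
next
  case False
  then have m: "0 < real (mstar I)" using finite_star by (simp add: card_gt_0_iff)
  let ?D = "(demand I - flow_val I x) / mstar I"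
  have D: "0 < ?D" using m x(3) by simp
  obtain R where R: "Src \<in> R" "Snk \<notin> R" "R \<subseteq> pverts (star I)"
    and cut: "\<And>a. fst a \<in> parcs (star_le I \<alpha>) \<Longrightarrow> rtail a \<in> R \<Longrightarrow> rhead a \<notin> R \<Longrightarrow>
      \<not> (0 < res I x a \<and> ?D \<le> res I x a)"
    using no_path_cut[OF none] by blast
  have "flow_val I y - flow_val I x < real (mstar I) * ?D"
  proof (rule residual_cut_bound_strict[OF x(1,2) y R D _ False])
    fix a assume "fst a \<in> parcs (star_le I \<alpha>)" "rtail a \<in> R" "rhead a \<notin> R"
    from cut[OF this] D show "res I x a < ?D" by linarith
  qed
  then show ?thesis using m by simp
qed

text \<open>The last clause is the lower bound: the preceding threshold cannot carry the demand. The
  first keeps a saturating flow in reserve, which shows that the weights do not run out.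
  \<open>k = 1\<close> without any weight occurs for graphs without arcs. Zero demand must force the
  zero flow, because the optimal bottleneck is then minus infinity.\<close>

fun lcap_inv :: "'v config \<Rightarrow> bool" where
  "lcap_inv Start \<longleftrightarrow> True"
| "lcap_inv Infeasible \<longleftrightarrow> (\<nexists>x. feasible I x)"
| "lcap_inv (Output x) \<longleftrightarrow> optimal I x"
| "lcap_inv (Phase k x) \<longleftrightarrow>
     (\<exists>y. is_flow I y \<and> demand I \<le> flow_val I y) \<and>
     1 \<le> k \<and> (k \<le> num_weights I \<or> k = 1) \<and>
     is_flow I x \<and> int_valued x \<and> supported I (nth_weight I k) x \<and>
     (demand I = 0 \<longrightarrow> x = (\<lambda>_. 0)) \<and>
     (1 < k \<longrightarrow> (\<forall>y. is_flow I y \<and> supported I (nth_weight I (k - 1)) y \<longrightarrow> flow_val I y < demand I))"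

lemma supported_mono: "supported I \<alpha> x \<Longrightarrow> \<alpha> \<le> \<beta> \<Longrightarrow> supported I \<beta> x"
  by (force simp: supported_def star_le_def)

lemma demand_pos_arcs:
  assumes "lcap_inv (Phase k x)" "0 < demand I"
  shows "EE I \<noteq> {}" "k \<le> num_weights I"
proof -
  obtain y where "is_flow I y" "demand I \<le> flow_val I y" using assms(1) by auto
  with assms(2) no_arcs_flow_val show "EE I \<noteq> {}" by fastforce
  then have "0 < num_weights I" using finite_EE by (simp add: card_gt_0_iff)
  then show "k \<le> num_weights I" using assms(1) by auto
qed

text \<open>The flow uses only arcs up to the \<open>k\<close>-th weight. A solution below that
  weight would use only arcs up to the weight before, and lifting it to the auxiliary graph
  contradicts the last clause of the invariant.\<close>

lemma finish_optimal:
  assumes inv: "lcap_inv (Phase k x)" and full: "flow_val I x = demand I"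
  shows "optimal I (restrict_flow I x)"
  unfolding optimal_def
proof (intro conjI allI impI)
  have x: "is_flow I x" "supported I (nth_weight I k) x" using inv by auto
  show "feasible I (restrict_flow I x)" using feasible_restrict_flow[OF x(1) full] .
  fix y assume y: "feasible I y"
  show "bottleneck I (restrict_flow I x) \<le> bottleneck I y"
  proof (cases "demand I = 0")
    case True
    then have "restrict_flow I x = (\<lambda>_. 0)" using inv by (auto simp: restrict_flow_def)
    then show ?thesis by (simp add: bottleneck_def bot_ereal_def)
  next
    case False
    then have pos: "0 < demand I" using demand_nonneg by simp
    note k = demand_pos_arcs[OF inv pos]
    have "1 \<le> k" using inv by simp
    have "bottleneck I (restrict_flow I x) \<le> ereal (nth_weight I k)"
      unfolding bottleneck_def
    proof (rule SUP_least)
      fix e assume "e \<in> {e \<in> EE I. 0 < restrict_flow I x e}"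
      then have e: "e \<in> EE I" "0 < x (Vtx (fst e), Vtx (snd e))" by (auto simp: restrict_flow_def)
      then have "(Vtx (fst e), Vtx (snd e)) \<in> parcs (star I)" by (force simp: star_def)
      with x(2) e have "(Vtx (fst e), Vtx (snd e)) \<in> parcs (star_le I (nth_weight I k))"
        by (force simp: supported_def)
      then show "ereal (weight I e) \<le> ereal (nth_weight I k)" by (simp add: star_le_def)
    qed
    also have "ereal (nth_weight I k) \<le> bottleneck I y"
    proof (rule ccontr)
      assume "\<not> ereal (nth_weight I k) \<le> bottleneck I y"
      then have "\<forall>e\<in>{e \<in> EE I. 0 < y e}. ereal (weight I e) < ereal (nth_weight I k)"
        unfolding bottleneck_def not_le by (meson SUP_lessD)
      then have less: "weight I e < nth_weight I k" if "e \<in> EE I" "0 < y e" for e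
      proof -
        have "ereal (weight I e) < ereal (nth_weight I k)"
          using that \<open>\<forall>e\<in>{e \<in> EE I. 0 < y e}. _ e\<close> by blast
        then show ?thesis by simp
      qed
      have prev: "1 < k \<and> weight I e \<le> nth_weight I (k - 1)" if "e \<in> EE I" "0 < y e" for e
        using weight_less_nth[OF _ less[OF that] \<open>1 \<le> k\<close> k(2)] that by auto
      show False
      proof (cases "k = 1")
        \<comment> \<open>There is no smaller weight, so \<open>y\<close> vanishes on all arcs and
          all balances are 0, against positive demand.\<close>
        case True
        have zero: "y e = 0" if "e \<in> EE I" for e
          using prev[OF that] True y that by (force simp: feasible_def)
        have "net_out (graph I) y i = 0" for i
          unfolding net_out_def using zero by (simp add: sum.neutral)
        then have "bal I i = 0" if "i \<in> VV I" for i using y that by (simp add: feasible_def)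
        then show False using pos by (simp add: demand_def sources_def)
      next
        case False
        with \<open>1 \<le> k\<close> have "1 < k" by simp
        \<comment> \<open>The new arcs carry \<open>new_weight\<close>, which is at most every
          weight, so they belong to the preceding threshold graph as well.\<close>
        have "new_weight I \<le> nth_weight I (k - 1)"
          using \<open>1 < k\<close> k by (intro new_weight_le nth_weight_mem) auto
        then have "supported I (nth_weight I (k - 1)) (lift_flow y)"
          using prev y unfolding supported_def star_le_def star_def feasible_def by force
        then show False using inv lift_flow[OF y] \<open>1 < k\<close> by force
      qed
    qed
    finally show ?thesis .
  qed
qed

lemma no_path_of_full:
  assumes "is_flow I x" "flow_val I x = demand I"
  shows "\<not> augmenting_path I \<alpha> x P"
proof
  assume P: "augmenting_path I \<alpha> x P"
  from augment_flow(1-3)[OF assms(1) P] flow_val_le_demand assms(2) show False by fastforce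
qed

lemma feasible_iff_max_flow:
  assumes "max_flow I y"
  shows "(\<exists>x. feasible I x) \<longleftrightarrow> demand I \<le> flow_val I y"
proof
  show "\<exists>x. feasible I x \<Longrightarrow> demand I \<le> flow_val I y"
    using assms lift_flow unfolding max_flow_def by metis
  assume "demand I \<le> flow_val I y"
  with assms flow_val_le_demand[of y] have "flow_val I y = demand I" "is_flow I y"
    by (auto simp: max_flow_def)
  then show "\<exists>x. feasible I x" using feasible_restrict_flow by blast
qed

lemma lcap_inv_step:
  assumes "lcap_step I c c'" "lcap_inv c"
  shows "lcap_inv c'"
  using assms
proof (cases rule: lcap_step.cases)
  case (infeasible y)
  then show ?thesis using feasible_iff_max_flow[of y] by auto
next
  case (init y)
  then show ?thesis using zero_is_flow by (auto simp: max_flow_def not_less)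
next
  case (augment k x P)
  then have P: "augmenting_path I (nth_weight I k) x P" by (simp add: large_path_def)
  have inv: "lcap_inv (Phase k x)" using assms(2) augment by simp
  then have x: "is_flow I x" "int_valued x" "supported I (nth_weight I k) x" by auto
  \<comment> \<open>With zero demand the zero flow is already full, and a full flow has no
    augmenting path; so the clause on zero demand is not broken here.\<close>
  have "demand I \<noteq> 0"
  proof
    assume "demand I = 0"
    then have "flow_val I x = demand I" using inv zero_is_flow by simp
    then show False using no_path_of_full[OF x(1)] P by blast
  qed
  then show ?thesis
    using inv augment_flow[OF x(1) P] augment_int_valued[OF x(2) P] x(3) unfolding augment by simp
next
  case (next_phase k x)
  have inv: "lcap_inv (Phase k x)" using assms(2) next_phase by simp
  then have x: "is_flow I x" "int_valued x" "supported I (nth_weight I k) x" and "1 \<le> k" by auto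
  have "flow_val I x < demand I"
    using next_phase flow_val_le_demand[OF x(1)] by simp
  then have "flow_val I y < demand I" if "is_flow I y" "supported I (nth_weight I k) y" for y
    using no_large_path_bound[OF x(1,3)] that next_phase by (auto simp: large_path_def)
  moreover have "nth_weight I k < nth_weight I (Suc k)"
    using nth_weight_less[of k "Suc k"] \<open>1 \<le> k\<close> next_phase by simp
  ultimately show ?thesis
    using inv next_phase supported_mono[OF x(3), of "nth_weight I (Suc k)"] by auto
next
  case (finish k x)
  then show ?thesis using finish_optimal[of k x] assms(2) by simp
qed

lemma lcap_inv_reachable: "(lcap_step I)\<^sup>*\<^sup>* Start c \<Longrightarrow> lcap_inv c"
  by (induction rule: rtranclp_induct) (auto intro: lcap_inv_step)

text \<open>At the largest weight the threshold graph is the whole auxiliary graph, where the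
  saturating flow kept in the invariant contradicts \<open>no_large_path_bound\<close>.\<close>

lemma phase_progress:
  assumes inv: "lcap_inv (Phase k x)" and none: "\<nexists>P. large_path I k x P"
    and "flow_val I x \<noteq> demand I"
  shows "k < num_weights I"
proof (rule ccontr)
  assume nk: "\<not> k < num_weights I"
  have x: "is_flow I x" "supported I (nth_weight I k) x" using inv by auto
  have less: "flow_val I x < demand I" using assms(3) flow_val_le_demand[OF x(1)] by simp
  with flow_val_nonneg[OF x(1)] have "0 < demand I" by linarith
  with demand_pos_arcs[OF inv] nk inv have k: "k = num_weights I" "1 \<le> num_weights I" by auto
  obtain y where y: "is_flow I y" "demand I \<le> flow_val I y" using inv by auto
  have "supported I (nth_weight I k) y" using star_le_last[OF k(2)] k(1) by (simp add: supported_def)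
  with no_large_path_bound[OF x less _ y(1)] none y(2) show False by (auto simp: large_path_def)
qed

lemma terminal_correct:
  assumes inv: "lcap_inv c" and stuck: "\<nexists>c'. lcap_step I c c'"
  shows "correct_answer I c"
proof (cases c)
  case Start
  \<comment> \<open>\<open>Start\<close> could be stuck only if no maximum flow existed.\<close>
  obtain y where "max_flow I y" using max_flow_exists by auto
  then show ?thesis using lcap_step.infeasible lcap_step.init stuck Start by blast
next
  case (Phase k x)
  have "\<nexists>P. large_path I k x P" using stuck Phase lcap_step.augment by blast
  moreover from this have "flow_val I x \<noteq> demand I" using stuck Phase lcap_step.finish by blast
  ultimately show ?thesis
    using phase_progress[of k x] inv stuck lcap_step.next_phase unfolding Phase by blast
qed (use inv in auto)

section \<open>Termination of the abstract algorithm\<close>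

definition progress :: "('v config \<times> 'v config) set" where
  "progress = inv_image (less_than <*lex*> less_than <*lex*> less_than)
     (\<lambda>c. case c of Start \<Rightarrow> (2, 0, 0)
          | Phase k x \<Rightarrow> (1, num_weights I - k, nat \<lfloor>demand I - flow_val I x\<rfloor>)
          | _ \<Rightarrow> (0 :: nat, 0 :: nat, 0 :: nat))"

text \<open>The path capacity is a positive integer, so an augmentation lowers the floor of the
  deficit by at least one; a mere real decrease might not change it.\<close>

lemma step_progress:
  assumes "lcap_step I c c'" "lcap_inv c"
  shows "(c', c) \<in> progress"
  using assms
proof (cases rule: lcap_step.cases)
  case (augment k x P)
  then have P: "augmenting_path I (nth_weight I k) x P" by (simp add: large_path_def)
  have x: "is_flow I x" "int_valued x" using assms(2) augment by auto
  note aug = augment_flow[OF x(1) P]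
  obtain d where d: "flow_val I x = of_int d" using flow_val_Ints[OF x(2)] by (auto elim: Ints_cases)
  obtain p where p: "path_cap I x P = of_int p"
    using augment_int_valued(2)[OF x(2) P] by (auto elim: Ints_cases)
  have "real_of_int (d + p) \<le> demand I" "0 < real_of_int p"
    using aug(2,3) flow_val_le_demand[OF aug(1)] by (simp_all add: d p)
  then have "d + p \<le> demand I" "0 < p" by linarith+
  moreover have "demand I - flow_val I x = of_int (demand I - d)"
    "demand I - flow_val I (augment x (path_cap I x P) P) = of_int (demand I - (d + p))"
    using d p aug(2) by simp_all
  ultimately show ?thesis
    unfolding augment progress_def by (simp only: in_inv_image config.case floor_of_int) auto
qed (auto simp: progress_def)

lemma lcap_correct: "lcap_correct I"
  unfolding lcap_correct_def
proof (intro conjI allI impI notI)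
  assume "\<exists>r. r 0 = Start \<and> (\<forall>i. lcap_step I (r i) (r (Suc i)))"
  then obtain r where r: "r 0 = Start" "\<And>i. lcap_step I (r i) (r (Suc i))" by blast
  have inv: "lcap_inv (r i)" for i
    by (induction i) (use r lcap_inv_step in \<open>auto simp del: lcap_inv.simps(2-)\<close>)
  have "wf progress" unfolding progress_def by (intro wf_inv_image wf_lex_prod wf_less_than)
  moreover have "(r (Suc i), r i) \<in> progress" for i by (rule step_progress[OF r(2) inv])
  ultimately show False using wf_no_infinite_down_chainE by blast
next
  fix z assume "(lcap_step I)\<^sup>*\<^sup>* Start z \<and> (\<nexists>z'. lcap_step I z z')"
  then show "correct_answer I z" using terminal_correct lcap_inv_reachable by blast
qed

end

section \<open>Timed executions\<close>

text \<open>Since \<open>exec\<close> is inductive, the existence of an execution includes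
  termination; the postcondition also sees the time.\<close>

definition run :: "'s com \<Rightarrow> 's \<Rightarrow> (nat \<Rightarrow> 's \<Rightarrow> bool) \<Rightarrow> bool" where
  "run c s Q \<longleftrightarrow> (\<exists>t s'. exec c s t s' \<and> Q t s')"

lemma run_mono: "run c s Q \<Longrightarrow> (\<And>t s'. Q t s' \<Longrightarrow> Q' t s') \<Longrightarrow> run c s Q'"
  by (auto simp: run_def)

inductive_cases DoE: "exec (Do f) s t s'"
inductive_cases SeqE: "exec (c ;; d) s t s'"
inductive_cases IfE: "exec (IF g THEN c ELSE d) s t s'"

lemma run_Do: "run (Do f) s Q \<longleftrightarrow> Q 1 (f s)"
  unfolding run_def by (metis DoE exec.Do)

lemma run_Seq: "run (c ;; d) s Q \<longleftrightarrow> run c s (\<lambda>t s'. run d s' (\<lambda>t'. Q (t + t')))"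
  unfolding run_def by (blast elim: SeqE intro: exec.Seq)

lemma run_If:
  "run (IF g THEN c ELSE d) s Q \<longleftrightarrow> (if g s then run c s (\<lambda>t. Q (1 + t)) else run d s (\<lambda>t. Q (1 + t)))"
  unfolding run_def by (cases "g s") (simp; metis IfE exec.IfTrue exec.IfFalse plus_1_eq_Suc)+

lemma run_While_done: "\<not> g s \<Longrightarrow> Q 1 s \<Longrightarrow> run (WHILE g DO c) s Q"
  unfolding run_def using exec.WhileFalse[of g] by blast

lemma run_While_step:
  assumes "g s" "run c s (\<lambda>t s'. run (WHILE g DO c) s' (\<lambda>t'. Q (1 + t + t')))"
  shows "run (WHILE g DO c) s Q"
  using assms(2) exec.WhileTrue[of g, OF assms(1)] unfolding run_def by blast

lemmas run_simps = run_Do run_Seq run_If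

text \<open>\<open>\<Phi>\<close> is both the variant and an amortised bound on the time still to be spent.\<close>

lemma run_While:
  assumes step: "\<And>s. Inv s \<Longrightarrow> g s \<Longrightarrow> run c s (\<lambda>t s'. Inv s' \<and> 1 + t + \<Phi> s' \<le> (\<Phi> s :: nat))"
    and "Inv s"
    and post: "\<And>t s'. Inv s' \<Longrightarrow> \<not> g s' \<Longrightarrow> t + \<Phi> s' \<le> \<Phi> s + 1 \<Longrightarrow> Q t s'"
  shows "run (WHILE g DO c) s Q"
proof -
  have "\<exists>t s'. exec (WHILE g DO c) s t s' \<and> Inv s' \<and> \<not> g s' \<and> t + \<Phi> s' \<le> \<Phi> s + 1"
    using \<open>Inv s\<close>
  proof (induction "\<Phi> s" arbitrary: s rule: less_induct)
    case less
    show ?case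
    proof (cases "g s")
      case True
      obtain t s' where 1: "exec c s t s'" "Inv s'" "1 + t + \<Phi> s' \<le> \<Phi> s"
        using step[OF less.prems True] by (auto simp: run_def)
      then obtain t' s'' where "exec (WHILE g DO c) s' t' s''" "Inv s''" "\<not> g s''" "t' + \<Phi> s'' \<le> \<Phi> s' + 1"
        using less.hyps[of s'] by auto
      with 1 exec.WhileTrue[of g, OF True 1(1)] show ?thesis
        by (intro exI[of _ "1 + t + t'"] exI[of _ s'']) auto
    next
      case False
      with less.prems exec.WhileFalse[of g] show ?thesis by (intro exI[of _ 1] exI[of _ s]) auto
    qed
  qed
  with post show ?thesis by (auto simp: run_def)
qed

text \<open>\<open>Inv D\<close> speaks of the processed prefix \<open>D\<close>. Each element costs
  the body plus one test, and the final \<open>1\<close> is the failing test.\<close>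

lemma run_for_list:
  assumes "todo s = xs" "Inv [] s"
    and step: "\<And>D x r s. xs = D @ x # r \<Longrightarrow> todo s = x # r \<Longrightarrow> Inv D s \<Longrightarrow>
      run c s (\<lambda>t s'. t \<le> k \<and> todo s' = r \<and> Inv (D @ [x]) s')"
    and post: "\<And>t s'. Inv xs s' \<Longrightarrow> t \<le> Suc k * length xs + 1 \<Longrightarrow> Q t s'"
  shows "run (WHILE (\<lambda>s. todo s \<noteq> []) DO c) s Q"
proof (rule run_While[where \<Phi> = "\<lambda>s. Suc k * length (todo s)" and
      Inv = "\<lambda>s. \<exists>D. xs = D @ todo s \<and> Inv D s"], goal_cases)
  case (1 s)
  then obtain D x r where D: "xs = D @ x # r" "todo s = x # r" "Inv D s"
    by (metis list.exhaust)
  show ?case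
    by (rule run_mono[OF step[OF D]]) (use D in auto)
qed (use assms in auto)

section \<open>Building the auxiliary graph\<close>

text \<open>The set \<open>L\<close> is a parameter so that the predicate can also describe the
  partially built graph.\<close>

definition links_ok :: "'v bnfp \<Rightarrow> ('v node \<times> 'v node) set \<Rightarrow> 'v ram \<Rightarrow> bool" where
  "links_ok I L \<sigma> \<longleftrightarrow> distinct (all_links \<sigma>) \<and> set (all_links \<sigma>) = L \<and> num_links \<sigma> = int (card L) \<and>
     (\<forall>e\<in>L. link_cap \<sigma> e = star_cap I e \<and> link_wt \<sigma> e = star_weight I e) \<and>
     (\<forall>i\<in>pverts (star I). distinct (adj \<sigma> i) \<and> set (adj \<sigma> i) = {a. fst a \<in> L \<and> rtail a = i})"

definition built :: "'v bnfp \<Rightarrow> 'v ram \<Rightarrow> bool" where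
  "built I \<sigma> \<longleftrightarrow> loaded I \<sigma> \<and> distinct (all_nodes \<sigma>) \<and> set (all_nodes \<sigma>) = pverts (star I) \<and>
     links_ok I (parcs (star I)) \<sigma> \<and> dem \<sigma> = demand I \<and>
     min_wt \<sigma> = new_weight I \<and> max_wt \<sigma> = Max (insert 0 (weight I ` EE I))"

lemma built_update [simp]:
  "built I (\<sigma>\<lparr>flw := a1\<rparr>) = built I \<sigma>" "built I (\<sigma>\<lparr>fval := a2\<rparr>) = built I \<sigma>"
  "built I (\<sigma>\<lparr>level := a3\<rparr>) = built I \<sigma>" "built I (\<sigma>\<lparr>new_level := a4\<rparr>) = built I \<sigma>"
  "built I (\<sigma>\<lparr>th_num := a5\<rparr>) = built I \<sigma>" "built I (\<sigma>\<lparr>th_den := a6\<rparr>) = built I \<sigma>"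
  "built I (\<sigma>\<lparr>scale := a7\<rparr>) = built I \<sigma>" "built I (\<sigma>\<lparr>labelled := a8\<rparr>) = built I \<sigma>"
  "built I (\<sigma>\<lparr>via := a9\<rparr>) = built I \<sigma>" "built I (\<sigma>\<lparr>work := b1\<rparr>) = built I \<sigma>"
  "built I (\<sigma>\<lparr>at_node := b2\<rparr>) = built I \<sigma>" "built I (\<sigma>\<lparr>amount := b3\<rparr>) = built I \<sigma>"
  "built I (\<sigma>\<lparr>todo_v := b4\<rparr>) = built I \<sigma>" "built I (\<sigma>\<lparr>todo_a := b5\<rparr>) = built I \<sigma>"
  "built I (\<sigma>\<lparr>todo_n := b6\<rparr>) = built I \<sigma>" "built I (\<sigma>\<lparr>todo_l := b7\<rparr>) = built I \<sigma>"
  "built I (\<sigma>\<lparr>no_sol := b8\<rparr>) = built I \<sigma>" "built I (\<sigma>\<lparr>sol := b9\<rparr>) = built I \<sigma>"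
  by (simp_all add: built_def links_ok_def loaded_def)

lemma links_ok_update [simp]:
  "links_ok I L (\<sigma>\<lparr>todo_v := b4\<rparr>) = links_ok I L \<sigma>" "links_ok I L (\<sigma>\<lparr>todo_a := b5\<rparr>) = links_ok I L \<sigma>"
  "links_ok I L (\<sigma>\<lparr>dem := a1\<rparr>) = links_ok I L \<sigma>" "links_ok I L (\<sigma>\<lparr>min_wt := a2\<rparr>) = links_ok I L \<sigma>"
  "links_ok I L (\<sigma>\<lparr>max_wt := a3\<rparr>) = links_ok I L \<sigma>"
  by (simp_all add: links_ok_def)

lemma loaded_update [simp]:
  "loaded I (\<sigma>\<lparr>todo_v := b4\<rparr>) = loaded I \<sigma>" "loaded I (\<sigma>\<lparr>todo_a := b5\<rparr>) = loaded I \<sigma>"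
  "loaded I (\<sigma>\<lparr>dem := a1\<rparr>) = loaded I \<sigma>" "loaded I (\<sigma>\<lparr>min_wt := a2\<rparr>) = loaded I \<sigma>"
  "loaded I (\<sigma>\<lparr>max_wt := a3\<rparr>) = loaded I \<sigma>" "loaded I (\<sigma>\<lparr>all_nodes := a4\<rparr>) = loaded I \<sigma>"
  "loaded I (\<sigma>\<lparr>all_links := a5\<rparr>) = loaded I \<sigma>" "loaded I (\<sigma>\<lparr>num_links := a6\<rparr>) = loaded I \<sigma>"
  "loaded I (\<sigma>\<lparr>link_cap := a7\<rparr>) = loaded I \<sigma>" "loaded I (\<sigma>\<lparr>link_wt := a8\<rparr>) = loaded I \<sigma>"
  "loaded I (\<sigma>\<lparr>adj := a9\<rparr>) = loaded I \<sigma>"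
  by (simp_all add: loaded_def)

text \<open>The net effect of \<open>add_link\<close>. The intermediate \<open>A\<close> matters for
  a loop, where both residual arcs enter the same list.\<close>

definition with_link :: "'v node \<times> 'v node \<Rightarrow> int \<Rightarrow> int \<Rightarrow> 'v ram \<Rightarrow> 'v ram" where
  "with_link e u w \<sigma> = (let A = (adj \<sigma>)(fst e := (e, True) # adj \<sigma> (fst e)) in
     \<sigma>\<lparr>all_links := e # all_links \<sigma>, num_links := num_links \<sigma> + 1,
       link_cap := (link_cap \<sigma>)(e := u), link_wt := (link_wt \<sigma>)(e := w),
       adj := A(snd e := (e, False) # A (snd e))\<rparr>)"

lemma with_link_simps [simp]:
  "loaded I (with_link e u w \<sigma>) = loaded I \<sigma>" "all_nodes (with_link e u w \<sigma>) = all_nodes \<sigma>"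
  "dem (with_link e u w \<sigma>) = dem \<sigma>" "min_wt (with_link e u w \<sigma>) = min_wt \<sigma>"
  "max_wt (with_link e u w \<sigma>) = max_wt \<sigma>" "todo_v (with_link e u w \<sigma>) = todo_v \<sigma>"
  "todo_a (with_link e u w \<sigma>) = todo_a \<sigma>" "in_weight (with_link e u w \<sigma>) = in_weight \<sigma>"
  "in_bal (with_link e u w \<sigma>) = in_bal \<sigma>"
  by (simp_all add: with_link_def Let_def)

text \<open>\<open>e\<close> is evaluated anew in each of the three assignments; the assumption
  makes it depend only on cells that these leave unchanged.\<close>

lemma run_add_link:
  assumes "\<And>s. todo_a s = todo_a \<sigma> \<Longrightarrow> todo_v s = todo_v \<sigma> \<Longrightarrow> e s = e \<sigma>"
  shows "run (add_link e u w) \<sigma> Q \<longleftrightarrow> Q 3 (with_link (e \<sigma>) (u \<sigma>) (w \<sigma>) \<sigma>)"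
proof -
  have "e (\<sigma>\<lparr>all_links := a, num_links := b, link_cap := c, link_wt := d\<rparr>) = e \<sigma>"
    "e (\<sigma>\<lparr>all_links := a, num_links := b, link_cap := c, link_wt := d, adj := f\<rparr>) = e \<sigma>" for a b c d f
    by (rule assms; simp)+
  then show ?thesis by (simp add: add_link_def run_simps with_link_def Let_def numeral_3_eq_3)
qed

context bnfp
begin

lemma links_ok_with_link:
  assumes "links_ok I L \<sigma>" "e \<notin> L" "finite L" "u = star_cap I e" "w = star_weight I e"
  shows "links_ok I (insert e L) (with_link e u w \<sigma>)"
proof -
  obtain i j where e: "e = (i, j)" by (cases e)
  have "distinct (adj (with_link e u w \<sigma>) k) \<and>
      set (adj (with_link e u w \<sigma>) k) = {a. fst a \<in> insert e L \<and> rtail a = k}"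
    if "k \<in> pverts (star I)" for k
    using assms(1,2) that unfolding links_ok_def with_link_def Let_def e
    by (auto split: if_splits)
  then show ?thesis
    using assms unfolding links_ok_def by (auto simp: with_link_def Let_def)
qed

text \<open>The unit of all cost bounds. The 2 stands for \<open>Src\<close> and \<open>Snk\<close>,
  and lets the unit absorb additive constants.\<close>

definition input_size :: nat where
  "input_size = card (VV I) + mstar I + 2"

lemma card_nodes: "card (pverts (star I)) = card (VV I) + 2"
proof -
  have "card (Vtx ` VV I) = card (VV I)" by (rule card_image) (simp add: inj_on_def)
  moreover have "Src \<notin> Vtx ` VV I" "Snk \<notin> Vtx ` VV I" by auto
  ultimately show ?thesis unfolding star_verts using finite_VV by simp
qed

lemma card_EE_le: "card (EE I) \<le> mstar I"
proof -
  have "card ((\<lambda>(i, j). (Vtx i, Vtx j)) ` EE I) = card (EE I)"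
    by (rule card_image) (auto simp: inj_on_def)
  moreover have "\<dots> \<le> mstar I" if "card ((\<lambda>(i, j). (Vtx i, Vtx j)) ` EE I) = card (EE I)"
    unfolding that[symmetric] by (rule card_mono[OF finite_star]) (auto simp: star_def)
  ultimately show ?thesis by simp
qed

text \<open>A vertex is never both source and sink, so it receives at most one new arc.\<close>

lemma mstar_le: "mstar I \<le> card (EE I) + card (VV I)"
proof -
  have "mstar I \<le> card ((\<lambda>(i, j). (Vtx i, Vtx j)) ` EE I) + card ((\<lambda>i. (Src :: 'v node, Vtx i)) ` sources I)
      + card ((\<lambda>j. (Vtx j, Snk :: 'v node)) ` sinks I)"
    unfolding star_def pair_pre_digraph.simps
    using card_Un_le[of "(\<lambda>(i, j). (Vtx i, Vtx j)) ` EE I \<union> (\<lambda>i. (Src :: 'v node, Vtx i)) ` sources I"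
        "(\<lambda>j. (Vtx j, Snk :: 'v node)) ` sinks I"]
      card_Un_le[of "(\<lambda>(i, j). (Vtx i, Vtx j)) ` EE I" "(\<lambda>i. (Src :: 'v node, Vtx i)) ` sources I"]
    by linarith
  also have "\<dots> \<le> card (EE I) + (card (sources I) + card (sinks I))"
    unfolding add.assoc using finite_EE finite_sources finite_sinks by (intro add_mono card_image_le)
  also have "card (sources I) + card (sinks I) = card (sources I \<union> sinks I)"
    using finite_sources finite_sinks by (intro card_Un_disjoint[symmetric]) (auto simp: sources_def sinks_def)
  also have "card (sources I \<union> sinks I) \<le> card (VV I)"
    using finite_VV by (intro card_mono) (auto simp: sources_def sinks_def)
  finally show ?thesis by simp
qed

lemma run_build_nodes:
  assumes "loaded I \<sigma>" "todo_v \<sigma> = in_verts \<sigma>" "all_nodes \<sigma> = [Src, Snk]" "all_links \<sigma> = []"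
    "num_links \<sigma> = 0" "adj \<sigma> Src = []" "adj \<sigma> Snk = []"
  shows "run (WHILE (\<lambda>\<sigma>. todo_v \<sigma> \<noteq> []) DO
        Do (\<lambda>\<sigma>. \<sigma>\<lparr>all_nodes := Vtx (hd (todo_v \<sigma>)) # all_nodes \<sigma>,
                  adj := (adj \<sigma>)(Vtx (hd (todo_v \<sigma>)) := []), todo_v := tl (todo_v \<sigma>)\<rparr>)) \<sigma>
     (\<lambda>t \<tau>. t \<le> 2 * card (VV I) + 1 \<and> loaded I \<tau> \<and> distinct (all_nodes \<tau>) \<and>
        set (all_nodes \<tau>) = pverts (star I) \<and> links_ok I {} \<tau> \<and>
        dem \<tau> = dem \<sigma> \<and> min_wt \<tau> = min_wt \<sigma> \<and> max_wt \<tau> = max_wt \<sigma>)"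
proof -
  have load: "distinct (in_verts \<sigma>)" "set (in_verts \<sigma>) = VV I" using assms(1) by (auto simp: loaded_def)
  then have len: "length (in_verts \<sigma>) = card (VV I)" using distinct_card by metis
  show ?thesis
  proof (rule run_for_list[where todo = todo_v and xs = "in_verts \<sigma>" and k = 1 and
        Inv = "\<lambda>D s. loaded I s \<and> distinct (all_nodes s) \<and>
          set (all_nodes s) = {Src, Snk} \<union> Vtx ` set D \<and> all_links s = [] \<and> num_links s = 0 \<and>
          (\<forall>i\<in>set (all_nodes s). adj s i = []) \<and>
          dem s = dem \<sigma> \<and> min_wt s = min_wt \<sigma> \<and> max_wt s = max_wt \<sigma>"], goal_cases)
    case (3 D i r s)
    then have "i \<notin> set D" using load(1) by auto
    with 3 show ?case by (simp add: run_simps) auto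
  qed (use assms load len in \<open>auto simp: links_ok_def star_verts\<close>)
qed

lemma run_build_arcs:
  assumes "loaded I \<sigma>" "todo_a \<sigma> = in_arcs \<sigma>" "distinct (all_nodes \<sigma>)"
    "set (all_nodes \<sigma>) = pverts (star I)" "links_ok I {} \<sigma>"
    "dem \<sigma> = 0" "min_wt \<sigma> = 0" "max_wt \<sigma> = 0"
  shows "run (WHILE (\<lambda>\<sigma>. todo_a \<sigma> \<noteq> []) DO
        (add_link (\<lambda>\<sigma>. (Vtx (fst (hd (todo_a \<sigma>))), Vtx (snd (hd (todo_a \<sigma>)))))
           (\<lambda>\<sigma>. in_cap \<sigma> (hd (todo_a \<sigma>))) (\<lambda>\<sigma>. in_weight \<sigma> (hd (todo_a \<sigma>))) ;;
         Do (\<lambda>\<sigma>. \<sigma>\<lparr>min_wt := min (min_wt \<sigma>) (in_weight \<sigma> (hd (todo_a \<sigma>))),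
                   max_wt := max (max_wt \<sigma>) (in_weight \<sigma> (hd (todo_a \<sigma>))),
                   todo_a := tl (todo_a \<sigma>)\<rparr>))) \<sigma>
     (\<lambda>t \<tau>. t \<le> 5 * card (EE I) + 1 \<and> loaded I \<tau> \<and> distinct (all_nodes \<tau>) \<and>
        set (all_nodes \<tau>) = pverts (star I) \<and>
        links_ok I ((\<lambda>(i, j). (Vtx i, Vtx j)) ` EE I) \<tau> \<and> dem \<tau> = 0 \<and>
        min_wt \<tau> = new_weight I \<and> max_wt \<tau> = Max (insert 0 (weight I ` EE I)))"
proof -
  let ?lift = "\<lambda>(i, j). (Vtx i, Vtx j)"
  have load: "distinct (in_arcs \<sigma>)" "set (in_arcs \<sigma>) = EE I" using assms(1) by (auto simp: loaded_def)
  then have len: "length (in_arcs \<sigma>) = card (EE I)" using distinct_card by metis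
  show ?thesis
  \<comment> \<open>\<open>k = 4\<close>: three assignments of \<open>add_link\<close> and one for
    the extreme weights.\<close>
  proof (rule run_for_list[where todo = todo_a and xs = "in_arcs \<sigma>" and k = 4 and
        Inv = "\<lambda>D s. loaded I s \<and> distinct (all_nodes s) \<and>
          set (all_nodes s) = pverts (star I) \<and> links_ok I (?lift ` set D) s \<and> dem s = 0 \<and>
          min_wt s = Min (insert 0 (weight I ` set D)) \<and> max_wt s = Max (insert 0 (weight I ` set D))"], goal_cases)
    case (3 D e r s)
    obtain i j where e: "e = (i, j)" by (cases e)
    have "e \<notin> set D" "e \<in> EE I" using load 3 by auto
    then have w: "in_weight s e = weight I e" "in_cap s e = cap I e" using 3 by (auto simp: loaded_def)
    have "links_ok I (insert (?lift e) (?lift ` set D)) (with_link (?lift e) (in_cap s e) (in_weight s e) s)"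
      using 3 \<open>e \<notin> set D\<close> w by (intro links_ok_with_link) (auto simp: e)
    then show ?case using 3 w
      by (simp add: run_simps run_add_link e insert_commute[of 0] min.commute max.commute)
  qed (use assms load len in \<open>auto simp: new_weight_def\<close>)
qed

lemma run_build:
  assumes "loaded I \<sigma>"
  shows "run build \<sigma> (\<lambda>t \<tau>. t \<le> 12 * input_size \<and> built I \<tau>)"
proof -
  let ?A = "(\<lambda>(i, j). (Vtx i, Vtx j)) ` EE I"
  let ?L = "\<lambda>D. ?A \<union> (\<lambda>i. (Src, Vtx i)) ` (sources I \<inter> D) \<union> (\<lambda>j. (Vtx j, Snk)) ` (sinks I \<inter> D)"
  let ?B = "\<lambda>s. loaded I s \<and> distinct (all_nodes s) \<and> set (all_nodes s) = pverts (star I) \<and>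
    min_wt s = new_weight I \<and> max_wt s = Max (insert 0 (weight I ` EE I))"
  have supplies: "run (WHILE (\<lambda>\<sigma>. todo_v \<sigma> \<noteq> []) DO
        ((IF (\<lambda>\<sigma>. 0 < in_bal \<sigma> (hd (todo_v \<sigma>)))
          THEN (add_link (\<lambda>\<sigma>. (Src, Vtx (hd (todo_v \<sigma>))))
                  (\<lambda>\<sigma>. in_bal \<sigma> (hd (todo_v \<sigma>))) min_wt ;;
                Do (\<lambda>\<sigma>. \<sigma>\<lparr>dem := dem \<sigma> + in_bal \<sigma> (hd (todo_v \<sigma>))\<rparr>))
          ELSE (IF (\<lambda>\<sigma>. in_bal \<sigma> (hd (todo_v \<sigma>)) < 0)
                THEN add_link (\<lambda>\<sigma>. (Vtx (hd (todo_v \<sigma>)), Snk))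
                       (\<lambda>\<sigma>. - in_bal \<sigma> (hd (todo_v \<sigma>))) min_wt
                ELSE Do (\<lambda>\<sigma>. \<sigma>))) ;;
         Do (\<lambda>\<sigma>. \<sigma>\<lparr>todo_v := tl (todo_v \<sigma>)\<rparr>))) s
      (\<lambda>t \<tau>. t \<le> 7 * card (VV I) + 1 \<and> built I \<tau>)"
    if s: "?B s" "links_ok I ?A s" "dem s = 0" "todo_v s = in_verts s" for s
  proof -
    have load: "distinct (in_verts s)" "set (in_verts s) = VV I" using s(1) by (auto simp: loaded_def)
    then have len: "length (in_verts s) = card (VV I)" using distinct_card by metis
    show ?thesis
    \<comment> \<open>\<open>k = 6\<close>: one test and four assignments at a source, two tests and
      three assignments at a sink, and one assignment to advance.\<close>
    proof (rule run_for_list[where todo = todo_v and xs = "in_verts s" and k = 6 and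
          Inv = "\<lambda>D s. ?B s \<and> links_ok I (?L (set D)) s \<and> dem s = (\<Sum>i\<in>sources I \<inter> set D. bal I i)"], goal_cases)
      case (3 D i r \<sigma>)
      have i: "i \<notin> set D" "i \<in> VV I" using load 3 by auto
      then have b: "in_bal \<sigma> i = bal I i" using 3 by (auto simp: loaded_def)
      have fin: "finite (?L (set D))" using finite_EE finite_sources finite_sinks by auto
      note hyps = 3
      consider "0 < bal I i" | "bal I i < 0" | "bal I i = 0" by linarith
      then show ?case
      proof cases
        case 1
        then have i': "i \<in> sources I" "i \<notin> sinks I" using i by (auto simp: sources_def sinks_def)
        have "links_ok I (insert (Src, Vtx i) (?L (set D))) (with_link (Src, Vtx i) (bal I i) (new_weight I) \<sigma>)"
          using hyps i fin by (intro links_ok_with_link) auto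
        with hyps 1 b i i' show ?thesis by (simp add: run_simps run_add_link)
      next
        case 2
        then have i': "i \<in> sinks I" "i \<notin> sources I" using i by (auto simp: sources_def sinks_def)
        have "links_ok I (insert (Vtx i, Snk) (?L (set D))) (with_link (Vtx i, Snk) (- bal I i) (new_weight I) \<sigma>)"
          using hyps i fin by (intro links_ok_with_link) auto
        with hyps 2 b i i' show ?thesis by (simp add: run_simps run_add_link)
      next
        case 3
        then have i': "i \<notin> sinks I" "i \<notin> sources I" by (auto simp: sources_def sinks_def)
        with hyps 3 b show ?thesis by (simp add: run_simps)
      qed
    next
      case (4 t \<tau>)
      have "sources I \<inter> VV I = sources I" "sinks I \<inter> VV I = sinks I" by (auto simp: sources_def sinks_def)
      with 4 load len show ?case by (simp add: built_def star_def demand_def)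
    qed (use s in auto)
  qed
  show ?thesis
    unfolding build_def run_Seq run_Do
  proof (rule run_mono[OF run_build_nodes], goal_cases)
    case (8 t1 s1)
    show ?case
    proof (rule run_mono[OF run_build_arcs], goal_cases)
      case (9 t2 s2)
      show ?case
      proof (rule run_mono[OF supplies], goal_cases)
        case (5 t3 s3)
        with 8 9 card_EE_le show ?case by (simp add: input_size_def)
      qed (use 9 in simp_all)
    qed (use 8 in simp_all)
  qed (use assms in simp_all)
qed

end

section \<open>Searching and augmenting\<close>

definition core where
  "core \<sigma> = (flw \<sigma>, fval \<sigma>, level \<sigma>, scale \<sigma>, th_num \<sigma>, th_den \<sigma>)"

text \<open>\<open>usable\<close> without the label test. It does not change during a search and so
  defines the fixed graph that is searched.\<close>

definition admissible :: "'v ram \<Rightarrow> 'v node rarc \<Rightarrow> bool" where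
  "admissible \<sigma> a \<longleftrightarrow> link_wt \<sigma> (fst a) \<le> level \<sigma> \<and> 0 < rescap (link_cap \<sigma>) (flw \<sigma>) a \<and>
     th_num \<sigma> \<le> th_den \<sigma> * rescap (link_cap \<sigma>) (flw \<sigma>) a"

lemma usable_iff: "usable \<sigma> a \<longleftrightarrow> admissible \<sigma> a \<and> \<not> labelled \<sigma> (rhead a)"
  by (auto simp: usable_def admissible_def)

lemma admissible_update [simp]:
  "admissible (\<sigma>\<lparr>labelled := a8\<rparr>) = admissible \<sigma>" "admissible (\<sigma>\<lparr>via := a9\<rparr>) = admissible \<sigma>"
  "admissible (\<sigma>\<lparr>work := b1\<rparr>) = admissible \<sigma>" "admissible (\<sigma>\<lparr>todo_n := b6\<rparr>) = admissible \<sigma>"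
  by (simp_all add: admissible_def fun_eq_iff)

lemma rwalk_crossing:
  assumes "rwalk u P v" "u \<in> R" "v \<notin> R"
  shows "\<exists>a\<in>set P. rtail a \<in> R \<and> rhead a \<notin> R"
  using assms
proof (induction P arbitrary: u)
  case (Cons a P)
  then show ?case by (cases "rhead a \<in> R") auto
qed auto

definition found_path :: "'v ram \<Rightarrow> 'v node rarc list \<Rightarrow> bool" where
  "found_path \<sigma> P \<longleftrightarrow> rwalk Src P Snk \<and> distinct (Src # map rhead P) \<and> (\<forall>a\<in>set P. via \<sigma> (rhead a) = a)"

context bnfp
begin

section \<open>Labelling search in linear time\<close>

lemma run_zero_flow:
  assumes "built I \<sigma>"
  shows "run zero_flow \<sigma> (\<lambda>t \<tau>. t \<le> 3 * input_size \<and> built I \<tau> \<and> (\<forall>e\<in>parcs (star I). flw \<tau> e = 0) \<and> fval \<tau> = 0)"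
proof -
  have len: "length (all_links \<sigma>) = mstar I" "set (all_links \<sigma>) = parcs (star I)"
    using assms distinct_card[of "all_links \<sigma>"] by (auto simp: built_def links_ok_def)
  show ?thesis
    unfolding zero_flow_def run_Seq run_Do
    by (rule run_for_list[where todo = todo_l and xs = "all_links \<sigma>" and k = 1 and
        Inv = "\<lambda>D s. built I s \<and> (\<forall>e\<in>set D. flw s e = 0) \<and> fval s = 0"])
      (use assms len in \<open>auto simp: run_simps input_size_def\<close>)
qed

text \<open>Each link yields two residual arcs, and each of these lies in the list of its tail
  only.\<close>

lemma sum_length_adj:
  assumes "built I \<sigma>"
  shows "(\<Sum>i\<in>pverts (star I). length (adj \<sigma> i)) = 2 * mstar I"
proof -
  have "length (adj \<sigma> i) = card {a. fst a \<in> parcs (star I) \<and> rtail a = i}" if "i \<in> pverts (star I)" for i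
    using assms that distinct_card[of "adj \<sigma> i"] by (auto simp: built_def links_ok_def)
  then have "(\<Sum>i\<in>pverts (star I). length (adj \<sigma> i))
      = (\<Sum>i\<in>pverts (star I). card {a. fst a \<in> parcs (star I) \<and> rtail a = i})" by simp
  also have "\<dots> = card (\<Union>i\<in>pverts (star I). {a. fst a \<in> parcs (star I) \<and> rtail a = i})"
    using finite_star finite_star_verts
    by (intro card_UN_disjoint[symmetric])
      (auto intro: finite_subset[of _ "parcs (star I) \<times> UNIV"])
  also have "(\<Union>i\<in>pverts (star I). {a. fst a \<in> parcs (star I) \<and> rtail a = i}) = parcs (star I) \<times> (UNIV :: bool set)"
    using rarc_verts by (auto simp: mem_Times_iff)
  finally show ?thesis by (simp add: card_cartesian_product)
qed

lemma adj_set: "built I \<sigma> \<Longrightarrow> i \<in> pverts (star I) \<Longrightarrow> set (adj \<sigma> i) = {a. fst a \<in> parcs (star I) \<and> rtail a = i}"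
  by (auto simp: built_def links_ok_def)

text \<open>The path has to be one that the \<open>via\<close> cells retrace, because the
  augmentation finds its path from these cells alone.\<close>

definition labels_ok :: "'v ram \<Rightarrow> bool" where
  "labels_ok s \<longleftrightarrow> (\<forall>i\<in>pverts (star I). labelled s i \<longrightarrow>
     (\<exists>P. rwalk Src P i \<and> distinct (Src # map rhead P) \<and>
       (\<forall>a\<in>set P. fst a \<in> parcs (star I) \<and> admissible s a \<and> labelled s (rhead a) \<and> via s (rhead a) = a)))"

text \<open>Admissible arcs from labelled to unlabelled nodes are always pending. Once nothing is
  pending, the labelled nodes form a cut that no admissible arc leaves.\<close>

definition search_inv :: "'v ram \<Rightarrow> bool" where
  "search_inv s \<longleftrightarrow> built I s \<and> labelled s Src \<and> labels_ok s \<and>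
     (\<forall>a\<in>set (concat (work s)). fst a \<in> parcs (star I) \<and> labelled s (rtail a)) \<and>
     (\<forall>a. fst a \<in> parcs (star I) \<and> labelled s (rtail a) \<and> admissible s a \<and> \<not> labelled s (rhead a) \<longrightarrow>
        a \<in> set (concat (work s)))"

text \<open>Pending arcs and lists, together with those that future labels would add: labelling a
  node only moves its share from the sum to the stack.\<close>

definition search_pot :: "'v ram \<Rightarrow> nat" where
  "search_pot s = length (concat (work s)) + length (work s) +
     (\<Sum>i\<in>{i \<in> pverts (star I). \<not> labelled s i}. length (adj s i) + 1)"

text \<open>Overwriting \<open>via\<close> at the new node harms no earlier path, since all heads on
  those paths were labelled before. The new node gets the path to \<open>rtail a\<close> extended by
  \<open>a\<close>.\<close>

lemma search_label:
  assumes inv: "search_inv s" and work: "work s = (a # l) # ls" and "admissible s a" "\<not> labelled s (rhead a)"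
  defines "s' \<equiv> s\<lparr>labelled := (labelled s)(rhead a := True), via := (via s)(rhead a := a),
      work := adj s (rhead a) # l # ls\<rparr>"
  shows "search_inv s'" "search_pot s' + 1 \<le> search_pot s"
proof -
  let ?i = "rhead a"
  have a: "fst a \<in> parcs (star I)" "labelled s (rtail a)" using inv work by (auto simp: search_inv_def)
  note verts = rarc_verts[OF a(1)]
  have built: "built I s" using inv by (simp add: search_inv_def)
  have "?i \<noteq> Src" using inv assms(4) by (auto simp: search_inv_def)
  have admissible: "admissible s' = admissible s" unfolding s'_def by simp
  have "labels_ok s'"
    unfolding labels_ok_def admissible
  proof (intro ballI impI)
    fix i assume i: "i \<in> pverts (star I)" "labelled s' i"
    define k where "k = (if i = ?i then rtail a else i)"
    have k: "k \<in> pverts (star I)" "labelled s k"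
      using i verts a(2) by (auto simp: k_def s'_def split: if_splits)
    then obtain P where P: "rwalk Src P k" "distinct (Src # map rhead P)"
      "\<forall>b\<in>set P. fst b \<in> parcs (star I) \<and> admissible s b \<and> labelled s (rhead b) \<and> via s (rhead b) = b"
      using inv unfolding search_inv_def labels_ok_def by blast
    then have P': "\<forall>b\<in>set P. fst b \<in> parcs (star I) \<and> admissible s b \<and> labelled s' (rhead b) \<and> via s' (rhead b) = b"
      and new: "?i \<notin> rhead ` set P"
      using assms(4) by (auto simp: s'_def)
    show "\<exists>P. rwalk Src P i \<and> distinct (Src # map rhead P) \<and>
       (\<forall>b\<in>set P. fst b \<in> parcs (star I) \<and> admissible s b \<and> labelled s' (rhead b) \<and> via s' (rhead b) = b)"
    proof (cases "i = ?i")
      case True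
      then have "rwalk Src (P @ [a]) i" using P(1) by (simp add: rwalk_snoc k_def)
      moreover have "distinct (Src # map rhead (P @ [a]))" using P(2) new \<open>?i \<noteq> Src\<close> by auto
      moreover have "\<forall>b\<in>set (P @ [a]). fst b \<in> parcs (star I) \<and> admissible s b \<and> labelled s' (rhead b) \<and> via s' (rhead b) = b"
        using P' a(1) assms(3) by (auto simp: s'_def)
      ultimately show ?thesis by blast
    next
      case False
      with P P' show ?thesis by (auto simp: k_def)
    qed
  qed
  \<comment> \<open>The arc \<open>a\<close> leaves the top list, but a further copy may remain on
    the stack.\<close>
  moreover have "set (concat (work s')) = {b. fst b \<in> parcs (star I) \<and> rtail b = ?i} \<union> (set (concat (work s)) - {a}) \<union> (if a \<in> set l \<union> set (concat ls) then {a} else {})"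
    using adj_set[OF built, of ?i] verts by (auto simp: s'_def work)
  ultimately show "search_inv s'"
    using inv a assms(4) unfolding search_inv_def admissible by (auto simp: s'_def)
  have "{i \<in> pverts (star I). \<not> labelled s i} = insert ?i {i \<in> pverts (star I). \<not> labelled s' i}"
    using verts assms(4) by (auto simp: s'_def)
  then have "(\<Sum>i\<in>{i \<in> pverts (star I). \<not> labelled s i}. length (adj s i) + 1) =
      length (adj s ?i) + 1 + (\<Sum>i\<in>{i \<in> pverts (star I). \<not> labelled s' i}. length (adj s' i) + 1)"
    using finite_star_verts by (simp add: s'_def)
  then show "search_pot s' + 1 \<le> search_pot s" by (simp add: search_pot_def work) (simp add: s'_def)
qed

lemma run_search_loop:
  assumes "search_inv \<sigma>"
  shows "run (WHILE (\<lambda>\<sigma>. work \<sigma> \<noteq> [] \<and> \<not> labelled \<sigma> Snk) DO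
        (IF (\<lambda>\<sigma>. hd (work \<sigma>) = [])
         THEN Do (\<lambda>\<sigma>. \<sigma>\<lparr>work := tl (work \<sigma>)\<rparr>)
         ELSE (IF (\<lambda>\<sigma>. usable \<sigma> (hd (hd (work \<sigma>))))
               THEN Do (\<lambda>\<sigma>. let a = hd (hd (work \<sigma>)); i = rhead a in
                      \<sigma>\<lparr>labelled := (labelled \<sigma>)(i := True), via := (via \<sigma>)(i := a),
                        work := adj \<sigma> i # tl (hd (work \<sigma>)) # tl (work \<sigma>)\<rparr>)
               ELSE Do (\<lambda>\<sigma>. \<sigma>\<lparr>work := tl (hd (work \<sigma>)) # tl (work \<sigma>)\<rparr>)))) \<sigma>
     (\<lambda>t \<tau>. t \<le> 4 * search_pot \<sigma> + 1 \<and> search_inv \<tau> \<and> core \<tau> = core \<sigma> \<and> admissible \<tau> = admissible \<sigma> \<and>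
        (work \<tau> = [] \<or> labelled \<tau> Snk))"
\<comment> \<open>One loop test, at most two inner tests and one assignment: 4 per unit of
  potential.\<close>
proof (rule run_While[where \<Phi> = "\<lambda>s. 4 * search_pot s" and
      Inv = "\<lambda>s. search_inv s \<and> core s = core \<sigma> \<and> admissible s = admissible \<sigma>"], goal_cases)
  case (1 s)
  then have inv: "search_inv s" and core: "core s = core \<sigma>" "admissible s = admissible \<sigma>" and "work s \<noteq> []" by auto
  then consider ls where "work s = [] # ls" | a l ls where "work s = (a # l) # ls"
    by (metis list.exhaust)
  then show ?case
  proof cases
    case 1
    then show ?thesis using inv core
      by (simp add: run_simps search_inv_def search_pot_def labels_ok_def core_def)
  next
    case 2
    show ?thesis
    proof (cases "usable s a")
      case True
      then show ?thesis using search_label[OF inv 2] core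
        by (simp add: run_simps 2 usable_iff Let_def core_def)
    next
      case False
      have "set (concat (work s)) = insert a (set (concat (l # ls)))" by (auto simp: 2)
      moreover have "labels_ok (s\<lparr>work := l # ls\<rparr>) = labels_ok s" by (simp add: labels_ok_def)
      ultimately have "search_inv (s\<lparr>work := l # ls\<rparr>)"
        using inv False unfolding search_inv_def usable_iff by (simp del: split_paired_All) blast
      then show ?thesis using False core by (simp add: run_simps 2 search_pot_def core_def)
    qed
  qed
qed (use assms in auto)

text \<open>Cells outside the auxiliary graph may hold anything; reading them as 0 makes the initial
  flow equal to \<open>\<lambda>_. 0\<close> and augmentation an equation of functions.\<close>

definition flow_of :: "'v ram \<Rightarrow> 'v flow" where
  "flow_of \<sigma> = (\<lambda>e. if e \<in> parcs (star I) then real_of_int (flw \<sigma> e) else 0)"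

definition flow_state :: "'v ram \<Rightarrow> 'v flow \<Rightarrow> bool" where
  "flow_state \<sigma> x \<longleftrightarrow> built I \<sigma> \<and> flow_of \<sigma> = x \<and> is_flow I x \<and> real_of_int (fval \<sigma>) = flow_val I x"

lemma flow_state_update [simp]:
  "flow_state (\<sigma>\<lparr>level := a3\<rparr>) x = flow_state \<sigma> x" "flow_state (\<sigma>\<lparr>new_level := a4\<rparr>) x = flow_state \<sigma> x"
  "flow_state (\<sigma>\<lparr>th_num := a5\<rparr>) x = flow_state \<sigma> x" "flow_state (\<sigma>\<lparr>th_den := a6\<rparr>) x = flow_state \<sigma> x"
  "flow_state (\<sigma>\<lparr>scale := a7\<rparr>) x = flow_state \<sigma> x" "flow_state (\<sigma>\<lparr>todo_a := b5\<rparr>) x = flow_state \<sigma> x"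
  by (simp_all add: flow_state_def flow_of_def cong: if_cong)

lemma flow_of_int_valued: "int_valued (flow_of \<sigma>)"
  by (auto simp: int_valued_def flow_of_def)

lemma res_flow_of:
  "built I \<sigma> \<Longrightarrow> fst a \<in> parcs (star I) \<Longrightarrow> res I (flow_of \<sigma>) a = real_of_int (rescap (link_cap \<sigma>) (flw \<sigma>) a)"
  by (cases a) (auto simp: flow_of_def built_def links_ok_def)

lemma admissible_iff:
  assumes "built I \<sigma>" "fst a \<in> parcs (star I)"
  shows "admissible \<sigma> a \<longleftrightarrow> fst a \<in> parcs (star_le I (level \<sigma>)) \<and> 0 < res I (flow_of \<sigma>) a \<and>
    real_of_int (th_num \<sigma>) \<le> real_of_int (th_den \<sigma>) * res I (flow_of \<sigma>) a"
proof -
  have "link_wt \<sigma> (fst a) = star_weight I (fst a)" using assms by (auto simp: built_def links_ok_def)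
  then show ?thesis
    unfolding admissible_def res_flow_of[OF assms] of_int_mult[symmetric] of_int_le_iff of_int_0_less_iff
    using assms(2) by (simp add: star_le_def)
qed

lemma path_cap_in: "P \<noteq> [] \<Longrightarrow> \<exists>a\<in>set P. path_cap I x P = res I x a"
  using Min_in[of "res I x ` set P"] unfolding path_cap_def by (simp add: image_iff)

text \<open>Success hands over the recorded path. After a failure, a suitable path would have to
  leave the labelled set along an admissible arc, and such an arc would still be pending.
  \<open>0 \<le> th_den \<sigma>\<close> passes the threshold from the capacity of a path to its
  arcs.\<close>

lemma run_search:
  assumes st: "flow_state \<sigma> x" and den: "0 \<le> th_den \<sigma>"
  shows "run search \<sigma> (\<lambda>t \<tau>. t \<le> 12 * input_size \<and> flow_state \<tau> x \<and> core \<tau> = core \<sigma> \<and>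
    (if labelled \<tau> Snk
     then \<exists>P. found_path \<tau> P \<and> augmenting_path I (level \<sigma>) x P \<and>
       real_of_int (th_num \<sigma>) \<le> real_of_int (th_den \<sigma>) * path_cap I x P
     else \<nexists>P. augmenting_path I (level \<sigma>) x P \<and>
       real_of_int (th_num \<sigma>) \<le> real_of_int (th_den \<sigma>) * path_cap I x P))"
proof -
  have built: "built I \<sigma>" using st by (simp add: flow_state_def)
  then have nodes: "set (all_nodes \<sigma>) = pverts (star I)" "length (all_nodes \<sigma>) = card (VV I) + 2"
    using distinct_card[of "all_nodes \<sigma>"] by (auto simp: built_def card_nodes)
  have x: "x = flow_of \<sigma>" using st by (simp add: flow_state_def)
  have final: "t \<le> 4 * (2 * mstar I + card (VV I) + 2) + 1 \<Longrightarrow> search_inv \<tau> \<Longrightarrow> core \<tau> = core \<sigma> \<Longrightarrow>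
    work \<tau> = [] \<or> labelled \<tau> Snk \<Longrightarrow> flow_state \<tau> x \<and>
    (if labelled \<tau> Snk
     then \<exists>P. found_path \<tau> P \<and> augmenting_path I (level \<sigma>) x P \<and>
       real_of_int (th_num \<sigma>) \<le> real_of_int (th_den \<sigma>) * path_cap I x P
     else \<nexists>P. augmenting_path I (level \<sigma>) x P \<and>
       real_of_int (th_num \<sigma>) \<le> real_of_int (th_den \<sigma>) * path_cap I x P)" for t \<tau>
  proof (rule conjI)
    assume inv: "search_inv \<tau>" and core: "core \<tau> = core \<sigma>" and stop: "work \<tau> = [] \<or> labelled \<tau> Snk"
    have bt: "built I \<tau>" using inv by (simp add: search_inv_def)
    have xt: "flow_of \<tau> = x" using core x by (simp add: flow_of_def core_def cong: if_cong)
    show "flow_state \<tau> x" using st bt xt core by (auto simp: flow_state_def core_def)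
    have admissible: "admissible \<tau> a \<longleftrightarrow> fst a \<in> parcs (star_le I (level \<sigma>)) \<and> 0 < res I x a \<and>
      real_of_int (th_num \<sigma>) \<le> real_of_int (th_den \<sigma>) * res I x a" if "fst a \<in> parcs (star I)" for a
      using admissible_iff[OF bt that] core xt by (simp add: core_def)
    show "if labelled \<tau> Snk
     then \<exists>P. found_path \<tau> P \<and> augmenting_path I (level \<sigma>) x P \<and>
       real_of_int (th_num \<sigma>) \<le> real_of_int (th_den \<sigma>) * path_cap I x P
     else \<nexists>P. augmenting_path I (level \<sigma>) x P \<and>
       real_of_int (th_num \<sigma>) \<le> real_of_int (th_den \<sigma>) * path_cap I x P"
    proof (cases "labelled \<tau> Snk")
      case True
      have "Snk \<in> pverts (star I)" by (simp add: star_verts)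
      with True inv obtain P where P: "rwalk Src P Snk" "distinct (Src # map rhead P)"
        "\<forall>a\<in>set P. fst a \<in> parcs (star I) \<and> admissible \<tau> a \<and> labelled \<tau> (rhead a) \<and> via \<tau> (rhead a) = a"
        unfolding search_inv_def labels_ok_def by blast
      have PG: "fst a \<in> parcs (star_le I (level \<sigma>)) \<and> 0 < res I x a \<and>
          real_of_int (th_num \<sigma>) \<le> real_of_int (th_den \<sigma>) * res I x a" if "a \<in> set P" for a
        using P(3) admissible that by blast
      then have aug: "augmenting_path I (level \<sigma>) x P"
        using P(1,2) unfolding augmenting_path_iff by blast
      moreover have "found_path \<tau> P" using P by (simp add: found_path_def)
      moreover have "real_of_int (th_num \<sigma>) \<le> real_of_int (th_den \<sigma>) * path_cap I x P"
        using path_cap_in[OF augmenting_path_not_Nil[OF aug], of x] PG by auto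
      ultimately show ?thesis using True by auto
    next
      case False
      have "\<not> (augmenting_path I (level \<sigma>) x P \<and>
        real_of_int (th_num \<sigma>) \<le> real_of_int (th_den \<sigma>) * path_cap I x P)" for P
      proof
        assume P: "augmenting_path I (level \<sigma>) x P \<and>
          real_of_int (th_num \<sigma>) \<le> real_of_int (th_den \<sigma>) * path_cap I x P"
        then have "rwalk Src P Snk" by (simp add: augmenting_path_iff)
        from rwalk_crossing[OF this, of "{i. labelled \<tau> i}"] False inv
        obtain a where a: "a \<in> set P" "labelled \<tau> (rtail a)" "\<not> labelled \<tau> (rhead a)"
          unfolding search_inv_def mem_Collect_eq by blast
        have le: "fst a \<in> parcs (star_le I (level \<sigma>))" "0 < res I x a"
          using P a(1) unfolding augmenting_path_iff by blast+
        then have mem: "fst a \<in> parcs (star I)" using star_le_subset by blast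
        have "path_cap I x P \<le> res I x a" using a(1) by (simp add: path_cap_def)
        then have "real_of_int (th_den \<sigma>) * path_cap I x P \<le> real_of_int (th_den \<sigma>) * res I x a"
          using den by (simp add: mult_left_mono)
        then have "admissible \<tau> a" using admissible[OF mem] le P by linarith
        then show False using inv a mem stop False unfolding search_inv_def
          by (auto simp del: split_paired_All)
      qed
      then show ?thesis using False by simp
    qed
  qed
  show ?thesis
    unfolding search_def run_Seq run_Do
  proof (rule run_for_list[where todo = todo_n and xs = "all_nodes \<sigma>" and k = 1 and
        Inv = "\<lambda>D s. built I s \<and> core s = core \<sigma> \<and> (\<forall>i\<in>set D. \<not> labelled s i)"], goal_cases)
    case (4 t s)
    let ?s = "s\<lparr>labelled := (labelled s)(Src := True), work := [adj s Src]\<rparr>"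
    have Src: "Src \<in> pverts (star I)" by (simp add: star_verts)
    have s: "built I s" "core s = core \<sigma>" "\<And>i. i \<in> pverts (star I) \<Longrightarrow> \<not> labelled s i" using 4 nodes by auto
    have lab: "labelled ?s i \<longleftrightarrow> i = Src" if "i \<in> pverts (star I)" for i using s(3)[OF that] by simp
    have "labels_ok ?s"
      unfolding labels_ok_def using lab by (auto intro!: exI[of _ "[]"])
    moreover have "labelled ?s (rtail a) \<longleftrightarrow> rtail a = Src" if "fst a \<in> parcs (star I)" for a
      using lab rarc_verts[OF that] by blast
    moreover have "set (concat (work ?s)) = {a. fst a \<in> parcs (star I) \<and> rtail a = Src}"
      using adj_set[OF s(1) Src] by simp
    moreover have "built I ?s" "labelled ?s Src" using s(1) by auto
    ultimately have inv: "search_inv ?s" unfolding search_inv_def by blast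
    have "{i \<in> pverts (star I). \<not> labelled ?s i} = pverts (star I) - {Src}" using lab by blast
    \<comment> \<open>The one list on the stack stands for the share of \<open>Src\<close>, so the
      potential is a sum over all nodes.\<close>
    then have "search_pot ?s = (\<Sum>i\<in>pverts (star I). length (adj s i) + 1)"
      using sum.remove[OF finite_star_verts Src, of "\<lambda>i. length (adj s i) + 1"]
      by (simp add: search_pot_def)
    also have "\<dots> = 2 * mstar I + card (VV I) + 2"
      unfolding sum.distrib sum_length_adj[OF s(1)] by (simp add: card_nodes)
    finally have pot: "search_pot ?s = 2 * mstar I + card (VV I) + 2" .
    have "core ?s = core \<sigma>" using s(2) by (simp add: core_def)
    show ?case
    proof (rule run_mono[OF run_search_loop[OF inv]], goal_cases)
      case (1 t' \<tau>)
      then show ?case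
        using final[of t' \<tau>] 4 \<open>core ?s = core \<sigma>\<close> nodes(2) unfolding pot by (auto simp: input_size_def)
    qed
  qed (use built in \<open>auto simp: run_simps core_def\<close>)
qed

text \<open>Induction from the end of \<open>Q\<close>, as the labels lead backwards.
  \<open>Src\<close> is not a head, so the loop cannot stop before the path is exhausted.\<close>

lemma run_amount:
  assumes "rwalk Src Q i" "\<forall>a\<in>set Q. via \<sigma> (rhead a) = a" "Src \<notin> rhead ` set Q" "at_node \<sigma> = i"
    "\<And>\<tau> m. \<tau> = \<sigma>\<lparr>at_node := Src, amount := m\<rparr> \<Longrightarrow>
      m = Min (insert (amount \<sigma>) (rescap (link_cap \<sigma>) (flw \<sigma>) ` set Q)) \<Longrightarrow> R (2 * length Q + 1) \<tau>"
  shows "run (WHILE (\<lambda>\<sigma>. at_node \<sigma> \<noteq> Src) DO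
        Do (\<lambda>\<sigma>. let a = via \<sigma> (at_node \<sigma>) in
          \<sigma>\<lparr>amount := min (amount \<sigma>) (rescap (link_cap \<sigma>) (flw \<sigma>) a), at_node := rtail a\<rparr>)) \<sigma> R"
  using assms
proof (induction Q arbitrary: i \<sigma> R rule: rev_induct)
  case Nil
  have "\<sigma> = \<sigma>\<lparr>at_node := Src, amount := amount \<sigma>\<rparr>" using Nil by simp
  from Nil.prems(5)[OF this] show ?case using Nil by (intro run_While_done) auto
next
  case (snoc a Q)
  then have a: "rhead a = i" "rwalk Src Q (rtail a)" "i \<noteq> Src" "via \<sigma> i = a"
    by (auto simp: rwalk_snoc)
  let ?\<sigma> = "\<sigma>\<lparr>amount := min (amount \<sigma>) (rescap (link_cap \<sigma>) (flw \<sigma>) a), at_node := rtail a\<rparr>"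
  show ?case
  proof (rule run_While_step)
    show "at_node \<sigma> \<noteq> Src" using a snoc.prems by simp
    have "run (WHILE (\<lambda>\<sigma>. at_node \<sigma> \<noteq> Src) DO
        Do (\<lambda>\<sigma>. let a = via \<sigma> (at_node \<sigma>) in
          \<sigma>\<lparr>amount := min (amount \<sigma>) (rescap (link_cap \<sigma>) (flw \<sigma>) a), at_node := rtail a\<rparr>)) ?\<sigma>
        (\<lambda>t. R (1 + 1 + t))"
    proof (rule snoc.IH[OF a(2)])
      fix \<tau> m
      assume "\<tau> = ?\<sigma>\<lparr>at_node := Src, amount := m\<rparr>"
        "m = Min (insert (amount ?\<sigma>) (rescap (link_cap ?\<sigma>) (flw ?\<sigma>) ` set Q))"
      moreover have "Min (insert (min u v) X) = Min (insert u (insert v X))" if "finite X" for u v :: int and X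
        using that by (cases "X = {}") (auto simp: min.assoc)
      ultimately show "R (1 + 1 + (2 * length Q + 1)) \<tau>" using snoc.prems(5)[of \<tau> m] by simp
    qed (use snoc.prems in auto)
    then show "run (Do (\<lambda>\<sigma>. let a = via \<sigma> (at_node \<sigma>) in
          \<sigma>\<lparr>amount := min (amount \<sigma>) (rescap (link_cap \<sigma>) (flw \<sigma>) a), at_node := rtail a\<rparr>)) \<sigma>
        (\<lambda>t s'. run (WHILE (\<lambda>\<sigma>. at_node \<sigma> \<noteq> Src) DO
        Do (\<lambda>\<sigma>. let a = via \<sigma> (at_node \<sigma>) in
          \<sigma>\<lparr>amount := min (amount \<sigma>) (rescap (link_cap \<sigma>) (flw \<sigma>) a), at_node := rtail a\<rparr>)) s'
        (\<lambda>t'. R (1 + t + t')))"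
      using a snoc.prems(4) by (simp add: run_Do Let_def)
  qed
qed

text \<open>\<open>distinct Q\<close> makes the one change per visited arc agree with the membership
  tests of \<open>augment\<close>.\<close>

lemma run_shift:
  assumes "rwalk Src Q i" "\<forall>a\<in>set Q. via \<sigma> (rhead a) = a" "Src \<notin> rhead ` set Q" "at_node \<sigma> = i"
    "distinct Q"
    "\<And>\<tau> f. \<tau> = \<sigma>\<lparr>at_node := Src, flw := f\<rparr> \<Longrightarrow>
      f = (\<lambda>e. flw \<sigma> e + (if (e, True) \<in> set Q then amount \<sigma> else 0)
          - (if (e, False) \<in> set Q then amount \<sigma> else 0)) \<Longrightarrow> R (2 * length Q + 1) \<tau>"
  shows "run (WHILE (\<lambda>\<sigma>. at_node \<sigma> \<noteq> Src) DO
        Do (\<lambda>\<sigma>. let a = via \<sigma> (at_node \<sigma>); e = fst a in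
          \<sigma>\<lparr>flw := (flw \<sigma>)(e := (if snd a then flw \<sigma> e + amount \<sigma> else flw \<sigma> e - amount \<sigma>)),
            at_node := rtail a\<rparr>)) \<sigma> R"
  using assms
proof (induction Q arbitrary: i \<sigma> R rule: rev_induct)
  case Nil
  have "\<sigma> = \<sigma>\<lparr>at_node := Src, flw := flw \<sigma>\<rparr>" using Nil by simp
  from Nil.prems(6)[OF this] show ?case using Nil by (intro run_While_done) auto
next
  case (snoc a Q)
  then have a: "rhead a = i" "rwalk Src Q (rtail a)" "i \<noteq> Src" "via \<sigma> i = a" "a \<notin> set Q" "distinct Q"
    by (auto simp: rwalk_snoc)
  let ?f = "(flw \<sigma>)(fst a := (if snd a then flw \<sigma> (fst a) + amount \<sigma> else flw \<sigma> (fst a) - amount \<sigma>))"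
  let ?\<sigma> = "\<sigma>\<lparr>flw := ?f, at_node := rtail a\<rparr>"
  show ?case
  proof (rule run_While_step)
    show "at_node \<sigma> \<noteq> Src" using a snoc.prems by simp
    have "run (WHILE (\<lambda>\<sigma>. at_node \<sigma> \<noteq> Src) DO
        Do (\<lambda>\<sigma>. let a = via \<sigma> (at_node \<sigma>); e = fst a in
          \<sigma>\<lparr>flw := (flw \<sigma>)(e := (if snd a then flw \<sigma> e + amount \<sigma> else flw \<sigma> e - amount \<sigma>)),
            at_node := rtail a\<rparr>)) ?\<sigma> (\<lambda>t. R (1 + 1 + t))"
    proof (rule snoc.IH[OF a(2)])
      fix \<tau> f
      assume "\<tau> = ?\<sigma>\<lparr>at_node := Src, flw := f\<rparr>"
        "f = (\<lambda>e. flw ?\<sigma> e + (if (e, True) \<in> set Q then amount ?\<sigma> else 0)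
          - (if (e, False) \<in> set Q then amount ?\<sigma> else 0))"
      moreover from this(2) have "f = (\<lambda>e. flw \<sigma> e + (if (e, True) \<in> set (Q @ [a]) then amount \<sigma> else 0)
          - (if (e, False) \<in> set (Q @ [a]) then amount \<sigma> else 0))"
        using a(5) by (cases a; cases "snd a") (auto simp: fun_eq_iff cong: if_cong)
      ultimately show "R (1 + 1 + (2 * length Q + 1)) \<tau>" using snoc.prems(6)[of \<tau> f] by simp
    qed (use snoc.prems a in auto)
    then show "run (Do (\<lambda>\<sigma>. let a = via \<sigma> (at_node \<sigma>); e = fst a in
          \<sigma>\<lparr>flw := (flw \<sigma>)(e := (if snd a then flw \<sigma> e + amount \<sigma> else flw \<sigma> e - amount \<sigma>)),
            at_node := rtail a\<rparr>)) \<sigma>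
        (\<lambda>t s'. run (WHILE (\<lambda>\<sigma>. at_node \<sigma> \<noteq> Src) DO
        Do (\<lambda>\<sigma>. let a = via \<sigma> (at_node \<sigma>); e = fst a in
          \<sigma>\<lparr>flw := (flw \<sigma>)(e := (if snd a then flw \<sigma> e + amount \<sigma> else flw \<sigma> e - amount \<sigma>)),
            at_node := rtail a\<rparr>)) s' (\<lambda>t'. R (1 + t + t')))"
      using a snoc.prems(4) by (simp add: run_Do Let_def split del: if_split cong: if_cong)
  qed
qed

lemma run_augment_found:
  assumes st: "flow_state \<sigma> x" and P: "found_path \<sigma> P" "augmenting_path I \<alpha> x P"
  shows "run augment_found \<sigma> (\<lambda>t \<tau>. t \<le> 7 * input_size \<and> flow_state \<tau> (augment x (path_cap I x P) P) \<and>
    level \<tau> = level \<sigma> \<and> scale \<tau> = scale \<sigma>)"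
proof -
  have built: "built I \<sigma>" and x: "flow_of \<sigma> = x" "is_flow I x" and val: "real_of_int (fval \<sigma>) = flow_val I x"
    using st by (auto simp: flow_state_def)
  let ?r = "rescap (link_cap \<sigma>) (flw \<sigma>)"
  let ?m = "Min (?r ` set P)"
  have walk: "rwalk Src P Snk" "\<forall>a\<in>set P. via \<sigma> (rhead a) = a" "Src \<notin> rhead ` set P" "distinct P"
    using P(1) by (auto simp: found_path_def distinct_map)
  have arcs: "fst a \<in> parcs (star I)" if "a \<in> set P" for a
    using P(2) that star_le_subset unfolding augmenting_path_iff by blast
  note ne = augmenting_path_not_Nil[OF P(2)]
  have len: "length P \<le> card (VV I) + 2"
  proof -
    have "length P = card (rhead ` set P)"
      using P(1) distinct_card[of "map rhead P"] by (simp add: found_path_def)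
    also have "\<dots> \<le> card (pverts (star I))"
      using arcs rarc_verts by (intro card_mono finite_star_verts) blast
    finally show ?thesis by (simp add: card_nodes)
  qed
  have "via \<sigma> Snk \<in> set P"
  proof -
    have "rwalk Src (butlast P @ [last P]) Snk" using walk(1) ne by simp
    then have "rhead (last P) = Snk" by (simp only: rwalk_snoc)
    then show ?thesis using walk(2) ne last_in_set by metis
  qed
  \<comment> \<open>The initial \<open>amount\<close> belongs to an arc of the path, so it does not
    affect the minimum.\<close>
  then have start: "Min (insert (?r (via \<sigma> Snk)) (?r ` set P)) = ?m"
    by (simp add: insert_absorb)
  have cap: "path_cap I x P = real_of_int ?m"
  proof -
    have "path_cap I x P = Min (real_of_int ` ?r ` set P)"
      unfolding path_cap_def image_image using res_flow_of[OF built] arcs x(1)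
      by (intro arg_cong[where f = Min] image_cong) auto
    also have "\<dots> = real_of_int ?m"
      using ne by (intro mono_Min_commute[symmetric]) (auto simp: mono_def)
    finally show ?thesis .
  qed
  have eq: "flow_of (\<sigma>\<lparr>at_node := Src, amount := ?m, flw := f, fval := v\<rparr>) = augment x (path_cap I x P) P"
    if f: "f = (\<lambda>e. flw \<sigma> e + (if (e, True) \<in> set P then ?m else 0)
          - (if (e, False) \<in> set P then ?m else 0))" for f v
  proof
    fix e
    show "flow_of (\<sigma>\<lparr>at_node := Src, amount := ?m, flw := f, fval := v\<rparr>) e = augment x (path_cap I x P) P e"
      unfolding augment_def cap f x(1)[THEN fun_cong, symmetric] using arcs[of "(e, True)"] arcs[of "(e, False)"]
      by (auto simp: flow_of_def)
  qed
  note aug = augment_flow[OF x(2) P(2)]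
  show ?thesis
    unfolding augment_found_def run_Seq run_Do
  proof (rule run_amount[OF walk(1)], goal_cases)
    case (4 \<tau> m)
    then have \<tau>: "\<tau> = \<sigma>\<lparr>at_node := Src, amount := ?m\<rparr>" using start by simp
    show ?case
    proof (rule run_shift[OF walk(1) _ walk(3) _ walk(4)], goal_cases)
      case (3 \<tau>' f)
      have f: "f = (\<lambda>e. flw \<sigma> e + (if (e, True) \<in> set P then ?m else 0)
          - (if (e, False) \<in> set P then ?m else 0))" using 3(2) \<tau> by (simp cong: if_cong)
      have \<tau>': "\<tau>' = \<sigma>\<lparr>at_node := Src, amount := ?m, flw := f\<rparr>" using 3(1) \<tau> by simp
      show ?case
        unfolding \<tau>' flow_state_def using eq[OF f] aug built cap val len by (simp add: input_size_def)
    qed (use walk \<tau> in auto)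
  qed (use walk in auto)
qed

end

section \<open>Running time\<close>

context bnfp
begin

lemma input_size_ge: "2 \<le> input_size"
  by (simp add: input_size_def)

text \<open>Shared by the scales of the maximum flow computation and the phases of the algorithm:
  \<open>J\<close> is what augmentation preserves, \<open>N\<close> bounds the augmentations still
  possible. A round costs at most 12 units for the search, 7 for the augmentation and two single
  steps, hence 21; the extra round in the bound is the first search.\<close>

lemma run_augment_while_large:
  assumes st: "flow_state \<sigma> x" and J: "J x"
    and thr: "\<And>s y. flow_state s y \<Longrightarrow> scale s = scale \<sigma> \<Longrightarrow>
      real_of_int (p s) = pr y \<and> real_of_int (q s) = qr"
    and "0 \<le> qr"
    and step: "\<And>y P. is_flow I y \<Longrightarrow> int_valued y \<Longrightarrow> J y \<Longrightarrow> augmenting_path I (level \<sigma>) y P \<Longrightarrow>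
      pr y \<le> qr * path_cap I y P \<Longrightarrow>
      J (augment y (path_cap I y P) P) \<and> N (augment y (path_cap I y P) P) < (N y :: nat)"
  shows "run (augment_while_large p q) \<sigma> (\<lambda>t \<tau>. \<exists>y. flow_state \<tau> y \<and> J y \<and>
    level \<tau> = level \<sigma> \<and> scale \<tau> = scale \<sigma> \<and>
    (\<nexists>P. augmenting_path I (level \<sigma>) y P \<and> pr y \<le> qr * path_cap I y P) \<and>
    t + 21 * input_size * N y \<le> 21 * input_size * (N x + 1))"
proof -
  define K where "K \<tau> y \<longleftrightarrow> flow_state \<tau> y \<and> level \<tau> = level \<sigma> \<and> scale \<tau> = scale \<sigma> \<and>
    (if labelled \<tau> Snk
     then \<exists>P. found_path \<tau> P \<and> augmenting_path I (level \<sigma>) y P \<and> pr y \<le> qr * path_cap I y P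
     else \<nexists>P. augmenting_path I (level \<sigma>) y P \<and> pr y \<le> qr * path_cap I y P)" for \<tau> y
  have search: "run search (s\<lparr>th_num := p s, th_den := q s\<rparr>) (\<lambda>t \<tau>. t \<le> 12 * input_size \<and> K \<tau> y)"
    if s: "flow_state s y" "level s = level \<sigma>" "scale s = scale \<sigma>" for s y
  proof -
    let ?s = "s\<lparr>th_num := p s, th_den := q s\<rparr>"
    have th: "real_of_int (th_num ?s) = pr y" "real_of_int (th_den ?s) = qr" using thr[OF s(1,3)] by auto
    have "flow_state ?s y" "0 \<le> th_den ?s" using s thr[OF s(1,3)] \<open>0 \<le> qr\<close> by auto
    from run_search[OF this] show ?thesis
      by (rule run_mono) (use s th in \<open>auto simp: K_def core_def\<close>)
  qed
  have loop: "run (WHILE (\<lambda>\<sigma>. labelled \<sigma> Snk) DO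
        (augment_found ;; Do (\<lambda>\<sigma>. \<sigma>\<lparr>th_num := p \<sigma>, th_den := q \<sigma>\<rparr>) ;; search)) s
      (\<lambda>t \<tau>. \<exists>y'. K \<tau> y' \<and> J y' \<and> \<not> labelled \<tau> Snk \<and> t + 21 * input_size * N y' \<le> 21 * input_size * N y + 1)"
    if s: "K s y" "J y" for s y
  proof (rule run_While[where \<Phi> = "\<lambda>s. 21 * input_size * N (flow_of s)" and
        Inv = "\<lambda>s. \<exists>y. K s y \<and> J y"], goal_cases)
    case (1 s)
    then obtain y P where y: "K s y" "J y" "flow_state s y" "level s = level \<sigma>" "scale s = scale \<sigma>"
      and P: "found_path s P" "augmenting_path I (level \<sigma>) y P" "pr y \<le> qr * path_cap I y P"
      by (auto simp: K_def)
    let ?y = "augment y (path_cap I y P) P"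
    have "flow_of s = y" "is_flow I y" using y(3) by (auto simp: flow_state_def)
    then have new: "J ?y" "N ?y < N y" using step[of y P] y(2) P(2,3) flow_of_int_valued by auto
    then have "21 * input_size * (N ?y + 1) \<le> 21 * input_size * N y" by (intro mult_le_mono2) simp
    show ?case
      unfolding run_Seq
    proof (rule run_mono[OF run_augment_found[OF y(3) P(1,2)]], goal_cases)
      case (1 t \<tau>)
      then have \<tau>: "flow_state \<tau> ?y" "level \<tau> = level \<sigma>" "scale \<tau> = scale \<sigma>" using y by auto
      show ?case
        unfolding run_Do
      proof (rule run_mono[OF search[OF \<tau>]], goal_cases)
        case (1 t' \<tau>')
        then have "flow_of \<tau>' = ?y" by (simp add: K_def flow_state_def)
        then show ?case
          using 1 \<open>t \<le> _ \<and> _\<close> \<open>flow_of s = y\<close> new(1) input_size_ge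
            \<open>21 * input_size * (N ?y + 1) \<le> 21 * input_size * N y\<close> by auto
      qed
    qed
  next
    case (3 t s')
    then obtain y' where "K s' y'" "J y'" by auto
    moreover have "flow_of s' = y'" "flow_of s = y"
      using s(1) calculation by (auto simp: K_def flow_state_def)
    ultimately show ?case using 3 by auto
  qed (use s in auto)
  show ?thesis
    unfolding augment_while_large_def run_Seq run_Do
  proof (rule run_mono[OF search[OF st]], goal_cases)
    case (3 t \<tau>)
    then show ?case
    proof (intro run_mono[OF loop[OF _ J]], goal_cases)
      case (2 t' \<tau>')
      then obtain y where "K \<tau>' y" "J y" "\<not> labelled \<tau>' Snk" "t' + 21 * input_size * N y \<le> 21 * input_size * N x + 1"
        by auto
      with 2 input_size_ge show ?case by (intro exI[of _ y]) (auto simp: K_def)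
    qed simp
  qed auto
qed

section \<open>Capacity scaling, counted in binary digits\<close>

abbreviation bits :: "int \<Rightarrow> nat" where
  "bits c \<equiv> floorlog 2 (nat c)"

lemma bits_double: "1 \<le> c \<Longrightarrow> bits (2 * c) = bits c + 1"
  using floorlog_power[of "nat c" 2 1] by (simp add: nat_mult_distrib mult.commute)

lemma bits_half: "1 \<le> c \<Longrightarrow> bits c = bits (c div 2) + 1"
  using compute_floorlog[of 2 "nat c"] by (simp add: nat_div_distrib)

lemma bits_mono: "c \<le> d \<Longrightarrow> bits c \<le> bits d"
  by (intro floorlog_mono) simp

lemma run_scale_up:
  assumes "flow_state \<sigma> x" "scale \<sigma> = 1"
  shows "run (WHILE (\<lambda>\<sigma>. 2 * scale \<sigma> \<le> dem \<sigma>) DO Do (\<lambda>\<sigma>. \<sigma>\<lparr>scale := 2 * scale \<sigma>\<rparr>)) \<sigma>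
    (\<lambda>t \<tau>. t \<le> 2 * bits (demand I) + 1 \<and> flow_state \<tau> x \<and> level \<tau> = level \<sigma> \<and> 1 \<le> scale \<tau> \<and>
      demand I < 2 * scale \<tau> \<and> bits (scale \<tau>) \<le> bits (demand I) + 1)"
proof (rule run_While[where \<Phi> = "\<lambda>s. 2 * (bits (demand I) - bits (scale s))" and
      Inv = "\<lambda>s. flow_state s x \<and> level s = level \<sigma> \<and> 1 \<le> scale s \<and> (scale s \<le> demand I \<or> scale s = 1)"],
    goal_cases)
  case (1 s)
  then have "2 * scale s \<le> demand I" by (auto simp: flow_state_def built_def)
  moreover from this have "bits (2 * scale s) \<le> bits (demand I)" by (rule bits_mono)
  ultimately show ?case using 1 by (simp add: run_Do bits_double)
next
  case (3 t s)
  then have "demand I < 2 * scale s" by (auto simp: flow_state_def built_def)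
  moreover have "bits (scale s) \<le> bits (demand I) + 1"
  proof (cases "scale s = 1")
    \<comment> \<open>If the demand is 0, the scale has one digit and the demand none: the reason
      for the \<open>+ 1\<close>.\<close>
    case True
    then show ?thesis by (simp add: compute_floorlog)
  next
    case False
    with 3 have "scale s \<le> demand I" by auto
    from bits_mono[OF this] show ?thesis by simp
  qed
  ultimately show ?case using 3 by simp
qed (use assms in auto)

lemma star_le_max_weight:
  assumes "built I \<sigma>"
  shows "parcs (star_le I (max_wt \<sigma>)) = parcs (star I)"
proof -
  let ?W = "insert 0 (weight I ` EE I)"
  have W: "finite ?W" using finite_EE by simp
  have max: "max_wt \<sigma> = Max ?W" using assms by (simp add: built_def)
  have "new_weight I \<le> 0" unfolding new_weight_def using W by (intro Min_le) auto
  then have "new_weight I \<le> Max ?W" using Max_ge[OF W, of 0] by simp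
  moreover have "weight I e \<le> Max ?W" if "e \<in> EE I" for e using W that by (intro Max_ge) auto
  ultimately show ?thesis unfolding max star_le_def by (auto simp: star_def)
qed

text \<open>Residual capacities are integers, so those below \<open>c\<close> are at most
  \<open>c - 1\<close>, hence at most twice \<open>c div 2\<close>. This is the invariant of the
  next scale; after \<open>c = 1\<close> it says that no gap remains.\<close>

lemma scale_bound:
  assumes "is_flow I y" "int_valued y" and full: "parcs (star_le I \<alpha>) = parcs (star I)" and c: "(1::int) \<le> c"
    and none: "\<nexists>P. augmenting_path I \<alpha> y P \<and> real_of_int c \<le> path_cap I y P" and z: "is_flow I z"
  shows "flow_val I z \<le> flow_val I y + 2 * real (mstar I) * real_of_int (c div 2)"
proof -
  obtain R where R: "Src \<in> R" "Snk \<notin> R" "R \<subseteq> pverts (star I)"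
    and cut: "\<And>a. fst a \<in> parcs (star_le I \<alpha>) \<Longrightarrow> rtail a \<in> R \<Longrightarrow> rhead a \<notin> R \<Longrightarrow>
      \<not> (0 < res I y a \<and> real_of_int c \<le> res I y a)"
    using no_path_cut[OF none] by blast
  have supp: "supported I \<alpha> w" for w using full by (simp add: supported_def)
  have "flow_val I z - flow_val I y \<le> real (mstar I) * real_of_int (c - 1)"
  proof (rule residual_cut_bound[OF assms(1) supp z supp R])
    show "0 \<le> real_of_int (c - 1)" using c by simp
    fix a assume "fst a \<in> parcs (star_le I \<alpha>)" "rtail a \<in> R" "rhead a \<notin> R"
    note cut[OF this]
    moreover have "res I y a \<in> \<int>" using assms(2) by (cases a) (auto simp: int_valued_def)
    then obtain r where "res I y a = real_of_int r" by (auto elim: Ints_cases)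
    ultimately show "res I y a \<le> real_of_int (c - 1)" using c
      by (simp only: of_int_le_iff of_int_0_less_iff) linarith
  qed
  also have "c - 1 \<le> 2 * (c div 2)" by linarith
  then have "real (mstar I) * real_of_int (c - 1) \<le> real (mstar I) * real_of_int (2 * (c div 2))"
    by (intro mult_left_mono of_int_le_iff[THEN iffD2]) auto
  finally show ?thesis by simp
qed

lemma run_solve_max_flow:
  assumes "built I \<sigma>"
  shows "run solve_max_flow \<sigma> (\<lambda>t \<tau>. t \<le> 60 * (input_size * (mstar I + 1) * (bits (demand I) + 1)) \<and>
    (\<exists>y. flow_state \<tau> y \<and> max_flow I y))"
proof -
  obtain z where z: "max_flow I z" "is_flow I z" using max_flow_exists by (auto simp: max_flow_def)
  let ?v = "flow_val I z" and ?m = "real (mstar I)"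
  \<comment> \<open>Per scale: at most \<open>2 * mstar I\<close> augmentations, the first search,
    and one unit for the steps of the outer loop.\<close>
  let ?cost = "21 * input_size * (2 * mstar I + 2)"
  let ?close = "\<lambda>y c. ?v \<le> flow_val I y + 2 * ?m * real_of_int c"
  have scaling: "run (WHILE (\<lambda>\<sigma>. 1 \<le> scale \<sigma>) DO
        (augment_while_large scale (\<lambda>_. 1) ;; Do (\<lambda>\<sigma>. \<sigma>\<lparr>scale := scale \<sigma> div 2\<rparr>))) s
      (\<lambda>t \<tau>. t \<le> ?cost * bits (scale s) + 1 \<and> (\<exists>y. flow_state \<tau> y \<and> max_flow I y))"
    if s: "flow_state s x" "level s = max_wt s" "1 \<le> scale s" "?close x (scale s)" for s x
  proof (rule run_While[where \<Phi> = "\<lambda>s. ?cost * bits (scale s)" and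
        Inv = "\<lambda>s. \<exists>y. flow_state s y \<and> level s = max_wt s \<and> 0 \<le> scale s \<and> ?close y (scale s)"],
      goal_cases)
    case (1 s)
    then obtain y where y: "flow_state s y" "level s = max_wt s" "?close y (scale s)" and c: "1 \<le> scale s" by auto
    let ?c = "real_of_int (scale s)"
    \<comment> \<open>The gap in units of the scale: every augmentation lowers it by at least
      one.\<close>
    define N where "N y = nat \<lfloor>(?v - flow_val I y) / ?c\<rfloor>" for y
    have "?c > 0" using c by simp
    have full: "parcs (star_le I (level s)) = parcs (star I)"
      using star_le_max_weight[of s] y by (simp add: flow_state_def)
    have "(?v - flow_val I y) / ?c \<le> 2 * ?m" using y(3) \<open>?c > 0\<close> by (simp add: pos_divide_le_eq)
    then have "N y \<le> 2 * mstar I" unfolding N_def by linarith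
    then have "21 * input_size * (N y + 1) \<le> 21 * input_size * (2 * mstar I + 1)"
      by (intro mult_le_mono2) simp
    then have cost: "21 * input_size * (N y + 1) + 21 * input_size \<le> ?cost"
      by (simp add: algebra_simps)
    have "run (augment_while_large scale (\<lambda>_. 1)) s (\<lambda>t \<tau>. \<exists>y'. flow_state \<tau> y' \<and> ?close y' (scale s) \<and>
      level \<tau> = level s \<and> scale \<tau> = scale s \<and>
      (\<nexists>P. augmenting_path I (level s) y' P \<and> ?c \<le> 1 * path_cap I y' P) \<and>
      t + 21 * input_size * N y' \<le> 21 * input_size * (N y + 1))"
    proof (rule run_augment_while_large[OF y(1), where J = "\<lambda>y. ?close y (scale s)" and pr = "\<lambda>_. ?c"])
      fix y P assume y: "is_flow I y" "?close y (scale s)" and P: "augmenting_path I (level s) y P" "?c \<le> 1 * path_cap I y P"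
      let ?y = "augment y (path_cap I y P) P"
      note aug = augment_flow[OF y(1) P(1)]
      have "flow_val I ?y \<le> ?v" using z(1) aug(1) by (simp add: max_flow_def)
      then have "0 \<le> (?v - flow_val I ?y) / ?c" using \<open>?c > 0\<close> by simp
      moreover have "(?v - flow_val I ?y) / ?c + 1 \<le> (?v - flow_val I y) / ?c"
        using aug(2) P(2) \<open>?c > 0\<close> by (simp add: field_simps)
      ultimately have "N ?y < N y" unfolding N_def by linarith
      then show "?close ?y (scale s) \<and> N ?y < N y" using y(2) aug(2,3) by simp
    qed (use y in auto)
    then show ?case
      unfolding run_Seq
    proof (rule run_mono, goal_cases)
      case (1 t \<tau>)
      then obtain y' where y': "flow_state \<tau> y'" "level \<tau> = level s" "scale \<tau> = scale s"
        "\<nexists>P. augmenting_path I (level s) y' P \<and> ?c \<le> path_cap I y' P"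
        "t + 21 * input_size * N y' \<le> 21 * input_size * (N y + 1)" by auto
      have "is_flow I y'" "int_valued y'" "max_wt \<tau> = max_wt s"
        using y'(1) y(1) flow_of_int_valued[of \<tau>] by (auto simp: flow_state_def built_def)
      moreover have "?close y' (scale s div 2)"
        using scale_bound[OF calculation(1,2) full c _ z(2)] y'(4) by simp
      moreover have "?cost * bits (scale s) = ?cost * bits (scale s div 2) + ?cost"
        using bits_half[OF c] by simp
      moreover have "0 \<le> scale s div 2" using c by (simp add: pos_imp_zdiv_nonneg_iff)
      moreover have "t + 2 \<le> ?cost" using y'(5) cost input_size_ge by linarith
      ultimately show ?case
        unfolding run_Do using y' y(2) by auto
    qed
  next
    case (3 t \<tau>)
    then obtain y where y: "flow_state \<tau> y" "0 \<le> scale \<tau>" "?close y (scale \<tau>)" by auto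
    \<comment> \<open>At scale 0 the invariant leaves no gap.\<close>
    moreover from this 3 have "scale \<tau> = 0" by simp
    ultimately have "is_flow I y" "?v \<le> flow_val I y" by (auto simp: flow_state_def)
    then have "max_flow I y" using z(1) unfolding max_flow_def by (meson order.trans)
    with y 3 show ?case by auto
  qed (use s in auto)
  have zero: "flow_state \<tau> (\<lambda>_. 0)" if "built I \<tau>" "\<forall>e\<in>parcs (star I). flw \<tau> e = 0" "fval \<tau> = 0" for \<tau>
    using that zero_is_flow by (auto simp: flow_state_def flow_of_def)
  show ?thesis
    unfolding solve_max_flow_def run_Seq
  proof (rule run_mono[OF run_zero_flow[OF assms]], goal_cases)
    case (1 t1 s1)
    then have s1: "flow_state s1 (\<lambda>_. 0)" using zero by simp
    then have s2: "flow_state (s1\<lparr>level := max_wt s1, scale := 1\<rparr>) (\<lambda>_. 0)" by simp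
    show ?case
      unfolding run_Do
    proof (rule run_mono[OF run_scale_up[OF s2]], goal_cases)
      case (2 t2 s3)
      then have s3: "flow_state s3 (\<lambda>_. 0)" "level s3 = max_wt s1" "1 \<le> scale s3"
        "demand I < 2 * scale s3" "bits (scale s3) \<le> bits (demand I) + 1" by auto
      have "max_wt s1 = max_wt s3" using s1 s3(1) by (simp add: flow_state_def built_def)
      \<comment> \<open>At the start the gap is at most the demand, which is less than twice the
        scale; the factor \<open>mstar I\<close> is at least 1 unless there are no arcs.\<close>
      have close: "?close (\<lambda>_. 0) (scale s3)"
      proof (cases "mstar I = 0")
        case True
        then have "parcs (star I) = {}" using finite_star by simp
        then have "?v = 0" by (simp add: flow_val_def net_out_def)
        with True zero_is_flow show ?thesis by simp
      next
        case False
        have "?v \<le> demand I" using flow_val_le_demand[OF z(2)] .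
        also have "\<dots> \<le> 2 * real_of_int (scale s3)" using s3(4) by linarith
        also have "\<dots> \<le> ?m * (2 * real_of_int (scale s3))" using False s3(3)
          by (intro mult_le_cancel_right1[THEN iffD2]) auto
        finally show ?thesis using zero_is_flow by (simp add: mult.commute mult.left_commute)
      qed
      show ?case
      proof (rule run_mono[OF scaling[OF s3(1) _ s3(3) close]], goal_cases)
        case (2 t3 s4)
        define L where "L = bits (demand I) + 1"
        define X where "X = input_size * (mstar I + 1) * L"
        have "?cost * bits (scale s3) \<le> ?cost * L" using s3(5) unfolding L_def by (rule mult_le_mono2)
        also have "\<dots> = 42 * X" by (simp add: X_def algebra_simps)
        finally have "t3 \<le> 42 * X + 1" using 2 by simp
        moreover have "input_size * 1 * 1 \<le> X" "1 * 1 * L \<le> X"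
          unfolding X_def L_def using input_size_ge by (intro mult_le_mono; simp)+
        moreover have "t1 \<le> 3 * input_size" "t2 \<le> 2 * L"
          using \<open>t1 \<le> _ \<and> _\<close> \<open>t2 \<le> _ \<and> _\<close> by (auto simp: L_def)
        ultimately have "t1 + (1 + (t2 + t3)) \<le> 60 * X" using input_size_ge by linarith
        then show ?case using 2 unfolding X_def L_def by simp
      qed (use s3 \<open>max_wt s1 = max_wt s3\<close> in simp)
    qed simp
  qed
qed

section \<open>Counting the augmentations of all phases\<close>

text \<open>Bounds the number of augmentations that can still happen before the flow is saturated: each of them
  removes at least the fraction \<open>1/m\<^sup>*\<close> of the deficit.\<close>

definition deficit_pot :: "'v flow \<Rightarrow> nat" where
  "deficit_pot y = (let d = demand I - flow_val I y in
     if d \<le> 0 then 0 else 1 + nat \<lfloor>real (mstar I) * ln d\<rfloor>)"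

text \<open>With path capacity \<open>c\<close> and deficit \<open>d\<close>,
  \<open>ln (1 - c / d) \<le> - c / d \<le> - 1 / mstar I\<close>. Unless the deficit becomes 0, it
  stays at least 1 by integrality, so the logarithm is nonnegative and \<open>nat\<close> cuts
  nothing off.\<close>

lemma deficit_pot_augment:
  assumes y: "is_flow I y" "int_valued y" and P: "augmenting_path I \<alpha> y P"
    and large: "demand I - flow_val I y \<le> real (mstar I) * path_cap I y P"
  shows "deficit_pot (augment y (path_cap I y P) P) < deficit_pot y"
proof -
  let ?c = "path_cap I y P" and ?m = "real (mstar I)"
  define d where "d = demand I - flow_val I y"
  note aug = augment_flow[OF y(1) P]
  have d': "demand I - flow_val I (augment y ?c P) = d - ?c" using aug(2) by (simp add: d_def)
  have "0 \<le> d - ?c" using flow_val_le_demand[OF aug(1)] d' by simp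
  with aug(3) have "0 < d" by linarith
  show ?thesis
  proof (cases "d - ?c \<le> 0")
    \<comment> \<open>The last augmentation, from a positive deficit to 0, is paid by the
      \<open>1 +\<close> in \<open>deficit_pot\<close>.\<close>
    case True
    with \<open>0 < d\<close> show ?thesis unfolding deficit_pot_def d' d_def[symmetric] by simp
  next
    case False
    have "d - ?c \<in> \<int>"
      using flow_val_Ints[OF y(2)] augment_int_valued(2)[OF y(2) P] by (simp add: d_def)
    then obtain j where j: "d - ?c = real_of_int j" by (auto elim: Ints_cases)
    with False have "1 \<le> j" by simp
    with j have one: "1 \<le> d - ?c" by simp
    have "ln (d - ?c) - ln d = ln ((d - ?c) / d)" using False \<open>0 < d\<close> by (simp add: ln_div)
    also have "\<dots> \<le> (d - ?c) / d - 1" using False \<open>0 < d\<close> by (intro ln_le_minus_one) simp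
    also have "\<dots> = - ?c / d" using \<open>0 < d\<close> by (simp add: field_simps)
    finally have "?m * (ln (d - ?c) - ln d) \<le> ?m * (- ?c / d)" by (intro mult_left_mono) auto
    also have "\<dots> \<le> - 1" using large \<open>0 < d\<close> by (simp add: d_def[symmetric] field_simps)
    finally have "?m * ln (d - ?c) + 1 \<le> ?m * ln d" by (simp add: algebra_simps)
    moreover have "0 \<le> ?m * ln (d - ?c)" using one by simp
    ultimately have "nat \<lfloor>?m * ln (d - ?c)\<rfloor> < nat \<lfloor>?m * ln d\<rfloor>" by linarith
    with False \<open>0 < d\<close> show ?thesis unfolding deficit_pot_def d' d_def[symmetric] by simp
  qed
qed

section \<open>Successive levels and the phases of the program\<close>

abbreviation higher :: "int \<Rightarrow> int set" where
  "higher l \<equiv> {w \<in> weight I ` EE I. l < w}"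

lemma higher_nth_weight:
  assumes "1 \<le> k" "k < num_weights I"
  shows "higher (nth_weight I k) \<noteq> {}" "Min (higher (nth_weight I k)) = nth_weight I (Suc k)"
proof -
  have mem: "nth_weight I (Suc k) \<in> higher (nth_weight I k)"
    using assms nth_weight_mem[of "Suc k"] nth_weight_less[of k "Suc k"] by simp
  then show "higher (nth_weight I k) \<noteq> {}" by blast
  show "Min (higher (nth_weight I k)) = nth_weight I (Suc k)"
  proof (rule Min_eqI)
    fix w assume "w \<in> higher (nth_weight I k)"
    then show "nth_weight I (Suc k) \<le> w"
      using weight_less_nth[of w "Suc k"] assms by (cases "w < nth_weight I (Suc k)") auto
  qed (use finite_EE mem in auto)
qed

text \<open>The program starts one below a lower bound of all weights, so that raising the level for
  the first time yields the first weight.\<close>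

lemma higher_new_weight:
  assumes "EE I \<noteq> {}"
  shows "higher (new_weight I - 1) \<noteq> {}" "Min (higher (new_weight I - 1)) = nth_weight I 1"
proof -
  have all: "higher (new_weight I - 1) = weight I ` EE I" using new_weight_le by force
  have one: "1 \<le> num_weights I" using assms finite_EE by (simp add: Suc_le_eq card_gt_0_iff)
  show "higher (new_weight I - 1) \<noteq> {}" using all assms by simp
  show "Min (higher (new_weight I - 1)) = nth_weight I 1"
    unfolding all
  proof (rule Min_eqI)
    fix w assume "w \<in> weight I ` EE I"
    then show "nth_weight I 1 \<le> w"
      using weight_less_nth[of w 1] one by (cases "w < nth_weight I 1") auto
  qed (use finite_EE nth_weight_mem[of 1] one in auto)
qed

lemma run_raise_level:
  assumes st: "flow_state \<sigma> x"
  shows "run raise_level \<sigma> (\<lambda>t \<tau>. t \<le> 4 * input_size \<and> flow_state \<tau> x \<and>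
    (higher (level \<sigma>) \<noteq> {} \<longrightarrow> level \<tau> = Min (higher (level \<sigma>))))"
proof -
  have built: "built I \<sigma>" using st by (simp add: flow_state_def)
  then have load: "distinct (in_arcs \<sigma>)" "set (in_arcs \<sigma>) = EE I" by (auto simp: built_def loaded_def)
  then have len: "length (in_arcs \<sigma>) = card (EE I)" using distinct_card by metis
  let ?H = "\<lambda>A. {w \<in> weight I ` A. level \<sigma> < w}"
  show ?thesis
    unfolding raise_level_def run_Seq run_Do
  proof (rule run_for_list[where todo = todo_a and xs = "in_arcs \<sigma>" and k = 1 and
        Inv = "\<lambda>D s. flow_state s x \<and> level s = level \<sigma> \<and>
          new_level s = Min (insert (max_wt \<sigma>) (?H (set D)))"], goal_cases)
    case (3 D e r s)
    have e: "e \<in> EE I" using 3(1) load by auto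
    then have w: "in_weight s e = weight I e" "weight I e \<le> max_wt \<sigma>"
      using 3 built finite_EE by (auto simp: flow_state_def built_def loaded_def)
    have fin: "finite (?H (set D))" by simp
    have upd: "Min (insert (max_wt \<sigma>) (?H (set (D @ [e])))) =
      (if level \<sigma> < weight I e \<and> weight I e < new_level s then weight I e else new_level s)"
    proof (cases "level \<sigma> < weight I e")
      case True
      then have "insert (max_wt \<sigma>) (?H (set (D @ [e]))) = insert (weight I e) (insert (max_wt \<sigma>) (?H (set D)))"
        by auto
      moreover have "Min (insert (weight I e) (insert (max_wt \<sigma>) (?H (set D)))) = min (weight I e) (new_level s)"
        using 3(3) by (subst Min_insert) auto
      ultimately show ?thesis using True by (simp add: min_def)
    next
      case False
      then have "?H (set (D @ [e])) = ?H (set D)" by auto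
      with False 3(3) show ?thesis by simp
    qed
    show ?case
      unfolding run_Do Let_def upd using 3(2) conjunct1[OF 3(3)] conjunct1[OF conjunct2[OF 3(3)]] w(1)
      by simp
  next
    case (4 t s)
    then have lev: "new_level s = Min (insert (max_wt \<sigma>) (higher (level \<sigma>)))" using load by simp
    \<comment> \<open>\<open>max_wt\<close> is the start value of the running minimum; it is at
      least every weight and drops out once some weight is higher.\<close>
    have "Min (insert (max_wt \<sigma>) (higher (level \<sigma>))) = Min (higher (level \<sigma>))" if ne: "higher (level \<sigma>) \<noteq> {}"
    proof -
      have fin: "finite (higher (level \<sigma>))" using finite_EE by simp
      have "Min (higher (level \<sigma>)) \<in> higher (level \<sigma>)" using fin ne by (rule Min_in)
      then have "Min (higher (level \<sigma>)) \<le> max_wt \<sigma>" using built finite_EE by (auto simp: built_def)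
      then show ?thesis unfolding Min_insert[OF fin ne] by (rule min_absorb2)
    qed
    with 4 lev len card_EE_le show ?case by (simp add: input_size_def)
  qed (use st in auto)
qed

text \<open>The program clears the denominator. This is sound since a path contains an arc, so
  \<open>mstar I\<close> is positive.\<close>

lemma large_path_iff:
  assumes "is_flow I y" "augmenting_path I l y = augmenting_path I (nth_weight I k) y"
  shows "large_path I k y P \<longleftrightarrow>
    augmenting_path I l y P \<and> demand I - flow_val I y \<le> real (mstar I) * path_cap I y P"
proof (cases "augmenting_path I l y P")
  case True
  then obtain a where "fst a \<in> parcs (star_le I l)"
    using augmenting_path_not_Nil[OF True] unfolding augmenting_path_iff by (cases P) auto
  then have "parcs (star I) \<noteq> {}" using star_le_subset by blast
  then have "0 < real (mstar I)" using finite_star by (simp add: card_gt_0_iff)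
  then show ?thesis
    unfolding large_path_def assms(2)[symmetric] by (simp add: pos_divide_le_eq mult.commute)
next
  case False
  then show ?thesis unfolding large_path_def assms(2)[symmetric] by simp
qed

text \<open>With reachability of \<open>Phase k y\<close> as the preserved property, every
  augmentation of the program becomes a step of the abstract algorithm. Beyond what
  \<open>deficit_pot\<close> pays, a phase costs 4 units for the level and 21 for its first
  search.\<close>

lemma run_phase:
  assumes st: "flow_state \<sigma> x" and reach: "(lcap_step I)\<^sup>*\<^sup>* Start (Phase k x)"
    and next_level: "EE I \<noteq> {} \<Longrightarrow> higher (level \<sigma>) \<noteq> {} \<and> Min (higher (level \<sigma>)) = nth_weight I k"
    and no_arcs: "EE I = {} \<Longrightarrow> parcs (star I) = {}"
  shows "run phase \<sigma> (\<lambda>t \<tau>. \<exists>y. flow_state \<tau> y \<and> (lcap_step I)\<^sup>*\<^sup>* Start (Phase k y) \<and>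
    (\<nexists>P. large_path I k y P) \<and> (EE I \<noteq> {} \<longrightarrow> level \<tau> = nth_weight I k) \<and>
    t + 21 * input_size * deficit_pot y \<le> 25 * input_size + 21 * input_size * deficit_pot x)"
  unfolding phase_def run_Seq
proof (rule run_mono[OF run_raise_level[OF st]], goal_cases)
  case (1 t1 s)
  then have s: "flow_state s x" and lev: "EE I \<noteq> {} \<Longrightarrow> level s = nth_weight I k" using next_level by auto
  \<comment> \<open>Without arcs the level need not equal the unspecified \<open>nth_weight\<close>,
    but then no threshold graph has a path.\<close>
  have same: "augmenting_path I (level s) y = augmenting_path I (nth_weight I k) y" for y
  proof (cases "EE I = {}")
    case True
    then have "parcs (star_le I \<alpha>) = {}" for \<alpha> using no_arcs star_le_subset by blast
    then have "\<not> augmenting_path I \<alpha> y P" for \<alpha> P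
      using augmenting_path_not_Nil[of I \<alpha> y P] hd_in_set[of P] unfolding augmenting_path_iff by blast
    then show ?thesis by (simp add: fun_eq_iff)
  qed (simp add: lev)
  have thr: "real_of_int (dem s' - fval s') = demand I - flow_val I y \<and> real_of_int (num_links s') = real (mstar I)"
    if "flow_state s' y" for s' y
    using that by (auto simp: flow_state_def built_def links_ok_def)
  show ?case
  proof (rule run_mono[OF run_augment_while_large[OF s, where
          J = "\<lambda>y. (lcap_step I)\<^sup>*\<^sup>* Start (Phase k y)" and N = deficit_pot and
          pr = "\<lambda>y. demand I - flow_val I y" and qr = "real (mstar I)", OF reach]], goal_cases)
    case (3 y P)
    then have "large_path I k y P" using large_path_iff[OF 3(1) same] by simp
    then have "lcap_step I (Phase k y) (Phase k (augment y (path_cap I y P) P))" by (rule lcap_step.augment)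
    with 3 deficit_pot_augment show ?case by (meson rtranclp.rtrancl_into_rtrancl)
  next
    case (4 t2 \<tau>)
    then obtain y where y: "flow_state \<tau> y" "(lcap_step I)\<^sup>*\<^sup>* Start (Phase k y)" "level \<tau> = level s"
      "\<nexists>P. augmenting_path I (level s) y P \<and> demand I - flow_val I y \<le> real (mstar I) * path_cap I y P"
      "t2 + 21 * input_size * deficit_pot y \<le> 21 * input_size * (deficit_pot x + 1)" by auto
    have "is_flow I y" using y(1) by (simp add: flow_state_def)
    then have "\<nexists>P. large_path I k y P" using y(4) large_path_iff[OF _ same] by simp
    then show ?case using y lev 1 by (intro exI[of _ y]) auto
  qed (use thr in auto)
qed

lemma run_write_output:
  assumes st: "flow_state \<sigma> x"
  shows "run write_output \<sigma> (\<lambda>t \<tau>. t \<le> 4 * input_size \<and> answer I \<tau> = Output (restrict_flow I x))"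
proof -
  have built: "built I \<sigma>" and x: "flow_of \<sigma> = x" using st by (auto simp: flow_state_def)
  then have load: "distinct (in_arcs \<sigma>)" "set (in_arcs \<sigma>) = EE I" by (auto simp: built_def loaded_def)
  then have len: "length (in_arcs \<sigma>) = card (EE I)" using distinct_card by metis
  show ?thesis
    unfolding write_output_def run_Seq run_Do
  proof (rule run_for_list[where todo = todo_a and xs = "in_arcs \<sigma>" and k = 1 and
        Inv = "\<lambda>D s. flw s = flw \<sigma> \<and> \<not> no_sol s \<and>
          (\<forall>e\<in>set D. sol s e = flw \<sigma> (Vtx (fst e), Vtx (snd e)))"], goal_cases)
    case (4 t s)
    have "(Vtx (fst e), Vtx (snd e)) \<in> parcs (star I)" if "e \<in> EE I" for e
      using that by (force simp: star_def)
    then have "answer I s = Output (restrict_flow I x)"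
      using 4 load by (auto simp: answer_def restrict_flow_def x[symmetric] flow_of_def)
    then show ?case using 4 len card_EE_le by (simp add: input_size_def)
  qed (auto simp: run_Do Let_def)
qed

text \<open>The answer is a configuration reached by the abstract algorithm; for an output, the
  invariant gives correctness. The potential of the phase loop has two parts:
  \<open>deficit_pot\<close> pays the augmentations of all phases together, and the number of
  weights above the level pays the overhead of each phase.\<close>

lemma run_lcap_program:
  assumes "loaded I \<sigma>"
  shows "run lcap_program \<sigma> (\<lambda>t \<tau>. (lcap_step I)\<^sup>*\<^sup>* Start (answer I \<tau>) \<and> correct_answer I (answer I \<tau>) \<and>
    t \<le> 50 * input_size + 60 * (input_size * (mstar I + 1) * (bits (demand I) + 1)) +
      21 * input_size * deficit_pot (\<lambda>_. 0) + 30 * input_size * num_weights I)"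
  unfolding lcap_program_def run_Seq
proof (rule run_mono[OF run_build[OF assms]], goal_cases)
  case (1 t1 s1)
  let ?X = "input_size * (mstar I + 1) * (bits (demand I) + 1)"
  from 1 have "built I s1" by simp
  show ?case
  proof (rule run_mono[OF run_solve_max_flow[OF \<open>built I s1\<close>]], goal_cases)
    case (1 t2 s2)
    then obtain z where z: "flow_state s2 z" "max_flow I z" by auto
    then have vals: "dem s2 = demand I" "real_of_int (fval s2) = flow_val I z" and "built I s2"
      by (auto simp: flow_state_def built_def)
    show ?case
    proof (cases "fval s2 < dem s2")
      case True
      then have "flow_val I z < demand I" using vals by linarith
      then have "lcap_step I Start Infeasible" by (rule lcap_step.infeasible[OF z(2)])
      moreover have "\<nexists>x. feasible I x"
        using feasible_iff_max_flow[OF z(2)] \<open>flow_val I z < demand I\<close> by simp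
      ultimately show ?thesis
        using True 1 \<open>t1 \<le> _ \<and> _\<close> input_size_ge by (auto simp: run_simps answer_def)
    next
      case False
      then have "\<not> flow_val I z < demand I" using vals by linarith
      then have reach: "(lcap_step I)\<^sup>*\<^sup>* Start (Phase 1 (\<lambda>_. 0))"
        by (intro r_into_rtranclp lcap_step.init[OF z(2)])
      \<comment> \<open>An instance without arcs that passes the feasibility test has no demand,
        hence no new arcs either.\<close>
      have no_arcs: "parcs (star I) = {}" if "EE I = {}"
      proof (rule no_arcs_star[OF that])
        have "flow_val I z = 0" using no_arcs_flow_val[OF that] z(2) by (simp add: max_flow_def)
        with \<open>\<not> flow_val I z < demand I\<close> demand_nonneg show "demand I = 0" by linarith
      qed
      have loop: "run (WHILE (\<lambda>\<sigma>. fval \<sigma> \<noteq> dem \<sigma>) DO phase) s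
          (\<lambda>t \<tau>. t \<le> 21 * input_size * deficit_pot y + 30 * input_size * num_weights I + 1 \<and>
            (\<exists>k y. flow_state \<tau> y \<and> (lcap_step I)\<^sup>*\<^sup>* Start (Phase k y) \<and> (\<nexists>P. large_path I k y P) \<and>
              flow_val I y = demand I))"
        if s: "flow_state s y" "(lcap_step I)\<^sup>*\<^sup>* Start (Phase k y)" "\<nexists>P. large_path I k y P"
          "EE I \<noteq> {} \<longrightarrow> level s = nth_weight I k" for s y k
      proof (rule run_While[where \<Phi> = "\<lambda>s. 21 * input_size * deficit_pot (flow_of s) + 30 * input_size * card (higher (level s))"
            and Inv = "\<lambda>s. \<exists>k y. flow_state s y \<and> (lcap_step I)\<^sup>*\<^sup>* Start (Phase k y) \<and> (\<nexists>P. large_path I k y P) \<and>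
              (EE I \<noteq> {} \<longrightarrow> level s = nth_weight I k)"], goal_cases)
        case (1 s)
        then obtain k y where y: "flow_state s y" "(lcap_step I)\<^sup>*\<^sup>* Start (Phase k y)" "\<nexists>P. large_path I k y P"
          "EE I \<noteq> {} \<longrightarrow> level s = nth_weight I k" "flow_of s = y" by (auto simp: flow_state_def)
        have inv: "lcap_inv (Phase k y)" using lcap_inv_reachable[OF y(2)] .
        have "flow_val I y \<noteq> demand I" using 1(2) y(1) by (auto simp: flow_state_def built_def)
        then have k: "1 \<le> k" "k < num_weights I" using phase_progress[OF inv y(3)] inv by auto
        then have "EE I \<noteq> {}" by auto
        with y have lev: "level s = nth_weight I k" by simp
        have "lcap_step I (Phase k y) (Phase (Suc k) y)"
          using y(3) \<open>flow_val I y \<noteq> demand I\<close> k(2) by (rule lcap_step.next_phase)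
        with y(2) have reach': "(lcap_step I)\<^sup>*\<^sup>* Start (Phase (Suc k) y)" by simp
        have "higher (nth_weight I (Suc k)) \<subset> higher (nth_weight I k)"
          using nth_weight_less[of k "Suc k"] nth_weight_mem[of "Suc k"] k by force
        then have "card (higher (nth_weight I (Suc k))) < card (higher (nth_weight I k))"
          using finite_EE by (intro psubset_card_mono) auto
        then have "30 * input_size * (card (higher (nth_weight I (Suc k))) + 1) \<le> 30 * input_size * card (higher (nth_weight I k))"
          by (intro mult_le_mono2) simp
        then have card: "30 * input_size * card (higher (nth_weight I (Suc k))) + 30 * input_size
            \<le> 30 * input_size * card (higher (nth_weight I k))" by simp
        show ?case
        proof (rule run_mono[OF run_phase[OF y(1) reach']], goal_cases)
          case (3 t \<tau>)
          then obtain y' where y': "flow_state \<tau> y'" "(lcap_step I)\<^sup>*\<^sup>* Start (Phase (Suc k) y')"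
            "\<nexists>P. large_path I (Suc k) y' P" "level \<tau> = nth_weight I (Suc k)"
            "t + 21 * input_size * deficit_pot y' \<le> 25 * input_size + 21 * input_size * deficit_pot y"
            using \<open>EE I \<noteq> {}\<close> by auto
          have "flow_of \<tau> = y'" using y'(1) by (simp add: flow_state_def)
          then have "1 + t + (21 * input_size * deficit_pot (flow_of \<tau>) + 30 * input_size * card (higher (level \<tau>)))
              \<le> 21 * input_size * deficit_pot (flow_of s) + 30 * input_size * card (higher (level s))"
            unfolding y'(4) lev y(5) \<open>flow_of \<tau> = y'\<close> using y'(5) card input_size_ge by linarith
          with y' show ?case by blast
        qed (use higher_nth_weight[OF k] lev \<open>EE I \<noteq> {}\<close> in auto)
      next
        case (3 t \<tau>)
        then obtain k' y' where "flow_state \<tau> y'" "(lcap_step I)\<^sup>*\<^sup>* Start (Phase k' y')" "\<nexists>P. large_path I k' y' P"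
          by blast
        moreover from this(1) 3(2) have "flow_val I y' = demand I"
          by (auto simp: flow_state_def built_def)
        moreover have "card (higher (level s)) \<le> num_weights I"
          using finite_EE by (intro card_mono) auto
        then have "30 * input_size * card (higher (level s)) \<le> 30 * input_size * num_weights I"
          by (rule mult_le_mono2)
        then have "t \<le> 21 * input_size * deficit_pot (flow_of s) + 30 * input_size * num_weights I + 1"
          using 3(3) by linarith
        moreover have "flow_of s = y" using s(1) by (simp add: flow_state_def)
        ultimately show ?case by blast
      qed (use s in blast)
      have "run (zero_flow ;; Do (\<lambda>\<sigma>. \<sigma>\<lparr>level := min_wt \<sigma> - 1\<rparr>) ;;
            phase ;; (WHILE (\<lambda>\<sigma>. fval \<sigma> \<noteq> dem \<sigma>) DO phase) ;; write_output) s2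
        (\<lambda>t \<tau>. (lcap_step I)\<^sup>*\<^sup>* Start (answer I \<tau>) \<and> correct_answer I (answer I \<tau>) \<and>
          t \<le> 34 * input_size + 21 * input_size * deficit_pot (\<lambda>_. 0) + 30 * input_size * num_weights I)"
        unfolding run_Seq
      proof (rule run_mono[OF run_zero_flow[OF \<open>built I s2\<close>]], goal_cases)
        case (1 t3 s3)
        let ?s = "s3\<lparr>level := min_wt s3 - 1\<rparr>"
        have "flow_state s3 (\<lambda>_. 0)" using 1 zero_is_flow by (auto simp: flow_state_def flow_of_def)
        moreover have "min_wt s3 = new_weight I" using 1 by (simp add: built_def)
        ultimately have s: "flow_state ?s (\<lambda>_. 0)" "level ?s = new_weight I - 1" by simp_all
        show ?case
          unfolding run_Do
        proof (rule run_mono[OF run_phase[OF s(1) reach]], goal_cases)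
          case (3 t4 s4)
          then obtain y where y: "flow_state s4 y" "(lcap_step I)\<^sup>*\<^sup>* Start (Phase 1 y)"
            "\<nexists>P. large_path I 1 y P" "EE I \<noteq> {} \<longrightarrow> level s4 = nth_weight I 1"
            "t4 + 21 * input_size * deficit_pot y \<le> 25 * input_size + 21 * input_size * deficit_pot (\<lambda>_. 0)" by auto
          show ?case
          proof (rule run_mono[OF loop[OF y(1-4)]], goal_cases)
            case (1 t5 s5)
            then obtain k x where x: "flow_state s5 x" "(lcap_step I)\<^sup>*\<^sup>* Start (Phase k x)"
              "\<nexists>P. large_path I k x P" "flow_val I x = demand I" by auto
            have out: "(lcap_step I)\<^sup>*\<^sup>* Start (Output (restrict_flow I x))"
              using x(2) lcap_step.finish[OF x(3,4)] by simp
            show ?case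
            proof (rule run_mono[OF run_write_output[OF x(1)]], goal_cases)
              case (1 t6 s6)
              have "correct_answer I (answer I s6)" "(lcap_step I)\<^sup>*\<^sup>* Start (answer I s6)"
                using out lcap_inv_reachable[OF out] 1 by auto
              moreover have "t3 \<le> 3 * input_size" "t6 \<le> 4 * input_size"
                "t5 \<le> 21 * input_size * deficit_pot y + 30 * input_size * num_weights I + 1"
                using 1 \<open>t3 \<le> _ \<and> _\<close> \<open>t5 \<le> _ \<and> _\<close> by auto
              ultimately show ?case using y(5) input_size_ge by auto
            qed
          qed
        qed (use higher_new_weight no_arcs s in auto)
      qed
      then have "run (zero_flow ;; Do (\<lambda>\<sigma>. \<sigma>\<lparr>level := min_wt \<sigma> - 1\<rparr>) ;;
            phase ;; (WHILE (\<lambda>\<sigma>. fval \<sigma> \<noteq> dem \<sigma>) DO phase) ;; write_output) s2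
        (\<lambda>t \<tau>. (lcap_step I)\<^sup>*\<^sup>* Start (answer I \<tau>) \<and> correct_answer I (answer I \<tau>) \<and>
          t1 + (t2 + (1 + t)) \<le> 50 * input_size + 60 * ?X + 21 * input_size * deficit_pot (\<lambda>_. 0) + 30 * input_size * num_weights I)"
        by (rule run_mono) (use 1 \<open>t1 \<le> _ \<and> _\<close> input_size_ge in auto)
      with False show ?thesis by (simp only: run_If if_False)
    qed
  qed
qed

section \<open>Explicit bounds in n, m and B\<close>

lemma demand_le: "demand I \<le> card (VV I) * max_supply I"
proof -
  have bal: "\<bar>bal I i\<bar> \<le> max_supply I" if "i \<in> VV I" for i
    unfolding max_supply_def using that finite_VV by (intro Max_ge) auto
  have "0 \<le> max_supply I" using bal VV_nonempty by force
  have "demand I \<le> (\<Sum>i\<in>sources I. max_supply I)"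
    unfolding demand_def by (rule sum_mono) (use bal in \<open>force simp: sources_def\<close>)
  also have "\<dots> \<le> card (VV I) * max_supply I"
    using \<open>0 \<le> max_supply I\<close> finite_VV
    by (auto intro!: mult_right_mono card_mono simp: sources_def)
  finally show ?thesis .
qed

text \<open>Balances sum to 0, so a nonzero balance takes at least two vertices. Hence the logarithm
  in the time bound is at least 1 and can absorb constants.\<close>

lemma two_le_card_mult_supply:
  assumes "1 \<le> max_supply I"
  shows "2 \<le> int (card (VV I)) * max_supply I"
proof -
  have "card (VV I) \<noteq> 1"
  proof
    assume "card (VV I) = 1"
    then obtain i where "VV I = {i}" by (auto simp: card_1_singleton_iff)
    with sum_bal assms show False by (simp add: max_supply_def)
  qed
  moreover have "card (VV I) \<noteq> 0" using finite_VV VV_nonempty by simp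
  ultimately have "2 * 1 \<le> int (card (VV I)) * max_supply I" using assms by (intro mult_mono) auto
  then show ?thesis by simp
qed

lemma time_bound:
  assumes B: "1 \<le> max_supply I" and K: "card (VV I) \<le> K * card (EE I)"
    and t: "t \<le> 50 * input_size + 60 * (input_size * (mstar I + 1) * (bits (demand I) + 1)) +
      21 * input_size * deficit_pot (\<lambda>_. 0) + 30 * input_size * num_weights I"
  shows "real t \<le> 281 * (2 * real K + 3)\<^sup>2 * real (card (EE I)) ^ 2 *
    log 2 (real (card (VV I)) * real_of_int (max_supply I))"
proof -
  define l where "l = log 2 (real (card (VV I)) * real_of_int (max_supply I))"
  \<comment> \<open>With n vertices and m arcs, \<open>input_size\<close> is at most
    \<open>2 n + m + 2\<close>; \<open>n \<le> K m\<close> and \<open>1 \<le> m\<close> give the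
    factor \<open>2 K + 3\<close>.\<close>
  define A where "A = (2 * real K + 3) * real (card (EE I))"
  have "2 \<le> real_of_int (int (card (VV I)) * max_supply I)"
    using two_le_card_mult_supply[OF B] by linarith
  then have nB: "2 \<le> real (card (VV I)) * real_of_int (max_supply I)" by simp
  then have l: "1 \<le> l" unfolding l_def by (subst le_log_iff) auto
  have "card (EE I) \<noteq> 0" using K finite_VV VV_nonempty by (intro notI) simp
  then have m: "1 \<le> real (card (EE I))" by linarith
  have n: "real (card (VV I)) \<le> real K * real (card (EE I))" using K by (metis of_nat_le_iff of_nat_mult)
  have ms: "real (mstar I) \<le> real (card (EE I)) + real (card (VV I))"
    using mstar_le by (metis of_nat_add of_nat_le_iff)
  have A: "real input_size \<le> A" "real (mstar I + 1) \<le> A" "real (num_weights I) \<le> A" "1 \<le> A"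
  proof -
    have nw: "real (num_weights I) \<le> real (card (EE I))" using card_image_le[OF finite_EE] by simp
    have "0 \<le> real K * real (card (EE I))" by simp
    then show "real input_size \<le> A" "real (mstar I + 1) \<le> A" "real (num_weights I) \<le> A" "1 \<le> A"
      unfolding A_def input_size_def using m n ms nw by (simp_all add: algebra_simps)
  qed
  have dem: "real_of_int (demand I) \<le> real (card (VV I)) * real_of_int (max_supply I)"
    using demand_le by (metis of_int_le_iff of_int_mult of_int_of_nat_eq)
  \<comment> \<open>A positive demand has at most \<open>l + 1\<close> digits, and
    \<open>1 \<le> l\<close> turns \<open>l + 2\<close> into \<open>3 * l\<close>.\<close>
  have bits: "real (bits (demand I) + 1) \<le> 3 * l"
  proof (cases "demand I \<le> 0")
    case True
    then show ?thesis using l by (simp add: floorlog_def)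
  next
    case False
    then have "real (bits (demand I)) \<le> log 2 (demand I) + 1"
      unfolding floorlog_def by (simp add: of_nat_nat)
    also have "log 2 (demand I) \<le> l" unfolding l_def using False dem nB by (subst log_le_cancel_iff) auto
    finally show ?thesis using l by simp
  qed
  have pot: "real (deficit_pot (\<lambda>_. 0)) \<le> A * l"
  proof (cases "demand I \<le> 0")
    case True
    then show ?thesis using l A zero_is_flow by (simp add: deficit_pot_def)
  next
    case False
    then have d: "1 \<le> real_of_int (demand I)" by simp
    \<comment> \<open>The natural logarithm is the binary one times \<open>ln 2\<close>, which is
      less than 1.\<close>
    have "ln (real_of_int (demand I)) \<le> log 2 (demand I)"
      unfolding log_def using d ln_2_less_1 by (simp add: field_simps mult_right_le_one_le)
    also have "\<dots> \<le> l" unfolding l_def using d dem nB by (subst log_le_cancel_iff) auto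
    finally have "real (mstar I) * ln (real_of_int (demand I)) \<le> real (mstar I) * l" by (intro mult_left_mono) auto
    moreover have "0 \<le> real (mstar I) * ln (real_of_int (demand I))" using d by simp
    ultimately have "real (deficit_pot (\<lambda>_. 0)) \<le> 1 + real (mstar I) * l"
      using False zero_is_flow unfolding deficit_pot_def Let_def by simp linarith
    also have "\<dots> \<le> real (mstar I + 1) * l" using l by (simp add: algebra_simps)
    also have "\<dots> \<le> A * l" using A(2) l by (intro mult_right_mono) auto
    finally show ?thesis .
  qed
  have "real t \<le> 50 * real input_size + 60 * (real input_size * real (mstar I + 1) * real (bits (demand I) + 1)) +
      21 * real input_size * real (deficit_pot (\<lambda>_. 0)) + 30 * real input_size * real (num_weights I)"
    using t by (metis (mono_tags) of_nat_le_iff of_nat_add of_nat_mult of_nat_numeral)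
  also have "\<dots> \<le> 50 * (A * A * l) + 60 * (A * A * (3 * l)) + 21 * A * (A * l) + 30 * (A * A * l)"
  proof (intro add_mono)
    have "real input_size * 1 * 1 \<le> A * A * l" using A l by (intro mult_mono) auto
    then show "50 * real input_size \<le> 50 * (A * A * l)" by simp
    show "60 * (real input_size * real (mstar I + 1) * real (bits (demand I) + 1)) \<le> 60 * (A * A * (3 * l))"
      using A bits by (intro mult_left_mono mult_mono) auto
    show "21 * real input_size * real (deficit_pot (\<lambda>_. 0)) \<le> 21 * A * (A * l)"
      using A pot by (intro mult_mono) auto
    have "real input_size * real (num_weights I) * 1 \<le> A * A * l" using A l by (intro mult_mono) auto
    then show "30 * real input_size * real (num_weights I) \<le> 30 * (A * A * l)" by simp
  qed
  \<comment> \<open>\<open>281 = 50 + 60 * 3 + 21 + 30\<close>.\<close>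
  also have "\<dots> = 281 * A\<^sup>2 * l" by (simp add: power2_eq_square)
  finally show ?thesis unfolding A_def l_def by (simp add: power_mult_distrib)
qed

end

theorem theorem3p4:
  shows "(\<forall>I :: 'v bnfp. bnfp_instance I \<longrightarrow> lcap_correct I) \<and>
    (\<forall>K :: nat. \<exists>C :: real. \<forall>(I :: 'v bnfp) \<sigma>. bnfp_instance I \<and> loaded I \<sigma> \<longrightarrow>
       (\<exists>\<tau> T. exec lcap_program \<sigma> T \<tau> \<and>
          (lcap_step I)\<^sup>*\<^sup>* Start (answer I \<tau>) \<and>
          correct_answer I (answer I \<tau>) \<and>
          (1 \<le> max_supply I \<and> card (VV I) \<le> K * card (EE I) \<longrightarrow>
             real T \<le> C * real (card (EE I)) ^ 2
                        * log 2 (real (card (VV I)) * real_of_int (max_supply I)))))"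
proof (intro conjI allI impI)
  fix I :: "'v bnfp"
  assume "bnfp_instance I"
  then show "lcap_correct I" by (intro bnfp.lcap_correct bnfp.intro)
next
  fix K :: nat
  show "\<exists>C :: real. \<forall>(I :: 'v bnfp) \<sigma>. bnfp_instance I \<and> loaded I \<sigma> \<longrightarrow>
       (\<exists>\<tau> T. exec lcap_program \<sigma> T \<tau> \<and>
          (lcap_step I)\<^sup>*\<^sup>* Start (answer I \<tau>) \<and>
          correct_answer I (answer I \<tau>) \<and>
          (1 \<le> max_supply I \<and> card (VV I) \<le> K * card (EE I) \<longrightarrow>
             real T \<le> C * real (card (EE I)) ^ 2
                        * log 2 (real (card (VV I)) * real_of_int (max_supply I))))"
  proof (intro exI[of _ "281 * (2 * real K + 3)\<^sup>2"] allI impI)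
    fix I :: "'v bnfp" and \<sigma>
    assume "bnfp_instance I \<and> loaded I \<sigma>"
    then interpret bnfp I by unfold_locales auto
    have "loaded I \<sigma>" using \<open>bnfp_instance I \<and> loaded I \<sigma>\<close> by simp
    from run_lcap_program[OF this] show "\<exists>\<tau> T. exec lcap_program \<sigma> T \<tau> \<and>
          (lcap_step I)\<^sup>*\<^sup>* Start (answer I \<tau>) \<and>
          correct_answer I (answer I \<tau>) \<and>
          (1 \<le> max_supply I \<and> card (VV I) \<le> K * card (EE I) \<longrightarrow>
             real T \<le> 281 * (2 * real K + 3)\<^sup>2 * real (card (EE I)) ^ 2
                        * log 2 (real (card (VV I)) * real_of_int (max_supply I)))"
      unfolding run_def using time_bound by blast
  qed
qed

end
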